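(* Let $e$ be a positive integer and $q = 3^{2e}$. With $\bm{p}$, $\pi$, $\mathcal{L}_{1}$, $\mathcal{L}_{2}$ as described in the context, put $\mathcal{P}_{1} = \{ \bm{r} \text{ point of } \mathrm{PG}(3,q) : |\mathrm{star}(\bm{r}) \cap \mathcal{L}_{1}| = \tfrac{1}{2}(3^{2e}+1)(3^{2e}-3^{e}) \}$ and $\mathcal{P}_{2} = \{ \bm{r} : |\mathrm{star}(\bm{r}) \cap\mathcal{L}_{1}| = \tfrac{1}{2}(3^{2e}+1) (3^{2e}+3^{e}) \}$. Then the partition of the lines of $\mathrm{PG}(3,q)$ into the four classes $\mathrm{star}(\bm{p})$, $\mathrm{line}(\pi)$, $\mathcal{L}_{1}$, $\mathcal{L}_{2}$ together with the partition of the points into the four classes $\{\bm{p}\}$, $\pi$, $\mathcal{P}_{1}$, $\mathcal{P}_{2}$ is a symmetric tactical decomposition of $\mathrm{PG}(3,q)$.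
   Context: Let $q\equiv 1 \pmod 4$, $q \not\equiv 1\pmod 3$ (this holds for $q=3^{2e}$), $\mathbb{F}=\mathbb{F}_q$, $\mathbb{E}=\mathbb{F}_{q^3}$, $\mathrm{T}(x)=x+x^q+x^{q^2}$ and $\mathrm{N}(x)=x^{q^2+q+1}$ for $x\in\mathbb{E}$. Fix a primitive element $\alpha$ of $\mathbb{E}$, put $\omega=\alpha^{q^2+q+1}$ (a primitive element of $\mathbb{F}$) and $\mu=\alpha^{q-1}$. Let $\chi_2$ be the quadratic character of $\mathbb{E}$ ($\chi_2(0)=0$). Consider $\mathrm{PG}(5,q)$ with underlying $\mathbb{F}$-space $V=\mathbb{E}^2$ and the quadratic form $\mathrm{Q}((u,v))=\mathrm{T}(uv)$; its quadric $\mathcal{Q}$ is a hyperbolic quadric $\mathcal{Q}^+(5,q)$, and $\pi_1=\{\langle (x,0)\rangle : x \in \mathbb{E}^*\}$, $\pi_2=\{\langle(0,y)\rangle : y\in\mathbb{E}^*\}$ are disjoint generators. Let $c:(u,v)\mapsto(\mu u,\mu^{-1}v)$, $z:(u,v)\mapsto(u,\omega^4 v)$ and $G=\langle c,z\rangle$ acting on points of $\mathcal{Q}$. Let $\mathcal{S}=\{a\in\mathbb{E}^*: \mathrm{N}(a)=1,\ \mathrm{T}(a^2)=0\}$ (a set of $q+1$ elements), fix $a_1\in\mathcal{S}$, and let $X_1=\{a\in\mathcal{S}: \chi_2(2\mathrm{T}(a_1a))\neq -1\}$, $X_2=\mathcal{S}\setminus X_1$. Let $\mathcal{T}_1$ be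 the union of the $G$-orbits of the points $\langle(1,a^2)\rangle$, $\langle(1,\omega a^2)\rangle$ for $a\in X_1$ and of the points $\langle(1,\omega^2 a^2)\rangle$, $\langle(1,\omega^3a^2)\rangle$ for $a \in X_2$; let $\mathcal{T}_2$ be the set of points of $\mathcal{Q}$ not in $\pi_1\cup\pi_2\cup\mathcal{T}_1$. Fix a Klein correspondence, i.e. a bijection $\kappa$ from the points of $\mathcal{Q}$ to the lines of $\mathrm{PG}(3,q)$ such that two points are collinear on $\mathcal{Q}$ iff their image lines meet, chosen so that $\kappa(\pi_1)=\mathrm{star}(\bm{p})$ (the set of all lines through a point $\bm{p}$); then $\kappa(\pi_2)=\mathrm{line}(\pi)$ (the set of all lines contained in a plane $\pi$), with $\bm{p}\notin\pi$. Put $\mathcal{L}_1=\kappa(\mathcal{T}_1)$, $\mathcal{L}_2=\kappa(\mathcal{T}_2)$. A tactical decomposition of $\mathrm{PG}(3,q)$ is a partition of the points into point classes and of the lines into line classes such that the number of points of a given point class on a line depends only on the class of the line, and the number of lines of a given line class through a point depends only on the class of the point; it is symmetric if there are equally many point classes and line classes. *)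

theory Defs
  imports
    "HOL-Analysis.Cartesian_Space"
    "HOL-Library.Numeral_Type"
    "HOL-Library.Disjoint_Sets"
    "HOL-Algebra.Bij"
    "HOL-Algebra.Generated_Groups"
begin

section \<open>The cubic extension\<close>

text \<open>
  The type \<open>'k\<close> plays the role of \<open>E\<close>, the field with \<open>q\<^sup>3\<close> elements; its subfield \<open>F\<close> with
  \<open>q\<close> elements is the set of elements fixed by \<open>x \<mapsto> x ^ q\<close>.
\<close>

definition base_field :: "nat \<Rightarrow> 'k::field set" where
  "base_field q = {x. x ^ q = x}"

definition Tr :: "nat \<Rightarrow> 'k::field \<Rightarrow> 'k" where
  "Tr q x = x + x ^ q + x ^ (q\<^sup>2)"

definition Nm :: "nat \<Rightarrow> 'k::field \<Rightarrow> 'k" where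
  "Nm q x = x ^ (q\<^sup>2 + q + 1)"

definition primitive_element :: "'k::field \<Rightarrow> bool" where
  "primitive_element \<alpha> \<longleftrightarrow> \<alpha> \<noteq> 0 \<and> (\<forall>x. x \<noteq> 0 \<longrightarrow> (\<exists>k::nat. x = \<alpha> ^ k))"

definition quadratic_character :: "'k::field \<Rightarrow> int" where
  "quadratic_character x = (if x = 0 then 0 else if \<exists>y. x = y\<^sup>2 then 1 else -1)"

definition omega :: "nat \<Rightarrow> 'k::field \<Rightarrow> 'k" where
  "omega q \<alpha> = \<alpha> ^ (q\<^sup>2 + q + 1)"

definition mu :: "nat \<Rightarrow> 'k::field \<Rightarrow> 'k" where
  "mu q \<alpha> = \<alpha> ^ (q - 1)"


section \<open>The hyperbolic quadric in \<open>PG(5,q)\<close>\<close>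

text \<open>
  Points of \<open>PG(5,q)\<close> are the one-dimensional \<open>F\<close>-subspaces of \<open>E \<times> E\<close>, as sets of vectors.
\<close>

definition span_pt :: "nat \<Rightarrow> 'k::field \<times> 'k \<Rightarrow> ('k \<times> 'k) set" where
  "span_pt q w = {(c * fst w, c * snd w) | c. c \<in> base_field q}"

definition quad_form :: "nat \<Rightarrow> 'k::field \<times> 'k \<Rightarrow> 'k" where
  "quad_form q w = Tr q (fst w * snd w)"

definition quadric :: "nat \<Rightarrow> ('k::field \<times> 'k) set set" where
  "quadric q = {span_pt q w | w. w \<noteq> (0, 0) \<and> quad_form q w = 0}"

text \<open>
  Two points are collinear on the quadric if the subspace they span (their line, when they are
  distinct) is totally singular.
\<close>

definition collinear_on_quadric ::
    "nat \<Rightarrow> ('k::field \<times> 'k) set \<Rightarrow> ('k \<times> 'k) set \<Rightarrow> bool" where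
  "collinear_on_quadric q P R \<longleftrightarrow> (\<forall>v\<in>P. \<forall>w\<in>R. quad_form q (v + w) = 0)"

definition gen1 :: "nat \<Rightarrow> ('k::field \<times> 'k) set set" where
  "gen1 q = {span_pt q (x, 0) | x. x \<noteq> 0}"

definition gen2 :: "nat \<Rightarrow> ('k::field \<times> 'k) set set" where
  "gen2 q = {span_pt q (0, y) | y. y \<noteq> 0}"

definition map_c :: "nat \<Rightarrow> 'k::field \<Rightarrow> 'k \<times> 'k \<Rightarrow> 'k \<times> 'k" where
  "map_c q \<alpha> = (\<lambda>(u, v). (mu q \<alpha> * u, inverse (mu q \<alpha>) * v))"

definition map_z :: "nat \<Rightarrow> 'k::field \<Rightarrow> 'k \<times> 'k \<Rightarrow> 'k \<times> 'k" where
  "map_z q \<alpha> = (\<lambda>(u, v). (u, omega q \<alpha> ^ 4 * v))"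

definition grp :: "nat \<Rightarrow> 'k::field \<Rightarrow> ('k \<times> 'k \<Rightarrow> 'k \<times> 'k) set" where
  "grp q \<alpha> = generate (BijGroup UNIV) {map_c q \<alpha>, map_z q \<alpha>}"

definition grp_orbit :: "nat \<Rightarrow> 'k::field \<Rightarrow> ('k \<times> 'k) set \<Rightarrow> ('k \<times> 'k) set set" where
  "grp_orbit q \<alpha> P = {g ` P | g. g \<in> grp q \<alpha>}"

definition S_set :: "nat \<Rightarrow> 'k::field set" where
  "S_set q = {a. a \<noteq> 0 \<and> Nm q a = 1 \<and> Tr q (a\<^sup>2) = 0}"

definition X1 :: "nat \<Rightarrow> 'k::field \<Rightarrow> 'k set" where
  "X1 q a1 = {a \<in> S_set q. quadratic_character (2 * Tr q (a1 * a)) \<noteq> -1}"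

definition X2 :: "nat \<Rightarrow> 'k::field \<Rightarrow> 'k set" where
  "X2 q a1 = S_set q - X1 q a1"

definition T1 :: "nat \<Rightarrow> 'k::field \<Rightarrow> 'k \<Rightarrow> ('k \<times> 'k) set set" where
  "T1 q \<alpha> a1 =
     (\<Union>a\<in>X1 q a1. grp_orbit q \<alpha> (span_pt q (1, a\<^sup>2))
                 \<union> grp_orbit q \<alpha> (span_pt q (1, omega q \<alpha> * a\<^sup>2))) \<union>
     (\<Union>a\<in>X2 q a1. grp_orbit q \<alpha> (span_pt q (1, omega q \<alpha> ^ 2 * a\<^sup>2))
                 \<union> grp_orbit q \<alpha> (span_pt q (1, omega q \<alpha> ^ 3 * a\<^sup>2)))"

definition T2 :: "nat \<Rightarrow> 'k::field \<Rightarrow> 'k \<Rightarrow> ('k \<times> 'k) set set" where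
  "T2 q \<alpha> a1 = quadric q - (gen1 q \<union> gen2 q \<union> T1 q \<alpha> a1)"


section \<open>The projective space \<open>PG(3,q)\<close>\<close>

text \<open>
  \<open>PG(3,q)\<close> is the lattice of subspaces of \<open>'f ^ 4\<close>, where \<open>'f\<close> is a field with \<open>q\<close> elements;
  incidence is inclusion of subspaces.
\<close>

definition pg_points :: "('f::field ^ 4) set set" where
  "pg_points = {W. vec.subspace W \<and> vec.dim W = 1}"

definition pg_lines :: "('f::field ^ 4) set set" where
  "pg_lines = {W. vec.subspace W \<and> vec.dim W = 2}"

definition pg_planes :: "('f::field ^ 4) set set" where
  "pg_planes = {W. vec.subspace W \<and> vec.dim W = 3}"

definition star :: "('f::field ^ 4) set \<Rightarrow> ('f ^ 4) set set" where
  "star r = {l \<in> pg_lines. r \<subseteq> l}"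

definition lines_in :: "('f::field ^ 4) set \<Rightarrow> ('f ^ 4) set set" where
  "lines_in \<pi> = {l \<in> pg_lines. l \<subseteq> \<pi>}"

definition points_in :: "('f::field ^ 4) set \<Rightarrow> ('f ^ 4) set set" where
  "points_in \<pi> = {r \<in> pg_points. r \<subseteq> \<pi>}"

definition lines_meet :: "('f::field ^ 4) set \<Rightarrow> ('f ^ 4) set \<Rightarrow> bool" where
  "lines_meet l m \<longleftrightarrow> (\<exists>r\<in>pg_points. r \<subseteq> l \<and> r \<subseteq> m)"

definition klein_correspondence ::
    "nat \<Rightarrow> (('k::field \<times> 'k) set \<Rightarrow> ('f::field ^ 4) set) \<Rightarrow> bool" where
  "klein_correspondence q \<kappa> \<longleftrightarrow>
     bij_betw \<kappa> (quadric q) pg_lines \<and>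
     (\<forall>P\<in>quadric q. \<forall>R\<in>quadric q.
        collinear_on_quadric q P R \<longleftrightarrow> lines_meet (\<kappa> P) (\<kappa> R))"

definition tactical_decomposition ::
    "('f::field ^ 4) set set set \<Rightarrow> ('f ^ 4) set set set \<Rightarrow> bool" where
  "tactical_decomposition PC LC \<longleftrightarrow>
     partition_on pg_points PC \<and> partition_on pg_lines LC \<and>
     (\<forall>C\<in>PC. \<forall>D\<in>LC. \<forall>l\<in>D. \<forall>m\<in>D. card {r \<in> C. r \<subseteq> l} = card {r \<in> C. r \<subseteq> m}) \<and>
     (\<forall>C\<in>PC. \<forall>D\<in>LC. \<forall>r\<in>C. \<forall>s\<in>C. card {l \<in> D. r \<subseteq> l} = card {l \<in> D. s \<subseteq> l})"

definition symmetric_tactical_decomposition ::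
    "('f::field ^ 4) set set set \<Rightarrow> ('f ^ 4) set set set \<Rightarrow> bool" where
  "symmetric_tactical_decomposition PC LC \<longleftrightarrow>
     tactical_decomposition PC LC \<and> card PC = card LC"

end

theory Submission
  imports Defs "HOL-Analysis.Analysis" "HOL-Computational_Algebra.Polynomial"
begin

text \<open>
  The points of \<open>PG(3,q)\<close> off \<open>\<pi>\<close> and different from \<open>p\<close> correspond to the nonzero \<open>b\<close> in the
  cubic extension: the star of such a point is the generator \<open>{(u, u \<times> b)}\<close> of the quadric, where
  \<open>\<times>\<close> is the cross product for the trace form. A point \<open>(u, v)\<close> of the quadric outside the two given
  generators is then a line containing the \<open>q\<close> points \<open>b\<close> with \<open>u \<times> b = v\<close>, an affine line
  \<open>b\<^sub>0 + F u\<close>. Everything follows from the evaluation of the sums of the quartic character \<open>eta\<close> of the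
  extension field over these affine lines: each of them equals \<open>\<gamma> = \<plusminus> 3 ^ e\<close> times a power of
  \<open>\<i>\<close>, with the same sign for all lines, and \<open>T1\<close>, \<open>T2\<close> collect the lines for which this power lies in \<open>{1, -\<i>}\<close>, \<open>{-1, \<i>}\<close>.
  Hence the two classes of points given by \<open>eta b\<close> in \<open>{1, -\<i>}\<close> or in \<open>{-1, \<i>}\<close> meet every line of
  \<open>L1\<close> in a constant number of points, likewise for \<open>L2\<close>, and a double count shows that
  they are \<open>P1\<close> and \<open>P2\<close>.

  For the line sum, a Gauss sum turns \<open>\<Sum>t. eta (w + t)\<close> into an exponential sum over a cubic
  polynomial in \<open>t\<close>. In characteristic 3 its leading term can be linearised, completing the square gives a
  Kloosterman sum twisted by a quartic character, and this in turn reduces to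
  the sum of a quadratic form over the prime field, which is diagonalised by means of the trace of the
  point \<open>a\<close> of the conic \<open>S\<close>.
\<close>

text \<open>Two signs are never determined: that of the quartic Gauss sum \<open>G\<close> and that
  of \<open>eps a1\<close>. Both are absorbed into the real number \<open>\<gamma>\<close>; as
  \<open>P1\<close> and \<open>P2\<close> are singled out by their star counts, the last step only
  has to match each count with the correct half of the points. That \<open>G\<close> is real, with
  G^2 = q, is peculiar to characteristic 3: the substitution k -> k^3 preserves the additive
  character \<open>ec\<close> and turns \<open>eta\<close> into its conjugate. Another obstacle is
  that \<open>X1\<close> compares a with a1 through Tr (a1 * a), whereas a line sum only sees Tr a.
  The bridge is the multiplicativity \<open>eps_mult\<close> on the conic S, which makes
  \<open>X1\<close> and \<open>X2\<close> the level sets of one sign function. The element 1 belongs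
  to S because Tr 1 = 0 in characteristic 3, and it needs separate treatment: there the norm cubic
  has no quadratic term, so there is no square to complete.\<close>

lemma sum_two_values:
  fixes f :: "'a \<Rightarrow> real"
  assumes "finite U" "\<And>x. x \<in> U \<Longrightarrow> f x = c \<or> f x = - c" "c \<noteq> 0"
  shows "(\<Sum>x\<in>U. f x) = c * (2 * real (card {x \<in> U. f x = c}) - real (card U))"
    and "card {x \<in> U. f x = - c} + card {x \<in> U. f x = c} = card U"
proof -
  have split: "U = {x \<in> U. f x = c} \<union> {x \<in> U. f x = - c}" and
    dis: "{x \<in> U. f x = c} \<inter> {x \<in> U. f x = - c} = {}" using assms by auto
  show card: "card {x \<in> U. f x = - c} + card {x \<in> U. f x = c} = card U"
    using card_Un_disjoint[OF _ _ dis] split assms(1) by simp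
  have "(\<Sum>x\<in>U. f x) = (\<Sum>x\<in>{x \<in> U. f x = c}. f x) + (\<Sum>x\<in>{x \<in> U. f x = - c}. f x)"
    using sum.union_disjoint[OF _ _ dis, of f] split assms(1) by simp
  also have "\<dots> = c * (real (card {x \<in> U. f x = c}) - real (card {x \<in> U. f x = - c}))"
    by (simp add: algebra_simps)
  finally show "(\<Sum>x\<in>U. f x) = c * (2 * real (card {x \<in> U. f x = c}) - real (card U))"
    unfolding card[symmetric] by (simp add: algebra_simps)
qed

section \<open>The finite field\<close>

locale cubic_extension =
  fixes e q :: nat and \<alpha> :: "'k::{field,finite}"
  assumes e_pos: "e > 0" and q_eq: "q = 3 ^ (2 * e)"
    and card_field: "CARD('k) = q ^ 3" and primitive: "primitive_element \<alpha>"
begin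

abbreviation F :: "'k set" where "F \<equiv> base_field q"

lemma q_eq_9: "q = 9 ^ e"
  by (simp add: q_eq power_mult)

lemma q_mod_8: "q mod 8 = 1"
proof -
  have "(9::nat) ^ e mod 8 = (9 mod 8) ^ e mod 8" by (metis power_mod)
  thus ?thesis by (simp add: q_eq_9)
qed

lemma q_ge_9: "q \<ge> 9"
  using e_pos by (simp add: q_eq_9 self_le_power)

text \<open>Translation by 1 permutes the finite field, so adding 1 to every element leaves their
  sum unchanged; hence the cardinality, a power of 3, is zero in the field.\<close>

lemma three_eq_0: "(3::'k) = 0"
proof -
  have inj: "inj (\<lambda>x::'k. x + 1)" by (auto simp: inj_def)
  have "(\<Sum>x\<in>UNIV. x) = (\<Sum>x\<in>UNIV. x + (1::'k))"
    by (rule sum.reindex_bij_witness[of _ "\<lambda>x. x + 1" "\<lambda>x. x - 1"]) auto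
  hence "of_nat CARD('k) = (0::'k)"
    by (simp add: sum.distrib)
  hence "of_nat (3 ^ (2 * e * 3)) = (0::'k)"
    by (simp only: card_field q_eq power_mult)
  hence "(3::'k) ^ (2 * e * 3) = 0"
    by (simp only: of_nat_power of_nat_numeral)
  thus ?thesis using power_not_zero by blast
qed

text \<open>As simp rules these normalise the numerals 2 and 4. Identities with integer coefficients
  are therefore expanded with \<open>del: char_3\<close>, and multiples of 3 are removed afterwards
  by \<open>three_eq_0\<close>.\<close>

lemma char_3 [simp]:
  "(2::'k) = - 1" "(4::'k) = 1"
proof -
  have "(2::'k) + 1 = 3" by simp
  thus two: "(2::'k) = - 1" by (simp add: three_eq_0 eq_neg_iff_add_eq_0)
  have "(4::'k) = 3 + 1" by simp
  thus "(4::'k) = 1" by (simp only: three_eq_0 add_0)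
qed

lemma one_neq_minus_one: "(1::'k) \<noteq> - 1"
  by (metis add_eq_0_iff char_3(1) one_add_one zero_neq_one)

lemma cube_add: "(x + y :: 'k) ^ 3 = x ^ 3 + y ^ 3"
proof -
  have "(x + y) ^ 3 = x ^ 3 + y ^ 3 + 3 * (x\<^sup>2 * y + x * y\<^sup>2)"
    by algebra
  thus ?thesis by (simp add: three_eq_0)
qed

lemma power_3_power_add: "(x + y :: 'k) ^ (3 ^ n) = x ^ (3 ^ n) + y ^ (3 ^ n)"
  by (induction n arbitrary: x y) (simp_all add: power_mult cube_add)

lemma frob_add: "(x + y :: 'k) ^ q = x ^ q + y ^ q"
  by (simp add: q_eq power_3_power_add)

lemma odd_q: "odd q"
  by (simp add: q_eq)

lemma frob_minus: "(- x :: 'k) ^ q = - (x ^ q)"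
  by (simp add: odd_q power_minus_odd)

lemma frob_diff: "(x - y :: 'k) ^ q = x ^ q - y ^ q"
  using frob_add[of x "- y"] by (simp add: frob_minus)

lemma power_q_squared: "(x::'k) ^ (q\<^sup>2) = (x ^ q) ^ q"
  by (simp add: power2_eq_square power_mult)

lemma \<alpha>_nonzero: "\<alpha> \<noteq> 0"
  using primitive by (simp add: primitive_element_def)

lemma ex_power_\<alpha>: "x \<noteq> 0 \<Longrightarrow> \<exists>k::nat. x = \<alpha> ^ k"
  using primitive by (simp add: primitive_element_def)

lemma power_card: "(x::'k) ^ (q ^ 3) = x"
proof (cases "x = 0")
  case False
  have "(\<Prod>y\<in>UNIV - {0}. y) = (\<Prod>y\<in>UNIV - {0}. x * y)"
    by (rule prod.reindex_bij_witness[of _ "\<lambda>y. x * y" "\<lambda>y. y / x"]) (use False in auto)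
  also have "\<dots> = x ^ (q ^ 3 - 1) * (\<Prod>y\<in>UNIV - {0}. y)"
    by (simp add: prod.distrib card_Diff_singleton card_field)
  finally have "x ^ (q ^ 3 - 1) = 1" by (simp add: prod_zero_iff)
  hence "x ^ Suc (q ^ 3 - 1) = x" by simp
  thus ?thesis using q_ge_9 by (metis Suc_diff_1 card_field zero_less_card_finite)
qed (use q_ge_9 in simp)

lemma frob_frob_frob [simp]: "(((x::'k) ^ q) ^ q) ^ q = x"
  using power_card[of x] by (simp add: power_mult[symmetric] power3_eq_cube)

lemma \<alpha>_power_card: "\<alpha> ^ (q ^ 3 - 1) = 1"
proof -
  have "\<alpha> ^ (q ^ 3 - 1) * \<alpha> = \<alpha>"
    using power_card[of \<alpha>] q_ge_9 by (metis Suc_diff_1 \<alpha>_nonzero card_field power_Suc2 zero_less_card_finite)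
  thus ?thesis using \<alpha>_nonzero by simp
qed

lemma \<alpha>_power_mod: "\<alpha> ^ k = \<alpha> ^ (k mod (q ^ 3 - 1))"
proof -
  have "\<alpha> ^ k = \<alpha> ^ ((q ^ 3 - 1) * (k div (q ^ 3 - 1)) + k mod (q ^ 3 - 1))" by simp
  also have "\<dots> = \<alpha> ^ (k mod (q ^ 3 - 1))"
    by (simp only: power_add power_mult \<alpha>_power_card) simp
  finally show ?thesis .
qed

lemma q3_gt_1: "q ^ 3 > 1"
  using q_ge_9 by (intro one_less_power) auto

lemma inj_on_\<alpha>_power: "inj_on (\<lambda>k. \<alpha> ^ k) {..<q ^ 3 - 1}"
proof (rule eq_card_imp_inj_on)
  have "(\<lambda>k. \<alpha> ^ k) ` {..<q ^ 3 - 1} = UNIV - {0}"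
  proof (safe)
    fix x :: 'k assume "x \<notin> (\<lambda>k. \<alpha> ^ k) ` {..<q ^ 3 - 1}"
    thus "x = 0"
    proof (rule contrapos_np)
      assume "x \<noteq> 0"
      then obtain k where "x = \<alpha> ^ k" using ex_power_\<alpha> by blast
      hence "x = \<alpha> ^ (k mod (q ^ 3 - 1))" using \<alpha>_power_mod by simp
      thus "x \<in> (\<lambda>k. \<alpha> ^ k) ` {..<q ^ 3 - 1}" using q3_gt_1 by auto
    qed
  qed (use \<alpha>_nonzero in auto)
  thus "card ((\<lambda>k. \<alpha> ^ k) ` {..<q ^ 3 - 1}) = card {..<q ^ 3 - 1}"
    by (simp add: card_Diff_singleton card_field)
qed simp

lemma \<alpha>_power_eq_iff: "\<alpha> ^ k = \<alpha> ^ l \<longleftrightarrow> k mod (q ^ 3 - 1) = l mod (q ^ 3 - 1)"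
proof
  assume "\<alpha> ^ k = \<alpha> ^ l"
  hence "\<alpha> ^ (k mod (q ^ 3 - 1)) = \<alpha> ^ (l mod (q ^ 3 - 1))" using \<alpha>_power_mod by metis
  thus "k mod (q ^ 3 - 1) = l mod (q ^ 3 - 1)"
    using q3_gt_1 by (intro inj_onD[OF inj_on_\<alpha>_power]) auto
qed (metis \<alpha>_power_mod)

lemma \<alpha>_power_eq_1_iff: "\<alpha> ^ k = 1 \<longleftrightarrow> (q ^ 3 - 1) dvd k"
  using \<alpha>_power_eq_iff[of k 0] by (simp add: dvd_eq_mod_eq_0)

lemma q3_minus_1: "q ^ 3 - 1 = (q - 1) * (q\<^sup>2 + q + 1)"
proof -
  obtain r where r: "q = Suc r" using q_ge_9 by (cases q) auto
  show ?thesis by (simp add: r power3_eq_cube power2_eq_square algebra_simps)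
qed

lemma q_minus_1_dvd_4: "4 dvd q - 1"
  using q_mod_8 by presburger

lemma q3_minus_1_dvd_4: "4 dvd q ^ 3 - 1"
  unfolding q3_minus_1 by (rule dvd_mult2[OF q_minus_1_dvd_4])

section \<open>The subfield F and its generator\<close>

definition \<omega> :: 'k where "\<omega> = omega q \<alpha>"

lemma \<omega>_eq: "\<omega> = \<alpha> ^ (q\<^sup>2 + q + 1)"
  by (simp add: \<omega>_def omega_def)

lemma \<omega>_nonzero: "\<omega> \<noteq> 0"
  by (simp add: \<omega>_eq \<alpha>_nonzero)

lemma \<omega>_power_eq_1_iff: "\<omega> ^ k = 1 \<longleftrightarrow> (q - 1) dvd k"
proof -
  have "\<omega> ^ k = 1 \<longleftrightarrow> (q\<^sup>2 + q + 1) * (q - 1) dvd (q\<^sup>2 + q + 1) * k"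
    by (simp only: \<omega>_eq power_mult[symmetric] \<alpha>_power_eq_1_iff q3_minus_1 mult.commute[of "q - 1"])
  thus ?thesis by (subst (asm) nat_mult_dvd_cancel_disj) simp
qed

lemma F_iff: "x \<in> F \<longleftrightarrow> x ^ q = x"
  by (simp add: base_field_def)

lemma power_q_minus_1:
  assumes "x \<noteq> (0::'k)" shows "x ^ q = x \<longleftrightarrow> x ^ (q - 1) = 1"
proof -
  have "x ^ q = x ^ (q - 1) * x" using q_ge_9
    by (metis One_nat_def Suc_pred less_le_trans power_Suc2 zero_less_numeral)
  thus ?thesis using assms by simp
qed

text \<open>A power \<alpha>^k is fixed by x -> x^q iff q^3 - 1 = (q - 1)(q^2 + q + 1) divides (q -
  1) k, that is, iff k is a multiple of q^2 + q + 1.\<close>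

lemma nonzero_F_iff: "x \<in> F - {0} \<longleftrightarrow> (\<exists>k<q - 1. x = \<omega> ^ k)"
proof
  assume x: "x \<in> F - {0}"
  then obtain k where k: "x = \<alpha> ^ k" using ex_power_\<alpha> by blast
  have "\<alpha> ^ (k * (q - 1)) = 1"
    using x k power_q_minus_1[of x] by (auto simp: F_iff power_mult)
  hence "(q - 1) * (q\<^sup>2 + q + 1) dvd (q - 1) * k"
    by (simp only: \<alpha>_power_eq_1_iff q3_minus_1 mult.commute[of k])
  hence "(q\<^sup>2 + q + 1) dvd k"
    using q_ge_9 by (subst (asm) nat_mult_dvd_cancel_disj) auto
  then obtain l where l: "k = (q\<^sup>2 + q + 1) * l" by blast
  hence "x = \<omega> ^ l" by (simp only: k l \<omega>_eq power_mult)
  moreover have "\<omega> ^ l = \<omega> ^ (l mod (q - 1))"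
  proof -
    have "\<omega> ^ l = \<omega> ^ ((q - 1) * (l div (q - 1)) + l mod (q - 1))" by simp
    also have "\<dots> = \<omega> ^ (l mod (q - 1))"
      by (simp only: power_add power_mult) (simp add: \<omega>_power_eq_1_iff[THEN iffD2])
    finally show ?thesis .
  qed
  ultimately show "\<exists>k<q - 1. x = \<omega> ^ k" using q_ge_9 by (intro exI[of _ "l mod (q - 1)"]) auto
next
  assume "\<exists>k<q - 1. x = \<omega> ^ k"
  then obtain k where k: "x = \<omega> ^ k" by blast
  have "x ^ (q - 1) = 1" by (simp add: k power_mult[symmetric] \<omega>_power_eq_1_iff)
  thus "x \<in> F - {0}" using power_q_minus_1[of x] k \<omega>_nonzero by (simp add: F_iff)
qed

lemma \<omega>_power_in_F: "\<omega> ^ k \<in> F"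
proof -
  have "(\<omega> ^ k) ^ (q - 1) = 1" by (simp add: power_mult[symmetric] \<omega>_power_eq_1_iff)
  thus ?thesis using power_q_minus_1[of "\<omega> ^ k"] \<omega>_nonzero by (simp add: F_iff)
qed

lemma \<omega>_in_F: "\<omega> \<in> F"
  using \<omega>_power_in_F[of 1] by simp

lemma F_cases:
  assumes "x \<in> F" "x \<noteq> 0" obtains k where "x = \<omega> ^ k"
  using assms nonzero_F_iff[of x] by auto

lemma F_0 [simp]: "0 \<in> F" and F_1 [simp]: "1 \<in> F"
  using q_ge_9 by (auto simp: F_iff)

lemma F_add [intro]: "x \<in> F \<Longrightarrow> y \<in> F \<Longrightarrow> x + y \<in> F"
  and F_diff [intro]: "x \<in> F \<Longrightarrow> y \<in> F \<Longrightarrow> x - y \<in> F"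
  and F_minus [intro]: "x \<in> F \<Longrightarrow> - x \<in> F"
  and F_mult [intro]: "x \<in> F \<Longrightarrow> y \<in> F \<Longrightarrow> x * y \<in> F"
  and F_divide [intro]: "x \<in> F \<Longrightarrow> y \<in> F \<Longrightarrow> x / y \<in> F"
  and F_inverse [intro]: "x \<in> F \<Longrightarrow> inverse x \<in> F"
  by (auto simp: F_iff frob_add frob_diff frob_minus power_mult_distrib power_divide power_inverse)

lemma F_power [intro]: "x \<in> F \<Longrightarrow> x ^ n \<in> F"
  by (induction n) auto

lemma F_minus_iff [simp]: "- x \<in> F \<longleftrightarrow> x \<in> F"
  using F_minus[of x] F_minus[of "- x"] by auto

lemma card_F: "card F = q"
proof -
  have "F - {0} = (\<lambda>k. \<omega> ^ k) ` {..<q - 1}"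
    using nonzero_F_iff by auto
  moreover have "inj_on (\<lambda>k. \<omega> ^ k) {..<q - 1}"
  proof (rule inj_onI)
    fix k l assume kl: "k \<in> {..<q - 1}" "l \<in> {..<q - 1}" "\<omega> ^ k = \<omega> ^ l"
    have "\<alpha> ^ ((q\<^sup>2 + q + 1) * k) = \<alpha> ^ ((q\<^sup>2 + q + 1) * l)"
      using kl(3) by (simp only: \<omega>_eq power_mult)
    moreover have "(q\<^sup>2 + q + 1) * k < q ^ 3 - 1" "(q\<^sup>2 + q + 1) * l < q ^ 3 - 1"
      using kl(1,2) unfolding q3_minus_1 mult.commute[of "q - 1"]
      by (simp_all only: nat_mult_less_cancel_disj lessThan_iff) auto
    ultimately have "(q\<^sup>2 + q + 1) * k = (q\<^sup>2 + q + 1) * l"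
      by (simp add: \<alpha>_power_eq_iff del: mult_cancel1)
    thus "k = l" by (subst (asm) nat_mult_eq_cancel_disj) simp
  qed
  ultimately have "card (F - {0}) = q - 1" by (simp add: card_image)
  thus ?thesis using q_ge_9 by (simp add: card_Diff_singleton)
qed

section \<open>Trace and norm\<close>

lemma Tr_eq: "Tr q x = x + x ^ q + (x ^ q) ^ q" for x :: 'k
  by (simp add: Tr_def power_q_squared)

lemma Nm_eq: "Nm q x = x * x ^ q * (x ^ q) ^ q" for x :: 'k
  by (simp add: Nm_def power_add power_q_squared mult_ac)

lemma Tr_in_F: "Tr q x \<in> F" for x :: 'k
  by (simp add: F_iff Tr_eq frob_add)

lemma Nm_in_F: "Nm q x \<in> F" for x :: 'k
  by (simp add: F_iff Nm_eq power_mult_distrib)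

lemma Tr_add: "Tr q (x + y) = Tr q x + Tr q y" for x y :: 'k
  by (simp add: Tr_eq frob_add)

lemma Tr_diff: "Tr q (x - y) = Tr q x - Tr q y" for x y :: 'k
  by (simp add: Tr_eq frob_diff)

lemma Tr_scale: "c \<in> F \<Longrightarrow> Tr q (c * x) = c * Tr q x" for x :: 'k
  by (simp add: F_iff Tr_eq power_mult_distrib algebra_simps)

lemma Nm_mult: "Nm q (x * y) = Nm q x * Nm q y" for x y :: 'k
  by (simp add: Nm_def power_mult_distrib)

lemma Nm_F: "c \<in> F \<Longrightarrow> Nm q c = c ^ 3" for c :: 'k
  by (simp add: F_iff Nm_eq power3_eq_cube mult.assoc)

lemma cube_inj: "x ^ 3 = y ^ 3 \<Longrightarrow> x = (y::'k)"
proof -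
  assume "x ^ 3 = y ^ 3"
  hence "(x - y) ^ 3 = 0" using cube_add[of x "- y"] by simp
  thus ?thesis by simp
qed

lemma Tr_F: "c \<in> F \<Longrightarrow> Tr q c = 0"
proof -
  assume "c \<in> F"
  hence "Tr q c = c + c + c" by (simp add: F_iff Tr_eq)
  also have "\<dots> = 3 * c" by algebra
  finally show ?thesis by (simp only: three_eq_0 mult_zero_left)
qed

text \<open>Otherwise a nonzero polynomial of degree q^2 would have q^3 roots.\<close>

lemma ex_Tr_nonzero: "\<exists>x::'k. Tr q x \<noteq> 0"
proof (rule ccontr)
  assume *: "\<not> ?thesis"
  define p :: "'k poly" where "p = monom 1 1 + monom 1 q + monom 1 (q\<^sup>2)"
  have lt: "1 < q" "q < q\<^sup>2" using q_ge_9 by (auto simp: power2_eq_square)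
  have "degree (monom (1::'k) 1 + monom 1 q) = q" using lt
    by (subst degree_add_eq_right) (auto simp: degree_monom_eq)
  hence deg: "degree p = q\<^sup>2" unfolding p_def using lt
    by (subst degree_add_eq_right) (auto simp: degree_monom_eq)
  hence "p \<noteq> 0" using lt by auto
  have "card {x. poly p x = 0} \<le> q\<^sup>2"
    using card_poly_roots_bound[OF \<open>p \<noteq> 0\<close>] deg by simp
  moreover have "{x. poly p x = 0} = UNIV"
    using * by (auto simp: p_def poly_monom Tr_def)
  ultimately have "q ^ 3 \<le> q ^ 2" by (simp add: card_field)
  thus False using q_ge_9 by (simp add: power_increasing_iff)
qed

lemma Tr_nondegenerate: "(\<And>u. Tr q (u * y) = 0) \<Longrightarrow> y = 0" for y :: 'k
proof (rule ccontr)
  assume *: "\<And>u. Tr q (u * y) = 0" and "y \<noteq> 0"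
  obtain x :: 'k where "Tr q x \<noteq> 0" using ex_Tr_nonzero by blast
  thus False using *[of "x / y"] \<open>y \<noteq> 0\<close> by simp
qed

lemma ex_Tr_eq_1: "y \<noteq> 0 \<Longrightarrow> \<exists>u. Tr q (y * u) = 1" for y :: 'k
proof -
  assume "y \<noteq> 0"
  then obtain u where u: "Tr q (u * y) \<noteq> 0" using Tr_nondegenerate by blast
  have "Tr q (inverse (Tr q (u * y)) * (u * y)) = 1"
    using u by (subst Tr_scale) (auto simp: Tr_in_F)
  thus ?thesis by (intro exI[of _ "inverse (Tr q (u * y)) * u"]) (simp add: mult_ac)
qed

section \<open>Quadratic and quartic characters\<close>

text \<open>Since \<open>q\<^sup>2 + q + 1\<close> is 3 modulo 4, the restriction of \<open>eta\<close> to \<open>F\<close> still has order 4, and it maps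
  \<open>\<omega>\<close> to \<open>- \<i>\<close>.\<close>

definition eta :: "'k \<Rightarrow> complex" where
  "eta x = (if x = 0 then 0 else \<i> ^ (SOME k. x = \<alpha> ^ k))"

lemma i_power_mod_4: "\<i> ^ k = \<i> ^ (k mod 4)"
proof -
  have "\<i> ^ k = \<i> ^ (4 * (k div 4) + k mod 4)" by simp
  also have "\<dots> = \<i> ^ (k mod 4)" by (simp only: power_add power_mult) simp
  finally show ?thesis .
qed

lemma eta_0 [simp]: "eta 0 = 0"
  by (simp add: eta_def)

text \<open>The exponent chosen by \<open>SOME\<close> is determined only modulo q^3 - 1; this is
  harmless because 4 divides q^3 - 1.\<close>

lemma eta_\<alpha>_power: "eta (\<alpha> ^ k) = \<i> ^ k"
proof -
  have "\<alpha> ^ k = \<alpha> ^ (SOME l. \<alpha> ^ k = \<alpha> ^ l)" by (rule someI) simp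
  hence "k mod (q ^ 3 - 1) = (SOME l. \<alpha> ^ k = \<alpha> ^ l) mod (q ^ 3 - 1)"
    by (simp add: \<alpha>_power_eq_iff)
  hence "k mod (q ^ 3 - 1) mod 4 = (SOME l. \<alpha> ^ k = \<alpha> ^ l) mod (q ^ 3 - 1) mod 4" by simp
  hence "k mod 4 = (SOME l. \<alpha> ^ k = \<alpha> ^ l) mod 4"
    by (simp only: mod_mod_cancel[OF q3_minus_1_dvd_4])
  thus ?thesis using \<alpha>_nonzero
    by (simp add: eta_def i_power_mod_4[of k] i_power_mod_4[of "SOME l. \<alpha> ^ k = \<alpha> ^ l"])
qed

lemma eta_mult: "eta (x * y) = eta x * eta y"
proof (cases "x = 0 \<or> y = 0")
  case False
  then obtain k l where "x = \<alpha> ^ k" "y = \<alpha> ^ l" using ex_power_\<alpha> by blast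
  moreover from this have "x * y = \<alpha> ^ (k + l)" by (simp add: power_add)
  ultimately show ?thesis by (metis eta_\<alpha>_power power_add)
qed auto

lemma eta_1 [simp]: "eta 1 = 1"
  using eta_\<alpha>_power[of 0] by simp

lemma eta_eq_0_iff [simp]: "eta x = 0 \<longleftrightarrow> x = 0"
  using ex_power_\<alpha>[of x] eta_\<alpha>_power eta_0 by (metis complex_i_not_zero power_not_zero)

lemma eta_power: "eta (x ^ n) = eta x ^ n"
  by (induction n) (auto simp: eta_mult)

lemma i_power_cases: "\<i> ^ k \<in> {1, \<i>, -1, -\<i>}"
proof -
  have "k mod 4 \<in> {0, 1, 2, 3}" by auto
  thus ?thesis by (subst i_power_mod_4) (auto simp: power3_eq_cube)
qed

lemma eta_cases: "x \<noteq> 0 \<Longrightarrow> eta x \<in> {1, \<i>, -1, -\<i>}"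
  using ex_power_\<alpha>[of x] eta_\<alpha>_power i_power_cases by metis

lemma eta_power_4: "x \<noteq> 0 \<Longrightarrow> eta x ^ 4 = 1"
  using eta_cases[of x] by auto

lemma eta_inverse: "eta (inverse x) = eta x ^ 3"
proof (cases "x = 0")
  case False
  have "eta (inverse x) * eta x = 1" using False by (simp add: eta_mult[symmetric])
  moreover have "eta x ^ 3 * eta x = 1"
    using eta_power_4[OF False] by (simp add: eval_nat_numeral mult_ac)
  ultimately show ?thesis using False by (metis eta_eq_0_iff mult_right_cancel)
qed auto

lemma eta_\<omega>: "eta \<omega> = - \<i>"
proof -
  have "(q\<^sup>2 + q + 1) mod 4 = 3"
  proof -
    define r where "r = q div 4"
    have r: "q = 4 * r + 1" unfolding r_def using q_mod_8 by presburger
    have "q\<^sup>2 + q + 1 = 4 * (4 * r\<^sup>2 + 3 * r) + 3"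
      by (simp add: r power2_eq_square algebra_simps)
    thus ?thesis by (simp only: mod_mult_self4) simp
  qed
  hence "eta \<omega> = \<i> ^ 3"
    by (simp only: \<omega>_eq eta_\<alpha>_power i_power_mod_4[of "q\<^sup>2 + q + 1"])
  thus ?thesis by (simp add: power3_eq_cube)
qed

text \<open>-1 is the power of \<open>\<omega>\<close> with exponent (q - 1) / 2, and this exponent
  is a multiple of 4 because q = 9^e is 1 modulo 8.\<close>

lemma eta_minus_1: "eta (-1) = 1"
proof -
  have "\<omega> ^ ((q - 1) div 2) \<noteq> 1"
  proof
    assume "\<omega> ^ ((q - 1) div 2) = 1"
    hence "(q - 1) dvd (q - 1) div 2" by (simp only: \<omega>_power_eq_1_iff)
    moreover have "0 < (q - 1) div 2" "(q - 1) div 2 < q - 1" using q_ge_9 by auto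
    ultimately show False using dvd_imp_le[of "q - 1" "(q - 1) div 2"] by linarith
  qed
  moreover have "(\<omega> ^ ((q - 1) div 2))\<^sup>2 = 1"
  proof -
    have "(q - 1) div 2 * 2 = q - 1" using q_mod_8 by presburger
    thus ?thesis by (simp only: power_mult[symmetric] \<omega>_power_eq_1_iff) simp
  qed
  ultimately have "\<omega> ^ ((q - 1) div 2) = - 1" by (simp add: power2_eq_1_iff)
  hence "eta (-1) = (- \<i>) ^ ((q - 1) div 2)" by (metis eta_power eta_\<omega>)
  moreover have "(q - 1) div 2 = 4 * (q div 8)"
  proof -
    have "q = 8 * (q div 8) + 1" using q_mod_8 by presburger
    thus ?thesis by linarith
  qed
  ultimately show ?thesis by (simp add: power_mult)
qed

lemma eta_minus [simp]: "eta (- x) = eta x"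
  using eta_mult[of "-1" x] by (simp add: eta_minus_1)

lemma eta_Nm: "eta (Nm q x) = eta x ^ 3"
proof (cases "x = 0")
  case False
  then obtain k where k: "x = \<alpha> ^ k" using ex_power_\<alpha> by blast
  have "Nm q x = \<omega> ^ k"
    by (simp only: Nm_def k \<omega>_eq power_mult[symmetric] mult.commute)
  moreover have "- \<i> = \<i> ^ 3" by (simp add: power3_eq_cube)
  ultimately have "eta (Nm q x) = (\<i> ^ 3) ^ k" by (simp only: eta_power eta_\<omega>)
  also have "\<dots> = eta x ^ 3" by (simp only: k eta_\<alpha>_power power_mult[symmetric] mult.commute)
  finally show ?thesis .
qed (simp add: Nm_def)

text \<open>The norm raises \<open>eta\<close> to the third power, and cubing is an involution on
  fourth roots of unity. Thus \<open>eta\<close> on the extension becomes a character of F evaluated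
  at a norm, which is what allows Gauss sums over F to be used for line sums.\<close>

lemma eta_eq_eta_Nm: "eta x = eta (Nm q x) ^ 3"
proof (cases "x = 0")
  case False
  have "eta (Nm q x) ^ 3 = eta x ^ 4 * eta x ^ 4 * eta x"
    by (simp add: eta_Nm eval_nat_numeral)
  thus ?thesis using False by (simp add: eta_power_4)
qed (simp add: Nm_def)

definition chi :: "'k \<Rightarrow> complex" where "chi x = eta x ^ 2"

lemma chi_0 [simp]: "chi 0 = 0" and chi_1 [simp]: "chi 1 = 1"
  and chi_minus [simp]: "chi (- x) = chi x"
  and chi_mult: "chi (x * y) = chi x * chi y"
  and chi_eq_0_iff [simp]: "chi x = 0 \<longleftrightarrow> x = 0"
  by (auto simp: chi_def eta_mult power_mult_distrib)

lemma chi_cases: "x \<noteq> 0 \<Longrightarrow> chi x = 1 \<or> chi x = -1"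
  using eta_cases[of x] by (auto simp: chi_def)

lemma chi_square: "x \<noteq> 0 \<Longrightarrow> chi (x\<^sup>2) = 1"
  using chi_cases[of x] by (auto simp: power2_eq_square chi_mult)

lemma chi_chi: "x \<noteq> 0 \<Longrightarrow> chi x * chi x = 1"
  using chi_cases[of x] by auto

lemma chi_inverse: "chi (inverse x) = chi x"
proof (cases "x = 0")
  case False
  have "chi (inverse x) = eta x ^ 4 * eta x ^ 2"
    by (simp add: chi_def eta_inverse eval_nat_numeral)
  thus ?thesis using False by (simp add: eta_power_4 chi_def)
qed simp

lemma chi_divide: "chi (x / y) = chi x * chi y"
  by (simp add: divide_inverse chi_mult chi_inverse)

lemma chi_cube: "chi (x ^ 3) = chi x"
  using chi_chi[of x] by (cases "x = 0") (auto simp: power3_eq_cube chi_mult)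

text \<open>The extension has odd degree, so squares of E lying in F are squares in F. Concretely,
  \<open>chi \<omega>\<close> is -1, so only even powers of \<open>\<omega>\<close> have value
  1.\<close>

lemma chi_eq_1_F:
  assumes "x \<in> F" "chi x = 1" shows "\<exists>y\<in>F. x = y\<^sup>2"
proof -
  have "x \<noteq> 0" using assms by auto
  then obtain k where k: "x = \<omega> ^ k" using assms F_cases by blast
  hence "(-1 :: complex) ^ k = 1" using assms(2)
    by (simp add: chi_def eta_power eta_\<omega> power_mult[symmetric] mult.commute)
  hence "even k" by (simp add: minus_one_power_iff split: if_splits)
  then obtain l where "k = l * 2" by (auto elim: evenE)
  thus ?thesis using k \<omega>_power_in_F[of l] by (auto simp: power_mult)
qed

lemma chi_eq_1_iff: "chi x = 1 \<longleftrightarrow> x \<noteq> 0 \<and> (\<exists>y. x = y\<^sup>2)"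
proof
  assume *: "chi x = 1"
  hence "x \<noteq> 0" by auto
  then obtain k where k: "x = \<alpha> ^ k" using ex_power_\<alpha> by blast
  hence "(-1 :: complex) ^ k = 1" using *
    by (simp add: chi_def eta_\<alpha>_power power_mult[symmetric] mult.commute)
  hence "even k" by (simp add: minus_one_power_iff split: if_splits)
  then obtain l where "k = l * 2" by (auto elim: evenE)
  thus "x \<noteq> 0 \<and> (\<exists>y. x = y\<^sup>2)" using k \<open>x \<noteq> 0\<close> by (auto simp: power_mult)
qed (auto simp: chi_square)

lemma quadratic_character_eq_chi: "complex_of_int (quadratic_character x) = chi x"
  using chi_cases[of x] chi_eq_1_iff[of x] by (auto simp: quadratic_character_def)

section \<open>Sums over the base field\<close>

lemma sum_F_shift: "a \<in> F \<Longrightarrow> (\<Sum>t\<in>F. f (t + a)) = (\<Sum>t\<in>F. f t)"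
  by (rule sum.reindex_bij_witness[of _ "\<lambda>t. t - a" "\<lambda>t. t + a"]) auto

lemma sum_F_scale: "a \<in> F \<Longrightarrow> a \<noteq> 0 \<Longrightarrow> (\<Sum>t\<in>F. f (a * t)) = (\<Sum>t\<in>F. f t)"
  by (rule sum.reindex_bij_witness[of _ "\<lambda>t. t / a" "\<lambda>t. a * t"]) auto

lemma sum_F_uminus: "(\<Sum>t\<in>F. f (- t)) = (\<Sum>t\<in>F. f t)"
  by (rule sum.reindex_bij_witness[of _ "\<lambda>t. - t" "\<lambda>t. - t"]) auto

lemma sum_F_inverse: "(\<Sum>t\<in>F. f (inverse t)) = (\<Sum>t\<in>F. f t)"
  by (rule sum.reindex_bij_witness[of _ "inverse" "inverse"]) auto

lemma sum_F_inj: "inj_on h F \<Longrightarrow> h ` F \<subseteq> F \<Longrightarrow> (\<Sum>t\<in>F. f (h t)) = (\<Sum>t\<in>F. f t)"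
  using endo_inj_surj[of F h] sum.reindex[of h F f] by simp

lemma sum_F_cube: "(\<Sum>t\<in>F. f (t ^ 3)) = (\<Sum>t\<in>F. f t)"
  by (rule sum_F_inj) (auto intro: inj_onI cube_inj)

lemma sum_F_fibres:
  fixes f :: "'k \<Rightarrow> complex" and A :: "'k set"
  assumes "h ` A \<subseteq> F"
  shows "(\<Sum>k\<in>A. w k * f (h k)) = (\<Sum>u\<in>F. f u * (\<Sum>k\<in>{k \<in> A. h k = u}. w k))"
proof -
  have "(\<Sum>k\<in>A. w k * f (h k)) = (\<Sum>u\<in>F. \<Sum>k\<in>{k \<in> A. h k = u}. w k * f (h k))"
    by (rule sum.group[symmetric]) (use assms in auto)
  also have "\<dots> = (\<Sum>u\<in>F. \<Sum>k\<in>{k \<in> A. h k = u}. w k * f u)"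
    by (intro sum.cong) auto
  finally show ?thesis by (simp add: sum_distrib_left mult.commute)
qed

lemma card_square_roots: "u \<in> F \<Longrightarrow> of_nat (card {k \<in> F. k\<^sup>2 = u}) = 1 + chi u"
proof -
  assume u: "u \<in> F"
  show ?thesis
  proof (cases "u = 0")
    case True
    hence "{k \<in> F. k\<^sup>2 = u} = {0}" by auto
    thus ?thesis using True by simp
  next
    case False
    show ?thesis
    proof (cases "\<exists>y\<in>F. u = y\<^sup>2")
      case True
      then obtain y where y: "y \<in> F" "u = y\<^sup>2" by auto
      hence "{k \<in> F. k\<^sup>2 = u} = {y, - y}" by (auto simp: power2_eq_iff)
      moreover have "y \<noteq> - y"
        using False y one_neq_minus_one by (metis mult_cancel_left2 mult_minus1_right power_zero_numeral)
      ultimately show ?thesis using False y by (simp add: chi_square)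
    next
      case False': False
      hence "{k \<in> F. k\<^sup>2 = u} = {}" by auto
      moreover have "chi u = -1" using False' u chi_eq_1_F chi_cases[OF False] by auto
      ultimately show ?thesis by (simp only:) simp
    qed
  qed
qed

lemma sum_F_square:
  fixes f :: "'k \<Rightarrow> complex"
  shows "(\<Sum>k\<in>F. f (k\<^sup>2)) = (\<Sum>u\<in>F. f u * (1 + chi u))"
proof -
  have "(\<Sum>k\<in>F. 1 * f (k\<^sup>2)) = (\<Sum>u\<in>F. f u * (\<Sum>k\<in>{k \<in> F. k\<^sup>2 = u}. 1))"
    by (rule sum_F_fibres) auto
  also have "\<dots> = (\<Sum>u\<in>F. f u * (1 + chi u))"
    by (intro sum.cong refl) (simp add: card_square_roots)
  finally show ?thesis by simp
qed

section \<open>The additive character\<close>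

text \<open>On F this is the absolute trace to the prime field, with values kept inside the big
  field. It is deliberately defined on all of E, because \<open>atr_cube_diff\<close> is applied to
  elements outside F.\<close>

definition atr :: "'k \<Rightarrow> 'k" where "atr x = (\<Sum>i<2 * e. x ^ (3 ^ i))"

lemma atr_add: "atr (x + y) = atr x + atr y"
  by (simp add: atr_def power_3_power_add sum.distrib)

lemma atr_0 [simp]: "atr 0 = 0"
  by (simp add: atr_def zero_power)

lemma atr_minus: "atr (- x) = - atr x"
  using atr_add[of x "- x"] by (simp add: add_eq_0_iff2 add.commute)

text \<open>The sum telescopes. If x lies outside F but x^3 - x lies in F, this reads off the
  absolute trace of x^3 - x from the action of Frobenius on x; both evaluations
  \<open>atr n = 1\<close> in \<open>line_sum_1\<close> and \<open>atr_inverse_tau\<close> arise in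
  this way.\<close>

lemma atr_cube_diff: "atr (x ^ 3 - x) = x ^ q - x"
proof -
  have "atr (x ^ 3 - x) = atr (x ^ 3) - atr x"
    using atr_add[of "x ^ 3" "- x"] by (simp add: atr_minus)
  also have "\<dots> = (\<Sum>i<2 * e. x ^ (3 ^ Suc i) - x ^ (3 ^ i))"
    by (simp add: atr_def sum_subtractf power_mult)
  also have "\<dots> = x ^ (3 ^ (2 * e)) - x ^ (3 ^ 0)"
    by (rule sum_lessThan_telescope)
  finally show ?thesis by (simp add: q_eq)
qed

lemma atr_cube: "x \<in> F \<Longrightarrow> atr (x ^ 3) = atr x"
  using atr_cube_diff[of x] atr_add[of "x ^ 3 - x" x] by (simp add: F_iff)

lemma atr_power_3: "atr x ^ 3 = atr (x ^ 3)"
proof -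
  have "(\<Sum>i\<in>A. f i) ^ 3 = (\<Sum>i\<in>A. f i ^ 3)" if "finite A" for A and f :: "nat \<Rightarrow> 'k"
    using that by induction (auto simp: cube_add)
  thus ?thesis by (simp add: atr_def power_mult[symmetric] mult.commute)
qed

lemma atr_cases: "x \<in> F \<Longrightarrow> atr x = 0 \<or> atr x = 1 \<or> atr x = - 1"
proof -
  assume "x \<in> F"
  hence "atr x ^ 3 = atr x" by (simp add: atr_power_3 atr_cube)
  hence "atr x * (atr x - 1) * (atr x + 1) = 0"
    by (simp add: algebra_simps power3_eq_cube)
  thus ?thesis by (auto simp: add_eq_0_iff2)
qed

definition zeta :: complex where "zeta = cis (2 * pi / 3)"

lemma zeta_cube: "zeta * zeta * zeta = 1"
  by (simp add: zeta_def cis_mult)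

lemma zeta_neq_1: "zeta \<noteq> 1"
  by (simp add: zeta_def complex_eq_iff cos_120 sin_120)

lemma zeta_sum: "1 + zeta + zeta\<^sup>2 = 0"
proof -
  have "(zeta - 1) * (1 + zeta + zeta\<^sup>2) = 0"
    using zeta_cube by (simp add: algebra_simps power2_eq_square)
  thus ?thesis using zeta_neq_1 by simp
qed

text \<open>On F the last branch is the value -1 of \<open>atr\<close>, so this is zeta to the power
  of the trace. It is an additive character on F only, which explains the membership conditions in
  what follows.\<close>

definition ec :: "'k \<Rightarrow> complex" where
  "ec x = (if atr x = 0 then 1 else if atr x = 1 then zeta else zeta\<^sup>2)"

lemma ec_0 [simp]: "ec 0 = 1"
  by (simp add: ec_def)

lemma ec_add: "x \<in> F \<Longrightarrow> y \<in> F \<Longrightarrow> ec (x + y) = ec x * ec y"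
proof -
  assume "x \<in> F" "y \<in> F"
  have z: "zeta * zeta\<^sup>2 = 1" "zeta\<^sup>2 * zeta = 1" "zeta\<^sup>2 * zeta\<^sup>2 = zeta"
    using zeta_cube by (auto simp: power2_eq_square mult.assoc)
  have o: "(-1::'k) \<noteq> 1" "(1::'k) + 1 = -1" "(-1::'k) - 1 = 1"
    using one_neq_minus_one by (auto simp: one_add_one[unfolded char_3])
  show ?thesis
    using atr_cases[OF \<open>x \<in> F\<close>] atr_cases[OF \<open>y \<in> F\<close>] z o
    by (auto simp: ec_def atr_add power2_eq_square)
qed

lemma ec_cube: "x \<in> F \<Longrightarrow> ec (x ^ 3) = ec x"
  by (simp add: ec_def atr_cube)

lemma ec_sum: "atr x = 1 \<Longrightarrow> ec x + ec (- x) = - 1"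
  using zeta_sum one_neq_minus_one by (simp add: ec_def atr_minus eq_neg_iff_add_eq_0 add_ac)

text \<open>Elements z^3 - z with z in F have absolute trace zero.\<close>

lemma ec_eq_if_diff: "x \<in> F \<Longrightarrow> y \<in> F \<Longrightarrow> z \<in> F \<Longrightarrow> x - y = z ^ 3 - z \<Longrightarrow> ec x = ec y"
  using atr_cube_diff[of z] atr_add[of "z ^ 3 - z" y] by (simp add: ec_def F_iff diff_eq_eq)

text \<open>The trace polynomial is nonzero of degree at most 3^(2e - 1), too small to vanish on all
  q elements of F.\<close>

lemma ex_atr_nonzero: "\<exists>x\<in>F. atr x \<noteq> 0"
proof (rule ccontr)
  assume *: "\<not> ?thesis"
  define p :: "'k poly" where "p = (\<Sum>i<2 * e. monom 1 (3 ^ i))"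
  have "coeff p (3 ^ 0) = 1"
    using e_pos by (simp add: p_def coeff_sum sum.delta' cong: if_cong) 
  hence "p \<noteq> 0" by auto
  have deg: "degree p \<le> 3 ^ (2 * e - 1)" unfolding p_def
    by (rule degree_sum_le) (auto intro!: order.trans[OF degree_monom_le] power_increasing)
  have "card F \<le> card {x. poly p x = 0}"
    using * by (intro card_mono) (auto simp: p_def poly_sum poly_monom atr_def)
  also have "\<dots> \<le> 3 ^ (2 * e - 1)"
    using card_poly_roots_bound[OF \<open>p \<noteq> 0\<close>] deg by linarith
  also have "\<dots> < 3 ^ (2 * e)" using e_pos by (intro power_strict_increasing) auto
  finally show False by (simp add: card_F q_eq[symmetric])
qed

lemma sum_ec: "k \<in> F \<Longrightarrow> (\<Sum>t\<in>F. ec (k * t)) = (if k = 0 then of_nat q else 0)"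
proof (cases "k = 0")
  case False
  assume k: "k \<in> F"
  obtain x where x: "x \<in> F" "atr x \<noteq> 0" using ex_atr_nonzero by blast
  have "ec x \<noteq> 1" using x zeta_neq_1 zeta_cube by (auto simp: ec_def power2_eq_square)
  have scale: "(\<Sum>t\<in>F. ec (k * t)) = (\<Sum>t\<in>F. ec t)"
    using k False by (rule sum_F_scale)
  have "(\<Sum>t\<in>F. ec t) = (\<Sum>t\<in>F. ec (t + x))"
    using x by (simp only: sum_F_shift)
  moreover have "(\<Sum>t\<in>F. ec (t + x)) = (\<Sum>t\<in>F. ec t) * ec x"
    using x by (simp add: ec_add sum_distrib_right)
  ultimately have "(\<Sum>t\<in>F. ec t) * ec x = (\<Sum>t\<in>F. ec t)" by simp
  hence "(\<Sum>t\<in>F. ec t) = 0" using \<open>ec x \<noteq> 1\<close> by simp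
  thus ?thesis using False scale by simp
qed (simp add: card_F)

section \<open>Gauss sums\<close>

definition gauss :: "nat \<Rightarrow> complex" where
  "gauss j = (\<Sum>k\<in>F. eta k ^ j * ec k)"

lemma sum_eta_power: "j \<in> {1, 2, 3} \<Longrightarrow> (\<Sum>k\<in>F. eta k ^ j) = 0"
proof -
  assume j: "j \<in> {1, 2, 3}"
  have "(\<Sum>k\<in>F. eta k ^ j) = (\<Sum>k\<in>F. eta (\<omega> * k) ^ j)"
    using \<omega>_in_F \<omega>_nonzero by (simp only: sum_F_scale[of \<omega> "\<lambda>k. eta k ^ j"] not_False_eq_True refl)
  also have "\<dots> = (- \<i>) ^ j * (\<Sum>k\<in>F. eta k ^ j)"
    by (simp only: eta_mult power_mult_distrib sum_distrib_left eta_\<omega>)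
  finally have "(\<Sum>k\<in>F. eta k ^ j) = (- \<i>) ^ j * (\<Sum>k\<in>F. eta k ^ j)" .
  moreover have "(- \<i>) ^ j \<noteq> 1" using j by (auto simp: power3_eq_cube complex_eq_iff)
  ultimately show ?thesis by simp
qed

text \<open>For nonzero x the factor is the inverse of \<open>eta x ^ j\<close>. Written with the
  positive exponent 4 - j it also covers x = 0, where both sides vanish.\<close>

lemma gauss_twist:
  assumes "j \<in> {1, 2, 3}" "x \<in> F"
  shows "(\<Sum>k\<in>F. eta k ^ j * ec (x * k)) = eta x ^ (4 - j) * gauss j"
proof (cases "x = 0")
  case True
  thus ?thesis using assms sum_eta_power[of j] by auto
next
  case False
  have "eta x ^ j * eta x ^ (4 - j) = 1"
    using assms(1) eta_power_4[OF False] by (auto simp: power_add[symmetric])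
  moreover have "gauss j = (\<Sum>k\<in>F. eta (x * k) ^ j * ec (x * k))"
    unfolding gauss_def using assms False
    by (intro sum_F_scale[of x "\<lambda>k. eta k ^ j * ec k", symmetric])
  hence "gauss j = eta x ^ j * (\<Sum>k\<in>F. eta k ^ j * ec (x * k))"
    by (simp add: eta_mult power_mult_distrib sum_distrib_left mult.assoc)
  ultimately show ?thesis by (simp add: mult.assoc[symmetric] mult.commute)
qed

text \<open>Expanding one factor by \<open>gauss_twist\<close> leaves a sum over k of full additive
  sums with frequency k + 1; only k = -1 survives, and \<open>eta\<close> is 1 there.\<close>

lemma gauss_mult:
  assumes "j \<in> {1, 2, 3}"
  shows "gauss j * gauss (4 - j) = of_nat q"
proof -
  have "gauss j * gauss (4 - j) = (\<Sum>x\<in>F. (eta x ^ (4 - j) * gauss j) * ec x)"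
    by (simp add: gauss_def[of "4 - j"] sum_distrib_left mult_ac)
  also have "\<dots> = (\<Sum>x\<in>F. \<Sum>k\<in>F. eta k ^ j * ec (x * k) * ec x)"
    using assms by (intro sum.cong refl) (simp add: gauss_twist[symmetric] sum_distrib_right)
  also have "\<dots> = (\<Sum>k\<in>F. \<Sum>x\<in>F. eta k ^ j * ec ((k + 1) * x))"
    by (subst sum.swap, intro sum.cong refl) (simp add: ring_distribs ec_add F_mult mult_ac)
  also have "\<dots> = (\<Sum>k\<in>F. if k = - 1 then eta k ^ j * of_nat q else 0)"
    by (intro sum.cong refl)
       (simp add: sum_distrib_left[symmetric] sum_ec F_add add_eq_0_iff2)
  also have "\<dots> = of_nat q" by (simp add: sum.delta')
  finally show ?thesis .
qed

definition G :: complex where "G = gauss 1"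
definition g :: complex where "g = gauss 2"

lemma g_squared: "g * g = of_nat q"
  using gauss_mult[of 2] by (simp add: g_def)

text \<open>Cubing permutes F, preserves \<open>ec\<close> and replaces \<open>eta\<close> by its
  third power, its inverse on nonzero elements. This is why the quartic Gauss sum has square q
  rather than merely absolute value sqrt q.\<close>

lemma gauss_3: "gauss 3 = G"
proof -
  have "G = (\<Sum>k\<in>F. eta (k ^ 3) * ec (k ^ 3))"
    unfolding G_def gauss_def by (simp add: sum_F_cube[of "\<lambda>k. eta k * ec k"])
  also have "\<dots> = gauss 3"
    unfolding gauss_def by (intro sum.cong refl) (simp add: eta_power ec_cube)
  finally show ?thesis by simp
qed

lemma G_squared: "G * G = of_nat q"
  using gauss_mult[of 1] gauss_3 by (simp add: G_def)

lemma G_eq: "G = 3 ^ e \<or> G = - (3 ^ e)"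
proof -
  have "G ^ 2 = (3 ^ e) ^ 2"
    using G_squared by (simp add: q_eq power2_eq_square power_add[symmetric] mult_2)
  thus ?thesis by (simp add: power2_eq_iff)
qed

lemma G_nonzero: "G \<noteq> 0"
  using G_eq by auto

lemma sum_ec_quadratic:
  assumes "A \<in> F" "A \<noteq> 0" "B \<in> F"
  shows "(\<Sum>t\<in>F. ec (A * t\<^sup>2 + B * t)) = chi A * g * ec (- (B\<^sup>2 / A))"
proof -
  \<comment> \<open>Completing the square with 2 = -1 and 4 = 1: the shift B / (2 A) becomes -(B /
    A) and the constant -B^2 / (4 A) becomes -(B^2 / A).\<close>
  have eq: "A * t\<^sup>2 + B * t = A * (t + (- (B / A)))\<^sup>2 + (- (B\<^sup>2 / A))" for t
  proof -
    have "A * (t + (- (B / A)))\<^sup>2 + (- (B\<^sup>2 / A)) = A * t\<^sup>2 - 2 * B * t"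
      using assms(2) by (simp add: power2_eq_square field_simps)
    thus ?thesis by simp
  qed
  have "(\<Sum>t\<in>F. ec (A * t\<^sup>2 + B * t)) = (\<Sum>t\<in>F. ec (A * (t + (- (B / A)))\<^sup>2) * ec (- (B\<^sup>2 / A)))"
    unfolding eq using assms by (intro sum.cong refl ec_add) (auto intro!: F_mult F_power F_minus F_divide F_diff)
  also have "\<dots> = (\<Sum>t\<in>F. ec (A * (t + (- (B / A)))\<^sup>2)) * ec (- (B\<^sup>2 / A))"
    by (simp add: sum_distrib_right)
  also have "(\<Sum>t\<in>F. ec (A * (t + (- (B / A)))\<^sup>2)) = (\<Sum>t\<in>F. ec (A * t\<^sup>2))"
    using assms by (intro sum_F_shift[of _ "\<lambda>t. ec (A * t\<^sup>2)"]) auto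
  also have "\<dots> = (\<Sum>u\<in>F. ec (A * u) * (1 + chi u))"
    by (rule sum_F_square)
  also have "\<dots> = (\<Sum>u\<in>F. ec (A * u)) + (\<Sum>u\<in>F. eta u ^ 2 * ec (A * u))"
    by (simp add: ring_distribs sum.distrib chi_def mult.commute)
  also have "\<dots> = chi A * g"
    using assms gauss_twist[of 2 A] by (simp add: sum_ec g_def chi_def)
  finally show ?thesis .
qed

section \<open>A twisted Kloosterman sum\<close>

definition kloosterman :: "'k \<Rightarrow> complex" where
  "kloosterman c = (\<Sum>m\<in>F. eta m * ec (c * (m + inverse m)))"

text \<open>If m = y^2, both summands equal chi y, and so do the values at the two roots y and -y.
  If m is a nonsquare, \<open>eta m\<close> is i or -i and the two summands cancel.\<close>

lemma eta_plus_eta_cube: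
  assumes "m \<in> F"
  shows "eta m + eta m ^ 3 = (\<Sum>l\<in>{l \<in> F. l\<^sup>2 = m}. chi l)"
proof (cases "\<exists>y\<in>F. m = y\<^sup>2")
  case True
  then obtain y where y: "y \<in> F" "m = y\<^sup>2" by auto
  show ?thesis
  proof (cases "y = 0")
    case False
    have "{l \<in> F. l\<^sup>2 = m} = {y, - y}" using y by (auto simp: power2_eq_iff)
    moreover have "y \<noteq> - y"
      using False one_neq_minus_one by (metis mult_cancel_left2 mult_minus1_right)
    moreover have "eta m ^ 3 = chi y"
      using y chi_cases[OF False] by (auto simp: eta_power chi_def[symmetric])
    ultimately show ?thesis using y by (simp add: eta_power chi_def)
  qed (use y in auto)
next
  case False
  hence "{l \<in> F. l\<^sup>2 = m} = {}" by auto
  moreover have "m \<noteq> 0" using False by (auto intro!: bexI[of _ 0])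
  hence "chi m = -1" using False assms chi_eq_1_F chi_cases by blast
  hence "eta m + eta m ^ 3 = 0"
    by (simp add: chi_def power3_eq_cube power2_eq_square mult.assoc)
  ultimately show ?thesis by (simp only: sum.empty)
qed

lemma sum_F_eta_plus_eta_cube:
  "(\<Sum>m\<in>F. (eta m + eta m ^ 3) * f m) = (\<Sum>l\<in>F. chi l * f (l\<^sup>2))"
proof -
  have "(\<Sum>l\<in>F. chi l * f (l\<^sup>2)) = (\<Sum>m\<in>F. f m * (\<Sum>l\<in>{l \<in> F. l\<^sup>2 = m}. chi l))"
    by (rule sum_F_fibres) auto
  thus ?thesis by (simp add: eta_plus_eta_cube mult.commute)
qed

text \<open>For h = l + 1/l one has h - 1 = (l + 1)^2 / l and h + 1 = (l - 1)^2 / l, because 2 = -1.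
  So both values on the right equal chi l, matching the two roots l and 1/l; for l = 1 and l = -1
  the roots coincide and one value is 0. If no l exists, the discriminant h^2 - 4 = (h - 1)(h + 1)
  is a nonsquare and the two values cancel.\<close>

lemma sum_chi_joukowski_fibre:
  assumes h: "h \<in> F"
  shows "(\<Sum>l\<in>{l \<in> F - {0}. l + inverse l = h}. chi l) = chi (h - 1) + chi (h + 1)"
proof (cases "\<exists>l\<in>F - {0}. l + inverse l = h")
  case True
  then obtain l where l: "l \<in> F" "l \<noteq> 0" "h = l + inverse l" by auto
  have "h - 1 = (l + 1)\<^sup>2 / l"
  proof -
    have "(l + 1)\<^sup>2 / l = l + 2 + inverse l" using l(2)
      by (simp add: power2_eq_square field_simps del: char_3)
    thus ?thesis by (simp add: l(3))
  qed
  hence 1: "chi (h - 1) = (chi (l + 1))\<^sup>2 * chi l"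
    by (simp add: chi_divide power2_eq_square chi_mult)
  have "h + 1 = (l - 1)\<^sup>2 / l"
  proof -
    have "(l - 1)\<^sup>2 / l = l - 2 + inverse l" using l(2)
      by (simp add: power2_eq_square field_simps del: char_3)
    thus ?thesis by (simp add: l(3))
  qed
  hence 2: "chi (h + 1) = (chi (l - 1))\<^sup>2 * chi l"
    by (simp add: chi_divide power2_eq_square chi_mult)
  have set: "{l' \<in> F - {0}. l' + inverse l' = h} = {l, inverse l}"
  proof -
    have "l' = l \<or> l' = inverse l" if "l' \<noteq> 0" "l' + inverse l' = h" for l'
    proof -
      have "(l' - l) * (l * l' - 1) = l * l' * ((l' + inverse l') - (l + inverse l))"
        using that(1) l(2) by (simp add: field_simps)
      hence "(l' - l) * (l * l' - 1) = 0" using that l by simp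
      hence "l' = l \<or> l * l' = 1" by simp
      thus ?thesis using inverse_unique[of l l'] by auto
    qed
    thus ?thesis using l by auto
  qed
  show ?thesis
  proof (cases "l = 1 \<or> l = -1")
    case True
    hence "inverse l = l" by auto
    hence "(\<Sum>l\<in>{l \<in> F - {0}. l + inverse l = h}. chi l) = chi l"
      unfolding set by simp
    moreover have "(chi (l + 1))\<^sup>2 + (chi (l - 1))\<^sup>2 = 1"
      using True by (elim disjE) simp_all
    hence "chi (h - 1) + chi (h + 1) = chi l"
      unfolding 1 2 distrib_right[symmetric] by simp
    ultimately show ?thesis by simp
  next
    case False
    have "l \<noteq> inverse l"
    proof
      assume "l = inverse l"
      hence "l * l = 1" using l(2) by (metis right_inverse)
      thus False using False by (simp add: square_eq_1_iff)
    qed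
    moreover have "(chi (l + 1))\<^sup>2 = 1" "(chi (l - 1))\<^sup>2 = 1"
      using False chi_chi[of "l + 1"] chi_chi[of "l - 1"]
      by (auto simp: power2_eq_square add_eq_0_iff2)
    ultimately show ?thesis using set 1 2 by (simp add: chi_inverse)
  qed
next
  case False
  have "chi (h - 1) * chi (h + 1) = - 1"
  proof (rule ccontr)
    assume neg: "\<not> ?thesis"
    have "\<exists>s\<in>F. (h - 1) * (h + 1) = s\<^sup>2"
    proof (cases "(h - 1) * (h + 1) = 0")
      case nz: False
      have "chi ((h - 1) * (h + 1)) = 1" using neg chi_cases[OF nz] by (auto simp: chi_mult)
      moreover have "(h - 1) * (h + 1) \<in> F" by (intro F_mult F_diff F_add h F_1)
      ultimately show ?thesis by (rule chi_eq_1_F[rotated])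
    qed (auto intro!: bexI[of _ 0])
    then obtain s where s: "s \<in> F" "(h - 1) * (h + 1) = s\<^sup>2" by auto
    \<comment> \<open>The root (h + s) / 2 of l^2 - h l + 1, with 1 / 2 = -1 and s a square root of
      the discriminant.\<close>
    define l where "l = - (h + s)"
    have "l * (l - h) = 2 * h\<^sup>2 + 3 * h * s + s\<^sup>2" by (simp add: l_def power2_eq_square algebra_simps del: char_3)
    also have "\<dots> = 3 * h\<^sup>2 + 3 * h * s - 1"
      unfolding s(2)[symmetric] by (simp add: power2_eq_square algebra_simps del: char_3)
    finally have "l * (l - h) = - 1" by (simp only: three_eq_0) simp
    hence "l * (h - l) = 1" by (simp add: algebra_simps)
    hence l: "l \<noteq> 0" "inverse l = h - l" by (auto simp: inverse_unique)
    have "l + inverse l = h" unfolding l(2) by simp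
    moreover have "l \<in> F" using h s by (auto simp: l_def)
    ultimately show False using False l(1) by blast
  qed
  moreover have "chi (h - 1) = 1 \<or> chi (h - 1) = -1"
    using calculation chi_cases[of "h - 1"] by fastforce
  ultimately have "chi (h - 1) + chi (h + 1) = 0" by auto
  moreover have "{l \<in> F - {0}. l + inverse l = h} = {}" using False by auto
  ultimately show ?thesis by (simp only: sum.empty)
qed

lemma sum_F_joukowski:
  "(\<Sum>l\<in>F. chi l * f (l + inverse l)) = (\<Sum>h\<in>F. f h * (chi (h - 1) + chi (h + 1)))"
proof -
  have "(\<Sum>l\<in>F. chi l * f (l + inverse l)) = (\<Sum>l\<in>F - {0}. chi l * f (l + inverse l))"
    by (intro sum.mono_neutral_right) auto
  also have "\<dots> = (\<Sum>h\<in>F. f h * (\<Sum>l\<in>{l \<in> F - {0}. l + inverse l = h}. chi l))"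
    by (rule sum_F_fibres) auto
  also have "\<dots> = (\<Sum>h\<in>F. f h * (chi (h - 1) + chi (h + 1)))"
    by (intro sum.cong refl) (simp only: sum_chi_joukowski_fibre)
  finally show ?thesis .
qed

text \<open>Inversion of m fixes the additive part and exchanges \<open>eta\<close> with its third
  power, so twice the sum carries the weight eta + eta^3. This weight unfolds along squares m = l^2,
  and l^2 + 1/l^2 depends only on h = l + 1/l. The two resulting sums, with h - 1 and h + 1, agree
  by the symmetry h -> -h.\<close>

lemma kloosterman_eq_sum_chi:
  assumes c: "c \<in> F"
  shows "kloosterman c = ec c * (\<Sum>h\<in>F. chi (h - 1) * ec (c * h\<^sup>2))"
proof -
  define f where "f m = ec (c * (m + inverse m))" for m
  have sq: "f (l\<^sup>2) * chi l = ec c * ec (c * (l + inverse l)\<^sup>2) * chi l" if l: "l \<in> F" for l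
  proof (cases "l = 0")
    case False
    have "l\<^sup>2 + inverse (l\<^sup>2) = (l + inverse l)\<^sup>2 - 2"
      using False by (simp add: power2_eq_square field_simps del: char_3)
    hence "l\<^sup>2 + inverse (l\<^sup>2) = 1 + (l + inverse l)\<^sup>2" by simp
    hence "f (l\<^sup>2) = ec (c + c * (l + inverse l)\<^sup>2)"
      by (simp only: f_def) (simp add: distrib_left)
    thus ?thesis using l c by (subst (asm) ec_add) (auto intro!: F_mult F_power F_add)
  qed simp
  have "kloosterman c = (\<Sum>m\<in>F. eta (inverse m) * f (inverse m))"
    by (simp only: sum_F_inverse[of "\<lambda>m. eta m * f m"]) (simp add: kloosterman_def f_def)
  also have "\<dots> = (\<Sum>m\<in>F. eta m ^ 3 * f m)"
    by (simp add: eta_inverse f_def add.commute)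
  finally have "2 * kloosterman c = (\<Sum>m\<in>F. (eta m + eta m ^ 3) * f m)"
    by (simp add: kloosterman_def f_def distrib_right sum.distrib)
  also have "\<dots> = (\<Sum>l\<in>F. chi l * f (l\<^sup>2))"
    by (rule sum_F_eta_plus_eta_cube)
  also have "\<dots> = (\<Sum>l\<in>F. chi l * (ec c * ec (c * (l + inverse l)\<^sup>2)))"
    by (intro sum.cong refl) (use sq in \<open>simp add: mult.commute\<close>)
  also have "\<dots> = (\<Sum>h\<in>F. ec c * ec (c * h\<^sup>2) * (chi (h - 1) + chi (h + 1)))"
    by (rule sum_F_joukowski)
  also have "\<dots> = ec c * (\<Sum>h\<in>F. chi (h - 1) * ec (c * h\<^sup>2)) + ec c * (\<Sum>h\<in>F. chi (h + 1) * ec (c * h\<^sup>2))"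
    by (simp add: sum_distrib_left sum.distrib[symmetric] algebra_simps)
  also have "(\<Sum>h\<in>F. chi (h + 1) * ec (c * h\<^sup>2)) = (\<Sum>h\<in>F. chi (- h + 1) * ec (c * (- h)\<^sup>2))"
    by (rule sum_F_uminus[symmetric])
  also have "\<dots> = (\<Sum>h\<in>F. chi (h - 1) * ec (c * h\<^sup>2))"
  proof (intro sum.cong refl)
    fix h show "chi (- h + 1) * ec (c * (- h)\<^sup>2) = chi (h - 1) * ec (c * h\<^sup>2)"
      using chi_minus[of "h - 1"] by simp
  qed
  finally show ?thesis by simp
qed

text \<open>After shifting h by 1, the weight chi h is written as (1 + chi h) - 1; the first part
  counts square roots and substitutes h = k^2, the second is a quadratic Gauss sum.\<close>

lemma kloosterman_eq_quartic:
  assumes c: "c \<in> F" "c \<noteq> 0"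
  shows "kloosterman c = ec (- c) * (\<Sum>k\<in>F. ec (c * (k ^ 4 - k\<^sup>2))) - chi c * g * ec c"
proof -
  have "(\<Sum>h\<in>F. chi (h - 1) * ec (c * h\<^sup>2)) = (\<Sum>h\<in>F. chi (h + 1 - 1) * ec (c * (h + 1)\<^sup>2))"
    by (rule sum_F_shift[symmetric]) simp
  also have "\<dots> = (\<Sum>h\<in>F. ec (c * (h + 1)\<^sup>2) * (1 + chi h)) - (\<Sum>h\<in>F. ec (c * (h + 1)\<^sup>2))"
    by (simp add: sum_subtractf[symmetric] algebra_simps)
  also have "(\<Sum>h\<in>F. ec (c * (h + 1)\<^sup>2) * (1 + chi h)) = (\<Sum>k\<in>F. ec (c * (k\<^sup>2 + 1)\<^sup>2))"
    by (rule sum_F_square[symmetric])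
  also have "\<dots> = (\<Sum>k\<in>F. ec c * ec (c * (k ^ 4 - k\<^sup>2)))"
  proof (intro sum.cong refl)
    fix k assume k: "k \<in> F"
    have "c * (k\<^sup>2 + 1)\<^sup>2 = c + c * (k ^ 4 + 2 * k\<^sup>2)"
      by (simp add: power2_eq_square eval_nat_numeral algebra_simps del: char_3)
    hence "c * (k\<^sup>2 + 1)\<^sup>2 = c + c * (k ^ 4 - k\<^sup>2)" by simp
    thus "ec (c * (k\<^sup>2 + 1)\<^sup>2) = ec c * ec (c * (k ^ 4 - k\<^sup>2))"
      using c k by (simp add: ec_add F_mult F_diff F_power)
  qed
  also have "(\<Sum>h\<in>F. ec (c * (h + 1)\<^sup>2)) = (\<Sum>h\<in>F. ec (c * h\<^sup>2))"
    by (rule sum_F_shift) simp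
  also have "\<dots> = chi c * g"
    using sum_ec_quadratic[of c 0] c by simp
  finally have "kloosterman c = ec c * (ec c * (\<Sum>k\<in>F. ec (c * (k ^ 4 - k\<^sup>2))) - chi c * g)"
    using c by (simp add: kloosterman_eq_sum_chi sum_distrib_left)
  moreover have "ec c * ec c = ec (- c)"
  proof -
    have "c + c = - c" using char_3(1) by (metis mult_2 mult_minus1)
    thus ?thesis using c ec_add[of c c] by simp
  qed
  ultimately show ?thesis by (simp add: algebra_simps)
qed

text \<open>The right-hand side is 3 on elements of trace zero and 0 elsewhere, so the claim says
  that the image of x -> x^3 - x is the kernel of the trace. One inclusion is
  \<open>atr_cube_diff\<close>; equality follows by counting, since all nonempty fibres have three
  elements and the kernel has q / 3.\<close>

lemma card_artin_schreier:
  assumes u: "u \<in> F"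
  shows "of_nat (card {x \<in> F. x ^ 3 - x = u}) = 1 + ec u + ec (- u)"
proof -
  define h where "h x = x ^ 3 - x" for x :: 'k
  have h_diff: "h x = h y \<longleftrightarrow> x - y \<in> {0, 1, -1}" for x y
  proof -
    have "h x - h y = (x - y) ^ 3 - (x - y)"
      using cube_add[of x "- y"] by (simp add: h_def)
    also have "\<dots> = (x - y) * (x - y - 1) * (x - y + 1)"
      by (simp add: power3_eq_cube algebra_simps)
    finally have "h x = h y \<longleftrightarrow> (x - y) * (x - y - 1) * (x - y + 1) = 0" by (metis right_minus_eq)
    thus ?thesis by (auto simp: add_eq_0_iff2)
  qed
  have fibre: "card {x \<in> F. h x = h y} = 3" if y: "y \<in> F" for y
  proof -
    have "{x \<in> F. h x = h y} = {y, y + 1, y - 1}"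
      using y by (auto simp: h_diff algebra_simps)
    moreover have "y + 1 \<noteq> y - 1" using one_neq_minus_one
      by (metis add.commute add_diff_cancel_left' diff_add_cancel minus_diff_eq uminus_add_conv_diff)
    ultimately show ?thesis by simp
  qed
  have vals: "1 + ec u + ec (- u) = (if atr u = 0 then 3 else 0)" if "u \<in> F" for u
    using atr_cases[OF that] zeta_sum by (auto simp: ec_def atr_minus add_ac)
  have im: "h ` F \<subseteq> {u \<in> F. atr u = 0}"
    by (auto simp: h_def atr_cube_diff F_iff[symmetric])
  have "of_nat q = (\<Sum>u\<in>F. 1 + ec (1 * u) + ec ((-1) * u))"
    using sum_ec[of 1] sum_ec[of "-1"] by (simp add: sum.distrib card_F del: mult_minus1 mult_1)
  also have "\<dots> = (\<Sum>u\<in>F. if atr u = 0 then 3 else 0)"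
    by (intro sum.cong refl) (simp add: vals)
  also have "\<dots> = of_nat (3 * card {u \<in> F. atr u = 0})"
    by (simp add: sum.If_cases Int_def)
  finally have card_ker: "q = 3 * card {u \<in> F. atr u = 0}" using of_nat_eq_iff by blast
  have "card F = (\<Sum>u\<in>h ` F. card {x \<in> F. h x = u})"
    using sum.image_gen[of F "\<lambda>_. 1::nat" h] by simp
  also have "\<dots> = (\<Sum>u\<in>h ` F. 3)" by (intro sum.cong refl) (auto simp: fibre)
  finally have "card (h ` F) = card {u \<in> F. atr u = 0}" using card_ker by (simp add: card_F)
  hence eq: "h ` F = {u \<in> F. atr u = 0}" using im by (intro card_subset_eq) auto
  show ?thesis
  proof (cases "atr u = 0")
    case True
    then obtain y where "y \<in> F" "u = h y" using u eq by blast
    thus ?thesis using True vals[OF u] fibre[of y] unfolding h_def by simp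
  next
    case False
    hence "{x \<in> F. x ^ 3 - x = u} = {}" using eq by (auto simp: h_def)
    thus ?thesis using vals[OF u] False by (simp only:) simp
  qed
qed

lemma sum_F_artin_schreier:
  fixes f :: "'k \<Rightarrow> complex"
  shows "(\<Sum>x\<in>F. f (x ^ 3 - x)) = (\<Sum>u\<in>F. f u * (1 + ec u + ec (- u)))"
proof -
  have "(\<Sum>x\<in>F. 1 * f (x ^ 3 - x)) = (\<Sum>u\<in>F. f u * (\<Sum>x\<in>{x \<in> F. x ^ 3 - x = u}. 1))"
    by (rule sum_F_fibres) auto
  also have "\<dots> = (\<Sum>u\<in>F. f u * (1 + ec u + ec (- u)))"
    by (intro sum.cong refl) (simp add: card_artin_schreier)
  finally show ?thesis by simp
qed

text \<open>
  Since \<open>ec\<close> is invariant under cubing, \<open>ec (c * (k ^ 4 - k\<^sup>2))\<close> is the value of an \<open>F\<^sub>3\<close>-quadratic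
  form; a root \<open>T\<close> of \<open>T ^ 4 + T = - c\<^sup>-\<^sup>2\<close> is what makes it the pull-back of a one-variable
  form \<open>c * T * l\<^sup>2\<close> along the additive map \<open>k \<mapsto> k - k\<^sup>3 / T\<close>.
\<close>

lemma ec_quartic_eq_ec_square:
  assumes "c \<in> F" "T \<in> F" "T \<noteq> 0" "k \<in> F" and T: "c\<^sup>2 * (T ^ 4 + T) = - 1"
  shows "ec (c * (k ^ 4 - k\<^sup>2)) = ec (c * T * (k - k ^ 3 / T)\<^sup>2)"
proof -
  have c0: "c \<noteq> 0" using T by auto
  have "c * T * (k - k ^ 3 / T)\<^sup>2 = c * T * k\<^sup>2 - 2 * (c * k ^ 4) + c / T * k ^ 6"
    using assms(3) by (simp add: power2_eq_square eval_nat_numeral field_simps del: char_3)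
  hence 1: "c * T * (k - k ^ 3 / T)\<^sup>2 = c * k ^ 4 + (c * T * k\<^sup>2 + c / T * k ^ 6)"
    by (simp add: algebra_simps)
  \<comment> \<open>The quartic equation for T in the form needed below: cubing the k^2 term moves
    it to k^6, where both terms together are the cube of -(c k^2).\<close>
  have eq: "(c * T) ^ 3 + c / T = - (c ^ 3)"
  proof -
    have "((c * T) ^ 3 + c / T + c ^ 3) * T = c * (c\<^sup>2 * (T ^ 4 + T) + 1)"
      using assms(3) by (simp add: power2_eq_square eval_nat_numeral field_simps del: char_3)
    hence "(c * T) ^ 3 + c / T + c ^ 3 = 0" using assms(3) by (simp add: T)
    thus ?thesis by (simp add: eq_neg_iff_add_eq_0)
  qed
  have 2: "(c * T * k\<^sup>2) ^ 3 + c / T * k ^ 6 = (- (c * k\<^sup>2)) ^ 3"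
  proof -
    have "(c * T * k\<^sup>2) ^ 3 + c / T * k ^ 6 = ((c * T) ^ 3 + c / T) * k ^ 6"
      by (simp only: power_mult_distrib[of "c * T"] distrib_right power_mult[symmetric]) simp
    also have "\<dots> = (- (c * k\<^sup>2)) ^ 3"
      unfolding eq by (simp add: power_mult_distrib power_mult[symmetric])
    finally show ?thesis .
  qed
  have "ec (c * T * k\<^sup>2 + c / T * k ^ 6) = ec ((c * T * k\<^sup>2) ^ 3) * ec (c / T * k ^ 6)"
    using assms by (subst ec_cube; intro ec_add F_mult F_power F_divide) auto
  also have "\<dots> = ec ((- (c * k\<^sup>2)) ^ 3)"
    unfolding 2[symmetric] using assms by (subst ec_add) (auto intro!: F_mult F_power F_divide)
  also have "\<dots> = ec (- (c * k\<^sup>2))"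
    using assms by (intro ec_cube) auto
  finally have 3: "ec (c * T * k\<^sup>2 + c / T * k ^ 6) = ec (- (c * k\<^sup>2))" .
  have "ec (c * (k ^ 4 - k\<^sup>2)) = ec (c * k ^ 4 + - (c * k\<^sup>2))"
    by (simp add: algebra_simps)
  also have "\<dots> = ec (c * k ^ 4) * ec (- (c * k\<^sup>2))"
    using assms by (intro ec_add) (auto intro!: F_mult F_power)
  also have "\<dots> = ec (c * T * (k - k ^ 3 / T)\<^sup>2)"
    unfolding 1 3[symmetric] using assms
    by (intro ec_add[symmetric]) (auto intro!: F_mult F_power F_add F_divide)
  finally show ?thesis .
qed

text \<open>The additive map k -> k - k^3 / T has kernel given by k = 0 or k^2 = T. For nonsquare T
  it is a bijection of F, and an ordinary quadratic Gauss sum remains.\<close>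

lemma quartic_sum_nonsquare:
  assumes "c \<in> F" "T \<in> F" and T: "c\<^sup>2 * (T ^ 4 + T) = - 1" and chiT: "chi T = - 1"
  shows "(\<Sum>k\<in>F. ec (c * (k ^ 4 - k\<^sup>2))) = - chi c * g"
proof -
  have nz: "c \<noteq> 0" "T \<noteq> 0" using T by auto
  define h where "h k = k - k ^ 3 / T" for k
  have "inj_on h F"
  proof (rule inj_onI)
    fix x y assume "x \<in> F" "y \<in> F" "h x = h y"
    hence "(x - y) = (x - y) ^ 3 / T"
      using cube_add[of x "- y"] by (simp add: h_def diff_divide_distrib) (simp add: algebra_simps)
    hence "(x - y) * (T - (x - y)\<^sup>2) = 0"
      using nz by (simp add: field_simps eval_nat_numeral)
    moreover have "T \<noteq> (x - y)\<^sup>2" using chiT chi_square[of "x - y"] nz by (cases "x = y") auto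
    ultimately show "x = y" by auto
  qed
  moreover have "h ` F \<subseteq> F" using assms by (auto simp: h_def)
  ultimately have "(\<Sum>k\<in>F. ec (c * T * (h k)\<^sup>2)) = (\<Sum>k\<in>F. ec (c * T * k\<^sup>2))"
    by (rule sum_F_inj)
  also have "\<dots> = chi (c * T) * g"
    using sum_ec_quadratic[of "c * T" 0] assms nz by (simp add: F_mult)
  finally show ?thesis
    using assms nz by (simp add: ec_quartic_eq_ec_square[of c T] h_def chi_mult)
qed

text \<open>For T = r^2 the scaling k -> r k turns the additive map into an Artin-Schreier map and
  the coefficient into A = c T^2. Its fibre count adds linear terms 0, u and -u to the quadratic
  exponent; the last two give the same value because only the square of the linear coefficient
  matters.\<close>

lemma quartic_sum_square:
  assumes c: "c \<in> F" and T: "c\<^sup>2 * (T ^ 4 + T) = - 1" and r: "r \<in> F" "T = r\<^sup>2"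
  shows "(\<Sum>k\<in>F. ec (c * (k ^ 4 - k\<^sup>2))) = chi c * g * (1 + 2 * ec (- (1 / (c * T\<^sup>2))))"
proof -
  have nz: "c \<noteq> 0" "T \<noteq> 0" "r \<noteq> 0" using T r by auto
  have TF: "T \<in> F" using r by auto
  define A where "A = c * T\<^sup>2"
  have A: "A \<in> F" "A \<noteq> 0" "chi A = chi c"
    using c TF nz by (auto simp: A_def chi_mult chi_square)
  have "(\<Sum>k\<in>F. ec (c * (k ^ 4 - k\<^sup>2))) = (\<Sum>k\<in>F. ec (c * T * (k - k ^ 3 / T)\<^sup>2))"
    using c TF nz T by (intro sum.cong refl ec_quartic_eq_ec_square)
  also have "\<dots> = (\<Sum>k\<in>F. ec (c * T * (r * k - (r * k) ^ 3 / T)\<^sup>2))"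
    using r nz by (intro sum_F_scale[symmetric, of _ "\<lambda>k. ec (c * T * (k - k ^ 3 / T)\<^sup>2)"])
  also have "\<dots> = (\<Sum>k\<in>F. ec (A * (k ^ 3 - k)\<^sup>2))"
  proof (intro sum.cong refl arg_cong[of _ _ ec])
    fix k
    show "c * T * (r * k - (r * k) ^ 3 / T)\<^sup>2 = A * (k ^ 3 - k)\<^sup>2"
      using nz by (simp add: A_def r(2) power2_eq_square eval_nat_numeral field_simps del: char_3)
  qed
  also have "\<dots> = (\<Sum>u\<in>F. ec (A * u\<^sup>2) * (1 + ec u + ec (- u)))"
    by (rule sum_F_artin_schreier)
  also have "\<dots> = (\<Sum>u\<in>F. ec (A * u\<^sup>2 + 0 * u)) + (\<Sum>u\<in>F. ec (A * u\<^sup>2 + 1 * u)) + (\<Sum>u\<in>F. ec (A * u\<^sup>2 + (-1) * u))"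
    unfolding sum.distrib[symmetric]
  proof (intro sum.cong refl)
    fix u assume u: "u \<in> F"
    have "A * u\<^sup>2 \<in> F" using A u by auto
    thus "ec (A * u\<^sup>2) * (1 + ec u + ec (- u))
      = ec (A * u\<^sup>2 + 0 * u) + ec (A * u\<^sup>2 + 1 * u) + ec (A * u\<^sup>2 + (-1) * u)"
      using u ec_add[of "A * u\<^sup>2" u] ec_add[of "A * u\<^sup>2" "- u"] by (simp add: algebra_simps)
  qed
  also have "\<dots> = chi A * g * (1 + 2 * ec (- (1 / A)))"
    using A sum_ec_quadratic[of A 0] sum_ec_quadratic[of A 1] sum_ec_quadratic[of A "-1"]
    by (simp del: mult_minus1 mult_1 mult_zero_left add_0_right) (simp add: algebra_simps)
  finally show ?thesis using A(3) by (simp add: A_def)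
qed

text \<open>Whether or not T is a square, the sum becomes a multiple of ec c + ec (-c), which is -1
  when atr c = 1; so the exponentials disappear and only the sign chi T is left. In the square case
  this depends on ec (-1 / (c T^2)) = ec (-c), which is shown with explicit elements of F.\<close>

lemma kloosterman_eq:
  assumes c: "c \<in> F" and T: "T \<in> F" "c\<^sup>2 * (T ^ 4 + T) = - 1" and tr: "atr c = 1"
  shows "kloosterman c = - chi c * chi T * g"
proof -
  have nz: "c \<noteq> 0" "T \<noteq> 0" using T by auto
  have sum: "ec c + ec (- c) = - 1" using tr by (rule ec_sum)
  have kl: "kloosterman c = ec (- c) * (\<Sum>k\<in>F. ec (c * (k ^ 4 - k\<^sup>2))) - chi c * g * ec c"
    using c nz by (intro kloosterman_eq_quartic)
  consider "chi T = 1" | "chi T = -1" using chi_cases nz by blast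
  thus ?thesis
  proof cases
    case 2
    have "kloosterman c = ec (- c) * (- chi c * g) - chi c * g * ec c"
      using kl quartic_sum_nonsquare[OF c T 2] by simp
    also have "\<dots> = - chi c * g * (ec c + ec (- c))" by (simp add: algebra_simps)
    finally show ?thesis using 2 by (simp add: sum)
  next
    case 1
    then obtain r where r: "r \<in> F" "T = r\<^sup>2" using T chi_eq_1_F by blast
    have T1: "T + 1 \<noteq> 0"
    proof
      assume "T + 1 = 0"
      hence "T ^ 4 + T = 0" by (simp add: add_eq_0_iff2)
      thus False using T by simp
    qed
    \<comment> \<open>In characteristic 3 one has T^4 + T = T (T + 1)^3, so the hypothesis on T
      makes this z a square root of -T (T + 1).\<close>
    define z where "z = 1 / (c * (T + 1))"
    have zF: "z \<in> F" unfolding z_def by (intro F_divide F_mult F_add c T F_1)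
    have z0: "z \<noteq> 0" using nz T1 by (simp add: z_def)
    have T4: "T ^ 4 + T = T * (T + 1) ^ 3" by (simp add: cube_add) (simp add: eval_nat_numeral algebra_simps)
    have z2: "z\<^sup>2 = - (T * (T + 1))"
    proof -
      have "c\<^sup>2 * T * (T + 1) ^ 3 = - 1" using T T4 by (simp add: mult.assoc)
      hence "(c * (T + 1))\<^sup>2 * (T * (T + 1)) = - 1"
        by (simp add: power2_eq_square power3_eq_cube mult_ac)
      moreover have "(c * (T + 1))\<^sup>2 \<noteq> 0" using nz T1 by simp
      ultimately have "T * (T + 1) = - 1 / (c * (T + 1))\<^sup>2"
        by (metis nonzero_mult_div_cancel_left)
      thus ?thesis by (simp add: z_def power_divide)
    qed
    have cz: "c = 1 / (z * (T + 1))" using nz T1 by (simp add: z_def)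
    have "1 / (c * T\<^sup>2) = - ((z / T) ^ 3)"
    proof -
      have "1 / (c * T\<^sup>2) = z * (T * (T + 1)) / T ^ 3"
        using nz T1 z0 by (simp add: cz field_simps eval_nat_numeral)
      also have "T * (T + 1) = - z\<^sup>2" by (simp add: z2)
      finally show ?thesis using nz by (simp add: field_simps eval_nat_numeral)
    qed
    hence "ec (- (1 / (c * T\<^sup>2))) = ec (z / T)"
      using ec_cube[of "z / T"] zF T by auto
    also have "ec (z / T) = ec (- c)"
    \<comment> \<open>z / T + c is the Artin-Schreier difference y^3 - y at y = -(T / z): after
      clearing denominators and substituting z^2 = -T (T + 1) the two sides differ by a multiple of
      3.\<close>
    proof (rule ec_eq_if_diff[of _ _ "- (T / z)"])
      have "(z / T - - c) * (z ^ 3 * T * (T + 1)) = ((- (T / z)) ^ 3 - - (T / z)) * (z ^ 3 * T * (T + 1))"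
      proof -
        have "(z / T - - c) * (z ^ 3 * T * (T + 1)) = (z\<^sup>2)\<^sup>2 * (T + 1) + z\<^sup>2 * T"
        proof -
          have "c * (z * (T + 1)) = 1" using nz T1 by (simp add: z_def)
          hence "c * (z ^ 3 * T * (T + 1)) = z\<^sup>2 * T"
            by (simp add: power3_eq_cube power2_eq_square mult_ac)
          moreover have "z / T * (z ^ 3 * T * (T + 1)) = (z\<^sup>2)\<^sup>2 * (T + 1)"
            using nz by (simp add: power3_eq_cube power2_eq_square mult_ac)
          ultimately show ?thesis by (simp add: distrib_right)
        qed
        moreover have "((- (T / z)) ^ 3 - - (T / z)) * (z ^ 3 * T * (T + 1)) = (T * z\<^sup>2 - T ^ 3) * (T * (T + 1))"
          using nz T1 z0 by (simp add: field_simps eval_nat_numeral)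
        moreover have "(z\<^sup>2)\<^sup>2 * (T + 1) + z\<^sup>2 * T - (T * z\<^sup>2 - T ^ 3) * (T * (T + 1)) = 3 * (T\<^sup>2 * (T + 1) * (T\<^sup>2 + T))"
          unfolding z2 by (simp add: eval_nat_numeral algebra_simps del: char_3)
        ultimately show ?thesis by (simp only: three_eq_0) simp
      qed
      thus "z / T - - c = (- (T / z)) ^ 3 - - (T / z)" using nz z0 T1 by simp
    qed (use zF T c in auto)
    finally have "ec (- (1 / (c * T\<^sup>2))) = ec (- c)" .
    hence "kloosterman c = ec (- c) * (chi c * g * (1 + 2 * ec (- c))) - chi c * g * ec c"
      using kl c T r quartic_sum_square[of c T r] by simp
    also have "ec (- c) * (chi c * g * (1 + 2 * ec (- c))) = chi c * g * (ec (- c) + 2 * (ec (- c) * ec (- c)))"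
      by (simp add: algebra_simps)
    also have "ec (- c) * ec (- c) = ec c"
    proof -
      have "- c + - c = c" using char_3(1) by (metis minus_add_distrib minus_minus mult_2 mult_minus1)
      thus ?thesis using c ec_add[of "- c" "- c"] by simp
    qed
    also have "chi c * g * (ec (- c) + 2 * ec c) - chi c * g * ec c = chi c * g * (ec c + ec (- c))"
      by (simp add: algebra_simps)
    finally show ?thesis using 1 by (simp add: sum)
  qed
qed

section \<open>Line sums of the quartic character\<close>

lemma square_frob: "((x::'k)\<^sup>2) ^ q = (x ^ q)\<^sup>2"
  by (simp add: power_mult[symmetric] mult.commute)

lemma frob_diff_eq_0_iff: "(x ^ q) ^ q - x ^ q = 0 \<longleftrightarrow> x \<in> F" for x :: 'k
proof
  assume "(x ^ q) ^ q - x ^ q = 0"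
  hence *: "(x ^ q) ^ q = x ^ q" by simp
  have "((x ^ q) ^ q) ^ q = (x ^ q) ^ q" by (simp only: *)
  hence "x = (x ^ q) ^ q" by (simp only: frob_frob_frob)
  thus "x \<in> F" unfolding F_iff using * by metis
qed (simp add: F_iff)

lemma S_setD:
  fixes a :: 'k
  assumes "a \<in> S_set q"
  shows "a \<noteq> 0" "a * a ^ q * (a ^ q) ^ q = 1" "a\<^sup>2 + (a ^ q)\<^sup>2 + ((a ^ q) ^ q)\<^sup>2 = (0::'k)"
  using assms by (auto simp: S_set_def Nm_eq Tr_eq square_frob)

text \<open>For a in S the three conjugates of a^2 sum to zero, so in characteristic 3 they form an
  arithmetic progression; this is its common difference, hence an element of F.\<close>

definition tau :: "'k \<Rightarrow> 'k" where "tau a = ((a ^ q) ^ q)\<^sup>2 - (a ^ q)\<^sup>2"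

lemma F_eq_1_if_cube: "x ^ 3 = 1 \<Longrightarrow> x = (1::'k)"
  using cube_inj[of x 1] by simp

lemma tau_in_F:
  assumes "a \<in> S_set q" shows "tau a \<in> F"
proof -
  have "tau a ^ q = a\<^sup>2 - ((a ^ q) ^ q)\<^sup>2"
    by (simp add: tau_def frob_diff square_frob)
  also have "\<dots> = a\<^sup>2 + (a ^ q)\<^sup>2 + ((a ^ q) ^ q)\<^sup>2 + tau a - 3 * ((a ^ q) ^ q)\<^sup>2"
    by (simp add: tau_def algebra_simps)
  also have "\<dots> = tau a" unfolding S_setD(3)[OF assms] three_eq_0 by simp
  finally show ?thesis by (simp add: F_iff)
qed

lemma tau_nonzero:
  assumes "a \<in> S_set q" "a \<noteq> 1" shows "tau a \<noteq> 0"
proof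
  assume "tau a = 0"
  hence "((a\<^sup>2) ^ q) ^ q = (a\<^sup>2) ^ q" by (simp add: tau_def square_frob)
  hence "a\<^sup>2 \<in> F" using frob_diff_eq_0_iff[of "a\<^sup>2"] by simp
  moreover have "Nm q (a\<^sup>2) = 1" using assms(1) by (simp add: S_set_def power2_eq_square Nm_mult)
  ultimately have "a\<^sup>2 = 1" by (simp add: Nm_F F_eq_1_if_cube)
  hence "a = - 1" using assms(2) by (simp add: power2_eq_1_iff)
  hence "Nm q a = - 1" by (subst Nm_F) auto
  thus False using assms one_neq_minus_one by (simp add: S_set_def)
qed

lemma tau_squared:
  assumes "a \<in> S_set q"
  shows "(tau a)\<^sup>2 = - (a\<^sup>2 * (a ^ q)\<^sup>2 + (a ^ q)\<^sup>2 * ((a ^ q) ^ q)\<^sup>2 + ((a ^ q) ^ q)\<^sup>2 * a\<^sup>2)"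
proof -
  define A B C where "A = a\<^sup>2" and "B = (a ^ q)\<^sup>2" and "C = ((a ^ q) ^ q)\<^sup>2"
  have A: "A = - (B + C)" using S_setD(3)[OF assms]
    unfolding A_def B_def C_def eq_neg_iff_add_eq_0 by (simp only: add.assoc)
  have "(C - B)\<^sup>2 = - (A * B + B * C + C * A) - 3 * (B * C)"
    unfolding A by (simp add: power2_eq_square algebra_simps)
  hence "(C - B)\<^sup>2 = - (A * B + B * C + C * A)" by (simp only: three_eq_0) simp
  thus ?thesis by (simp add: tau_def A_def B_def C_def)
qed

text \<open>The square of the trace is -e2(a), because the squares of the conjugates of a sum to
  zero; squaring e2 again gives e2(a^2) + 2 Nm a * Tr a. The result is the equation required of T in
  \<open>kloosterman_eq\<close>, with T = Tr a and c = 1 / tau a.\<close>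

lemma Tr_quartic:
  assumes "a \<in> S_set q"
  shows "Tr q a ^ 4 + Tr q a = - (tau a)\<^sup>2"
proof -
  define b c where "b = a ^ q" and "c = (a ^ q) ^ q"
  have n: "a * b * c = 1" and s: "a\<^sup>2 + b\<^sup>2 + c\<^sup>2 = 0"
    using S_setD[OF assms] by (auto simp: b_def c_def)
  have T: "Tr q a = a + b + c" by (simp add: Tr_eq b_def c_def)
  have t2: "(tau a)\<^sup>2 = - (a\<^sup>2 * b\<^sup>2 + b\<^sup>2 * c\<^sup>2 + c\<^sup>2 * a\<^sup>2)"
    using tau_squared[OF assms] by (simp only: b_def c_def)
  define E where "E = a * b + b * c + c * a"
  have "(a + b + c)\<^sup>2 = a\<^sup>2 + b\<^sup>2 + c\<^sup>2 + 2 * E" by (simp add: E_def power2_eq_square algebra_simps del: char_3)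
  hence T2: "Tr q a ^ 2 = - E" by (simp add: s T)
  have "E\<^sup>2 = (a\<^sup>2 * b\<^sup>2 + b\<^sup>2 * c\<^sup>2 + c\<^sup>2 * a\<^sup>2) + 2 * (a * b * c) * (a + b + c)"
    by (simp add: E_def power2_eq_square algebra_simps del: char_3)
  also have "\<dots> = - (tau a)\<^sup>2 - Tr q a"
    unfolding t2 n T by (simp add: algebra_simps)
  finally have "(Tr q a ^ 2)\<^sup>2 = - (tau a)\<^sup>2 - Tr q a" by (simp add: T2)
  thus ?thesis by (simp add: power_mult[symmetric])
qed

lemma Tr_nonzero: "a \<in> S_set q \<Longrightarrow> a \<noteq> 1 \<Longrightarrow> Tr q a \<noteq> 0" for a :: 'k
  using Tr_quartic[of a] tau_nonzero[of a] by auto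

text \<open>The element h = a^2 / tau a has conjugates h, h + 1, h + 2, so its norm 1 / tau^3 equals
  h^3 - h. The absolute trace of that is h^q - h = 1.\<close>

lemma atr_inverse_tau:
  assumes "a \<in> S_set q" "a \<noteq> 1"
  shows "atr (1 / tau a) = 1"
proof -
  define h where "h = a\<^sup>2 / tau a"
  have t: "tau a \<in> F" "tau a \<noteq> 0" using assms tau_in_F tau_nonzero by auto
  have h1: "h ^ q = (a ^ q)\<^sup>2 / tau a" and h2: "(h ^ q) ^ q = ((a ^ q) ^ q)\<^sup>2 / tau a"
    using t by (simp_all add: h_def power_divide square_frob F_iff)
  have "(h ^ q) ^ q - h ^ q = tau a / tau a"
    by (subst h2, subst h1, subst (3) tau_def, simp only: diff_divide_distrib)
  hence d: "(h ^ q) ^ q = h ^ q + 1" using t by (simp add: algebra_simps)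
  have "h + h ^ q + (h ^ q) ^ q = 0"
    using S_setD(3)[OF assms(1)] by (subst h2, subst h1) (simp add: h_def add_divide_distrib[symmetric])
  hence "h + 2 * h ^ q + 1 = 0" using d by (simp add: algebra_simps del: char_3)
  hence hq: "h ^ q = h + 1" by (simp add: algebra_simps add_eq_0_iff2)
  hence hqq: "(h ^ q) ^ q = h + 2" using d by (simp add: add.assoc del: char_3)
  have "h * h ^ q * (h ^ q) ^ q = 1 / tau a ^ 3"
  proof -
    have "h * h ^ q * (h ^ q) ^ q = (a * a ^ q * (a ^ q) ^ q)\<^sup>2 / tau a ^ 3"
      by (subst h2, subst h1) (simp add: h_def power3_eq_cube power_mult_distrib)
    thus ?thesis by (simp add: S_setD(2)[OF assms(1)])
  qed
  moreover have "h * h ^ q * (h ^ q) ^ q = h ^ 3 - h"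
  proof -
    have "h * (h + 1) * (h + 2) = h ^ 3 - h + 3 * (h\<^sup>2 + h)"
      by (simp add: power2_eq_square power3_eq_cube algebra_simps del: char_3)
    thus ?thesis by (subst hqq, subst hq) (simp only: three_eq_0, simp)
  qed
  ultimately have "atr ((1 / tau a) ^ 3) = h ^ q - h"
    by (simp add: power_one_over atr_cube_diff[symmetric])
  thus ?thesis using atr_cube[of "1 / tau a"] F_divide[OF F_1 t(1)] hq by simp
qed

text \<open>The conjugates of a^2 have elementary symmetric functions 0, -(tau a)^2 and 1, and the
  norm is a product of three factors linear in them.\<close>

lemma Nm_line:
  assumes "a \<in> S_set q" "a \<noteq> 1" "t \<in> F"
  shows "Nm q (- 1 / (tau a * a\<^sup>2) + t) = t ^ 3 + tau a * t\<^sup>2 - 1 / tau a ^ 3"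
proof -
  define A B C where "A = a\<^sup>2" and "B = (a ^ q)\<^sup>2" and "C = ((a ^ q) ^ q)\<^sup>2"
  define r where "r = tau a"
  have r: "r \<in> F" "r \<noteq> 0" using assms tau_in_F tau_nonzero by (auto simp: r_def)
  have nz: "A \<noteq> 0" "B \<noteq> 0" "C \<noteq> 0" using S_setD(1)[OF assms(1)] by (auto simp: A_def B_def C_def)
  have sum: "A + B + C = 0" using S_setD(3)[OF assms(1)] by (simp add: A_def B_def C_def)
  have prod: "A * B * C = 1" using S_setD(2)[OF assms(1)]
    by (simp add: A_def B_def C_def power_mult_distrib[symmetric])
  have e2: "A * B + B * C + C * A = - r\<^sup>2"
    using tau_squared[OF assms(1)] by (simp add: A_def B_def C_def r_def)
  define w where "w = - 1 / (r * A) + t"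
  have w1: "w ^ q = - 1 / (r * B) + t" and w2: "(w ^ q) ^ q = - 1 / (r * C) + t"
    using r assms(3)
    by (simp_all add: w_def frob_add frob_diff frob_minus power_divide power_mult_distrib F_iff A_def B_def C_def square_frob)
  have f: "- 1 / (r * X) + t = (1 - t * r * X) / (- (r * X))" if "X \<noteq> 0" for X
    using that r by (simp add: field_simps)
  have "Nm q w = ((1 - t * r * A) * (1 - t * r * B) * (1 - t * r * C)) / (- (r ^ 3 * (A * B * C)))"
    unfolding Nm_eq
    by (subst w2, subst w1, unfold w_def, unfold f[OF nz(1)] f[OF nz(2)] f[OF nz(3)])
       (simp add: power3_eq_cube mult_ac)
  also have "(1 - t * r * A) * (1 - t * r * B) * (1 - t * r * C)
    = 1 - t * r * (A + B + C) + t\<^sup>2 * r\<^sup>2 * (A * B + B * C + C * A) - t ^ 3 * r ^ 3 * (A * B * C)"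
    by (simp add: power2_eq_square power3_eq_cube algebra_simps)
  also have "\<dots> = 1 - t\<^sup>2 * r ^ 4 - t ^ 3 * r ^ 3"
    unfolding sum e2 prod by (simp add: power_add[symmetric] mult.assoc)
  finally have "Nm q w = (1 - t\<^sup>2 * r ^ 4 - t ^ 3 * r ^ 3) / (- (r ^ 3))" by (simp add: prod)
  also have "\<dots> = t ^ 3 + r * t\<^sup>2 - 1 / r ^ 3"
    using r by (simp add: field_simps eval_nat_numeral)
  finally show ?thesis by (simp add: w_def r_def A_def)
qed

text \<open>The summation variable of the Gauss sum is replaced by m^3, so that a leading term m^3
  t^3 = (m t)^3 has the same \<open>ec\<close> value as m t. This is the linearisation of the
  cubic.\<close>

lemma gauss_line_sum:
  assumes "\<And>t. t \<in> F \<Longrightarrow> Nm q (w + t) = n t"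
  shows "G * (\<Sum>t\<in>F. eta (w + t)) = (\<Sum>m\<in>F. eta m ^ 3 * (\<Sum>t\<in>F. ec (m ^ 3 * n t)))"
proof -
  have nF: "n t \<in> F" if "t \<in> F" for t using assms[OF that] Nm_in_F by metis
  have "G * (\<Sum>t\<in>F. eta (w + t)) = (\<Sum>t\<in>F. eta (n t) ^ 3 * gauss 1)"
    by (simp add: sum_distrib_left G_def mult.commute assms[symmetric] flip: eta_eq_eta_Nm)
  also have "\<dots> = (\<Sum>t\<in>F. \<Sum>k\<in>F. eta k * ec (n t * k))"
    using gauss_twist[of 1] nF by (intro sum.cong refl) simp
  also have "\<dots> = (\<Sum>t\<in>F. \<Sum>m\<in>F. eta (m ^ 3) * ec (n t * m ^ 3))"
    by (intro sum.cong refl sum_F_cube[symmetric])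
  also have "\<dots> = (\<Sum>m\<in>F. eta m ^ 3 * (\<Sum>t\<in>F. ec (m ^ 3 * n t)))"
    by (subst sum.swap) (simp add: eta_power sum_distrib_left mult.commute)
  finally show ?thesis .
qed

text \<open>The sum over t is quadratic and leaves a twisted Kloosterman sum at 1 / tau a, whose
  hypotheses are exactly \<open>Tr_quartic\<close> and \<open>atr_inverse_tau\<close>. The two
  factors chi (tau a) cancel, and g * g = q = G * G permits division by \<open>G\<close>.\<close>

lemma line_sum_generic:
  assumes a: "a \<in> S_set q" "a \<noteq> 1"
  shows "(\<Sum>t\<in>F. eta (- 1 / (tau a * a\<^sup>2) + t)) = - G * chi (Tr q a)"
proof -
  define r where "r = tau a"
  have r: "r \<in> F" "r \<noteq> 0" using a tau_in_F tau_nonzero by (auto simp: r_def)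
  have inner: "eta m ^ 3 * (\<Sum>t\<in>F. ec (m ^ 3 * (t ^ 3 + r * t\<^sup>2 - 1 / r ^ 3)))
    = chi r * g * (eta (- m) * ec (1 / r * (- m + inverse (- m))))" if m: "m \<in> F" for m
  proof (cases "m = 0")
    case False
    have "ec (m ^ 3 * (t ^ 3 + r * t\<^sup>2 - 1 / r ^ 3)) = ec (m ^ 3 * r * t\<^sup>2 + m * t) * ec (- (m / r))"
      if t: "t \<in> F" for t
    proof -
      have "m ^ 3 * (t ^ 3 + r * t\<^sup>2 - 1 / r ^ 3) = m ^ 3 * r * t\<^sup>2 + ((m * t) ^ 3 + (- (m / r)) ^ 3)"
        by (simp add: power_mult_distrib power_divide algebra_simps)
      also have "ec \<dots> = ec (m ^ 3 * r * t\<^sup>2) * (ec ((m * t) ^ 3) * ec ((- (m / r)) ^ 3))"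
        using m t r by (subst ec_add; (subst ec_add)?) (auto intro!: F_mult F_power F_minus F_divide F_add)
      also have "\<dots> = ec (m ^ 3 * r * t\<^sup>2) * ec (m * t) * ec (- (m / r))"
        using m t r by (simp only: ec_cube F_mult F_minus F_divide mult.assoc)
      also have "ec (m ^ 3 * r * t\<^sup>2) * ec (m * t) = ec (m ^ 3 * r * t\<^sup>2 + m * t)"
        using m t r by (intro ec_add[symmetric]) (auto intro!: F_mult F_power)
      finally show ?thesis .
    qed
    hence "(\<Sum>t\<in>F. ec (m ^ 3 * (t ^ 3 + r * t\<^sup>2 - 1 / r ^ 3)))
      = (\<Sum>t\<in>F. ec (m ^ 3 * r * t\<^sup>2 + m * t)) * ec (- (m / r))"
      by (simp add: sum_distrib_right)
    also have "(\<Sum>t\<in>F. ec (m ^ 3 * r * t\<^sup>2 + m * t)) = chi (m ^ 3 * r) * g * ec (- (m\<^sup>2 / (m ^ 3 * r)))"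
      using m False r by (intro sum_ec_quadratic) auto
    also have "chi (m ^ 3 * r) = chi m * chi r" by (simp add: chi_mult chi_cube)
    also have "m\<^sup>2 / (m ^ 3 * r) = inverse m / r"
      using False r by (simp add: field_simps eval_nat_numeral)
    finally have "(\<Sum>t\<in>F. ec (m ^ 3 * (t ^ 3 + r * t\<^sup>2 - 1 / r ^ 3)))
      = chi m * chi r * g * (ec (- (inverse m / r)) * ec (- (m / r)))" by (simp add: mult_ac)
    also have "ec (- (inverse m / r)) * ec (- (m / r)) = ec (- (inverse m / r) + - (m / r))"
      using m r by (intro ec_add[symmetric]) auto
    also have "- (inverse m / r) + - (m / r) = 1 / r * (- m + inverse (- m))"
      using False r by (simp add: field_simps)
    finally have "(\<Sum>t\<in>F. ec (m ^ 3 * (t ^ 3 + r * t\<^sup>2 - 1 / r ^ 3)))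
      = chi m * chi r * g * ec (1 / r * (- m + inverse (- m)))" .
    \<comment> \<open>The quadratic Gauss sum contributes chi m, which lifts the exponent of
      \<open>eta\<close> from 3 to 5, that is, to 1.\<close>
    moreover have "eta m ^ 3 * chi m = eta m"
      using eta_power_4[OF False] by (simp add: chi_def eval_nat_numeral)
    ultimately show ?thesis by (simp add: mult_ac)
  qed auto
  have "G * (\<Sum>t\<in>F. eta (- 1 / (tau a * a\<^sup>2) + t))
    = (\<Sum>m\<in>F. eta m ^ 3 * (\<Sum>t\<in>F. ec (m ^ 3 * (t ^ 3 + r * t\<^sup>2 - 1 / r ^ 3))))"
    unfolding r_def by (rule gauss_line_sum) (rule Nm_line[OF a])
  also have "\<dots> = chi r * g * (\<Sum>m\<in>F. eta (- m) * ec (1 / r * (- m + inverse (- m))))"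
    unfolding sum_distrib_left[of "chi r * g"] by (intro sum.cong refl inner)
  also have "(\<Sum>m\<in>F. eta (- m) * ec (1 / r * (- m + inverse (- m)))) = kloosterman (1 / r)"
    unfolding kloosterman_def by (rule sum_F_uminus)
  also have "\<dots> = - chi (1 / r) * chi (Tr q a) * g"
  proof (rule kloosterman_eq)
    show "(1 / r)\<^sup>2 * (Tr q a ^ 4 + Tr q a) = - 1"
      using r Tr_quartic[OF a(1)] by (simp add: r_def power_divide)
  qed (use r a in \<open>auto simp: Tr_in_F r_def atr_inverse_tau\<close>)
  also have "chi r * g * (- chi (1 / r) * chi (Tr q a) * g) = - (chi r * chi r) * chi (Tr q a) * (g * g)"
    by (simp add: chi_divide)
  also have "\<dots> = G * (- G * chi (Tr q a))"
    using r by (simp add: chi_chi g_squared G_squared[symmetric])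
  finally show ?thesis using G_nonzero mult_left_cancel by blast
qed

text \<open>This is the case a = 1. The norm is t^3 - t + n, so after linearisation the exponent is
  linear in t and its sum vanishes unless m^3 = m. Only m = 1 and m = -1 contribute, and atr n = 1
  evaluates the two terms.\<close>

lemma line_sum_1:
  assumes w: "(w ^ q) ^ q - w ^ q = 1"
  shows "(\<Sum>t\<in>F. eta (w + t)) = - G"
proof -
  have "((w ^ q) ^ q - w ^ q) ^ q = 1" using w by simp
  hence "w - (w ^ q) ^ q = 1" by (simp add: frob_diff)
  hence "w = w ^ q + 2" using w by (simp add: algebra_simps del: char_3)
  hence w1: "w ^ q = w + 1" by (simp add: algebra_simps)
  hence w2: "(w ^ q) ^ q = w + 2" using w by (simp add: algebra_simps del: char_3)
  define n where "n = w ^ 3 - w"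
  have atr_n: "atr n = 1" by (simp add: n_def atr_cube_diff w1)
  have N: "Nm q (w + t) = t ^ 3 - t + n" if t: "t \<in> F" for t
  proof -
    have "Nm q (w + t) = (w + t) * (w + t + 1) * (w + t + 2)"
      using t by (simp add: Nm_eq frob_add F_iff w1 w2 del: char_3) (simp add: algebra_simps del: char_3)
    also have "\<dots> = (w + t) ^ 3 - (w + t) + 3 * ((w + t)\<^sup>2 + (w + t))"
      by (simp add: power2_eq_square power3_eq_cube algebra_simps del: char_3)
    finally show ?thesis by (simp only: three_eq_0 cube_add) (simp add: n_def)
  qed
  have nF: "n \<in> F" using N[of 0] Nm_in_F[of "w + 0"] by simp
  have inner: "eta m ^ 3 * (\<Sum>t\<in>F. ec (m ^ 3 * (t ^ 3 - t + n)))
    = (if m ^ 3 = m then eta m ^ 3 * ec (m * n) * of_nat q else 0)" if m: "m \<in> F" for m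
  proof -
    have "ec (m ^ 3 * (t ^ 3 - t + n)) = ec ((m - m ^ 3) * t) * ec (m ^ 3 * n)" if t: "t \<in> F" for t
    proof -
      have "m ^ 3 * (t ^ 3 - t + n) = (m * t) ^ 3 + (- (m ^ 3 * t) + m ^ 3 * n)"
        by (simp add: power_mult_distrib algebra_simps)
      also have "ec \<dots> = ec ((m * t) ^ 3) * (ec (- (m ^ 3 * t)) * ec (m ^ 3 * n))"
        using m t nF by (subst ec_add; (subst ec_add)?) (auto intro!: F_mult F_power F_minus F_add)
      also have "ec ((m * t) ^ 3) = ec (m * t)" using m t by (intro ec_cube) auto
      also have "ec (m * t) * (ec (- (m ^ 3 * t)) * ec (m ^ 3 * n)) = ec (m * t + - (m ^ 3 * t)) * ec (m ^ 3 * n)"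
        using m t by (subst ec_add) (auto intro!: F_mult F_power)
      also have "m * t + - (m ^ 3 * t) = (m - m ^ 3) * t" by (simp add: algebra_simps)
      finally show ?thesis .
    qed
    hence "(\<Sum>t\<in>F. ec (m ^ 3 * (t ^ 3 - t + n))) = (\<Sum>t\<in>F. ec ((m - m ^ 3) * t)) * ec (m ^ 3 * n)"
      by (simp add: sum_distrib_right)
    also have "\<dots> = (if m ^ 3 = m then of_nat q * ec (m * n) else 0)"
      using m by (subst sum_ec) auto
    finally show ?thesis by simp
  qed
  have cubes: "{m \<in> F. m ^ 3 = m} = {0, 1, -1}"
  proof -
    have "m \<in> {0, 1, -1}" if "m ^ 3 = m" for m :: 'k
    proof -
      have "m * (m - 1) * (m + 1) = 0" using that by (simp add: power3_eq_cube algebra_simps)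
      thus ?thesis by (auto simp: add_eq_0_iff2)
    qed
    thus ?thesis by auto
  qed
  have "G * (\<Sum>t\<in>F. eta (w + t)) = (\<Sum>m\<in>F. eta m ^ 3 * (\<Sum>t\<in>F. ec (m ^ 3 * (t ^ 3 - t + n))))"
    by (rule gauss_line_sum) (rule N)
  also have "\<dots> = (\<Sum>m\<in>F. if m ^ 3 = m then eta m ^ 3 * ec (m * n) * of_nat q else 0)"
    by (intro sum.cong refl inner)
  also have "\<dots> = (\<Sum>m\<in>{m \<in> F. m ^ 3 = m}. eta m ^ 3 * ec (m * n) * of_nat q)"
    by (simp add: sum.If_cases Int_def)
  also have "\<dots> = (ec n + ec (- n)) * of_nat q"
    unfolding cubes using one_neq_minus_one by (simp add: algebra_simps)
  also have "\<dots> = G * (- G)" using ec_sum[OF atr_n] by (simp add: G_squared)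
  finally show ?thesis using G_nonzero mult_left_cancel by blast
qed

text \<open>At a = 1 the trace vanishes and \<open>chi\<close> would give 0; the value 1 is the one
  that \<open>line_sum_1\<close> dictates, and it is also compatible with
  \<open>eps_mult\<close>.\<close>

definition eps :: "'k \<Rightarrow> complex" where
  "eps a = (if a = 1 then 1 else chi (Tr q a))"

text \<open>
  All solutions \<open>w\<close> differ by elements of \<open>F\<close>, so one may be chosen freely; the choice
  \<open>w = -1 / (tau a * a\<^sup>2)\<close> makes the linear term of the cubic \<open>t \<mapsto> Nm q (w + t)\<close> vanish.
\<close>

lemma line_sum:
  assumes a: "a \<in> S_set q" and w: "(w ^ q) ^ q - w ^ q = a\<^sup>2"
  shows "(\<Sum>t\<in>F. eta (w + t)) = - G * eps a"
proof (cases "a = 1")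
  case True
  thus ?thesis using w by (simp add: line_sum_1 eps_def)
next
  case False
  define w0 where "w0 = - 1 / (tau a * a\<^sup>2)"
  have t: "tau a \<in> F" "tau a \<noteq> 0" using a False tau_in_F tau_nonzero by auto
  have nz: "a \<noteq> 0" using S_setD[OF a] by auto
  have "(w0 ^ q) ^ q - w0 ^ q = a\<^sup>2"
  proof -
    define A B C where "A = a\<^sup>2" and "B = (a ^ q)\<^sup>2" and "C = ((a ^ q) ^ q)\<^sup>2"
    have n: "A * B * C = 1" using S_setD(2)[OF a]
      by (simp add: A_def B_def C_def power_mult_distrib[symmetric])
    hence BC: "B \<noteq> 0" "C \<noteq> 0" by auto
    have w1: "w0 ^ q = - 1 / (tau a * B)" and w2: "(w0 ^ q) ^ q = - 1 / (tau a * C)"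
      using t by (simp_all add: w0_def B_def C_def frob_minus power_divide power_mult_distrib F_iff square_frob)
    have "(w0 ^ q) ^ q - w0 ^ q = (C - B) / (tau a * (B * C))"
      by (subst w2, subst w1) (use t BC in \<open>simp add: field_simps\<close>)
    also have "\<dots> = 1 / (B * C)" using t by (simp add: tau_def B_def C_def)
    also have "\<dots> = A" using n BC by (simp add: field_simps)
    also have "A = a\<^sup>2" by (simp add: A_def)
    finally show ?thesis .
  qed
  hence "((w - w0) ^ q) ^ q - (w - w0) ^ q = 0" using w by (simp add: frob_diff algebra_simps)
  hence d: "w - w0 \<in> F" by (simp only: frob_diff_eq_0_iff)
  have "(\<Sum>t\<in>F. eta (w + t)) = (\<Sum>t\<in>F. eta (w0 + (t + (w - w0))))"
    by (simp add: algebra_simps)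
  also have "\<dots> = (\<Sum>t\<in>F. eta (w0 + t))" using d by (rule sum_F_shift)
  also have "\<dots> = - G * eps a"
    using line_sum_generic[OF a False] False by (simp add: w0_def eps_def)
  finally show ?thesis .
qed

lemma norm_decomposition:
  assumes "d \<noteq> (0::'k)"
  obtains s m where "s \<in> F" "s \<noteq> 0" "Nm q m = 1" "d = s * m"
proof -
  \<comment> \<open>The cube root of the norm inside F: cubing this exponent gives 3^(2e) = q, which
    acts trivially on F. A cube root is needed because the norm of s in F is s^3.\<close>
  define s where "s = Nm q d ^ (3 ^ (2 * e - 1))"
  have s: "s \<in> F" "s \<noteq> 0" using assms Nm_in_F by (auto simp: s_def Nm_def)
  have "s ^ 3 = Nm q d ^ (3 ^ Suc (2 * e - 1))"
    by (simp only: s_def power_mult[symmetric] power_Suc2)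
  also have "\<dots> = Nm q d" using e_pos Nm_in_F[of d] by (simp add: F_iff q_eq[symmetric])
  finally have s3: "s ^ 3 = Nm q d" .
  have "Nm q d = s ^ 3 * Nm q (d / s)" using s Nm_mult[of s "d / s"] by (simp add: Nm_F)
  hence "Nm q (d / s) = 1" unfolding s3[symmetric] using s by simp
  thus ?thesis using that[of s "d / s"] s by simp
qed

lemma trace_zero_decomposition:
  assumes "d \<noteq> 0" "Tr q d = 0"
  obtains s a where "s \<in> F" "s \<noteq> 0" "a \<in> S_set q" "d = s * a\<^sup>2"
proof -
  obtain s n where s: "s \<in> F" "s \<noteq> 0" and Nn: "Nm q n = 1" and n: "d = s * n"
    using norm_decomposition[OF assms(1)] by blast
  \<comment> \<open>The exponent is half of (q^2 + q + 1) + 1, so a^2 = Nm n * n = n: an element of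
    norm 1 has a square root of norm 1.\<close>
  define a where "a = n ^ ((q\<^sup>2 + q + 2) div 2)"
  have "even (q\<^sup>2 + q + 2)" using odd_q by simp
  hence "a\<^sup>2 = n ^ (q\<^sup>2 + q + 2)"
    by (simp only: a_def power_mult[symmetric] dvd_div_mult_self)
  also have "\<dots> = Nm q n * n" by (simp add: Nm_def power_add power2_eq_square mult_ac)
  finally have a2: "a\<^sup>2 = n" by (simp add: Nn)
  have "Nm q a = Nm q n ^ ((q\<^sup>2 + q + 2) div 2)"
    by (simp only: a_def Nm_def power_mult[symmetric] mult.commute)
  hence "Nm q a = 1" by (simp add: Nn)
  moreover have "s * Tr q n = 0" using assms(2) s by (simp add: n Tr_scale)
  hence "Tr q (a\<^sup>2) = 0" using s by (simp add: a2)
  moreover have "a \<noteq> 0" using a2 n assms by auto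
  ultimately have "a \<in> S_set q" by (simp add: S_set_def)
  thus ?thesis using that[of s a] s n a2 by simp
qed

section \<open>The conic\<close>

text \<open>A nondegenerate conic contains no line. In conjugate coordinates, the cross product (x0,
  x1, x2) of two orthogonal isotropic vectors satisfies x1 * x0 = 0; its coordinates are conjugate,
  so it vanishes. Then a / b lies in F and has norm 1, hence is 1.\<close>

lemma S_set_orthogonal_imp_eq:
  fixes a b :: 'k
  assumes a: "a \<in> S_set q" and b: "b \<in> S_set q" and T: "Tr q (a * b) = 0"
  shows "a = b"
proof -
  define a1 a2 b1 b2 where "a1 = a ^ q" and "a2 = (a ^ q) ^ q" and "b1 = b ^ q" and "b2 = (b ^ q) ^ q"
  have aa: "a * a + a1 * a1 + a2 * a2 = 0" and bb: "b * b + b1 * b1 + b2 * b2 = 0"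
    using S_setD(3)[OF a] S_setD(3)[OF b] by (auto simp: a1_def a2_def b1_def b2_def power2_eq_square)
  have ab: "a * b + a1 * b1 + a2 * b2 = 0"
    using T by (simp add: Tr_eq power_mult_distrib a1_def a2_def b1_def b2_def)
  define x0 x1 x2 where "x0 = a1 * b2 - a2 * b1" and "x1 = a2 * b - a * b2" and "x2 = a * b1 - a1 * b"
  have "x1 * a2 - x2 * a1 = b * (a * a + a1 * a1 + a2 * a2) - a * (a * b + a1 * b1 + a2 * b2)"
    by (simp add: x1_def x2_def algebra_simps)
  hence 1: "x1 * a2 = x2 * a1" using aa ab by simp
  have "x1 * b2 - x2 * b1 = b * (a * b + a1 * b1 + a2 * b2) - a * (b * b + b1 * b1 + b2 * b2)"
    by (simp add: x1_def x2_def algebra_simps)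
  hence 2: "x1 * b2 = x2 * b1" using bb ab by simp
  have "x1 * x0 = a1 * (x1 * b2) - b1 * (x1 * a2)" by (simp add: x0_def algebra_simps)
  also have "\<dots> = 0" unfolding 1 2 by (simp add: algebra_simps)
  finally have "x1 * x0 = 0" .
  moreover have "x1 = x0 ^ q"
    by (simp add: x0_def x1_def a1_def a2_def b1_def b2_def frob_diff power_mult_distrib)
  ultimately have "x0 = 0" by auto
  hence "((a / b) ^ q) ^ q - (a / b) ^ q = 0"
    using S_setD(1)[OF b] by (simp add: x0_def a1_def a2_def b1_def b2_def power_divide field_simps)
  hence F: "a / b \<in> F" by (simp only: frob_diff_eq_0_iff)
  have "Nm q (a / b) = 1"
    using a b by (simp add: S_set_def Nm_def power_divide)
  hence "a / b = 1" using F Nm_F F_eq_1_if_cube by metis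
  thus ?thesis using S_setD(1)[OF b] by simp
qed

text \<open>The Gram matrix of the isotropic vectors \<open>1, a, b\<close> has determinant
  \<open>2 * Tr a * Tr b * Tr (a * b)\<close>, and it is the square of an element \<open>D\<close> of \<open>F\<close>.\<close>

lemma eps_mult:
  assumes a: "a \<in> S_set q" and b: "b \<in> S_set q" and "a \<noteq> b"
  shows "chi (Tr q (a * b)) = eps a * eps b"
proof -
  have nz: "Tr q (a * b) \<noteq> 0" using S_set_orthogonal_imp_eq assms by blast
  show ?thesis
  proof (cases "a = 1 \<or> b = 1")
    case True
    thus ?thesis using assms(3) by (auto simp: eps_def)
  next
    case False
    define a1 a2 b1 b2 where "a1 = a ^ q" and "a2 = (a ^ q) ^ q" and "b1 = b ^ q" and "b2 = (b ^ q) ^ q"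
    have a2: "a2 * a2 = - (a * a + a1 * a1)"
      using S_setD(3)[OF a] unfolding a1_def a2_def eq_neg_iff_add_eq_0 by (simp add: power2_eq_square add_ac)
    have b2: "b2 * b2 = - (b * b + b1 * b1)"
      using S_setD(3)[OF b] unfolding b1_def b2_def eq_neg_iff_add_eq_0 by (simp add: power2_eq_square add_ac)
    \<comment> \<open>The determinant of the matrix whose rows are the conjugates of 1, a and b; its
      square is the Gram determinant.\<close>
    define D where "D = (a1 * b2 - a2 * b1) + (a2 * b - a * b2) + (a * b1 - a1 * b)"
    have "D ^ q = D"
      by (simp add: D_def a1_def a2_def b1_def b2_def frob_diff frob_add power_mult_distrib)
    define S P R where "S = a + a1 + a2" and "P = b + b1 + b2" and "R = a * b + a1 * b1 + a2 * b2"
    have "D\<^sup>2 = 3 * (a * a + a1 * a1 + a2 * a2) * (b * b + b1 * b1 + b2 * b2)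
      + 2 * S * P * R - 3 * R * R - (a * a + a1 * a1 + a2 * a2) * P * P - (b * b + b1 * b1 + b2 * b2) * S * S"
      by (simp add: D_def S_def P_def R_def power2_eq_square algebra_simps del: char_3)
    hence "D\<^sup>2 = - (S * P * R)"
      unfolding a2 b2 three_eq_0 by simp
    moreover have "S = Tr q a" "P = Tr q b" "R = Tr q (a * b)"
      by (simp_all add: S_def P_def R_def Tr_eq a1_def a2_def b1_def b2_def power_mult_distrib)
    ultimately have "D\<^sup>2 = - (Tr q a * Tr q b * Tr q (a * b))" by simp
    moreover have "D \<noteq> 0" using calculation nz False Tr_nonzero a b by auto
    hence "chi (D\<^sup>2) = 1" by (rule chi_square)
    ultimately have "chi (Tr q a) * chi (Tr q b) * chi (Tr q (a * b)) = 1" by (simp add: chi_mult)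
    thus ?thesis using False chi_cases[OF nz] chi_cases[OF Tr_nonzero[OF a]] chi_cases[OF Tr_nonzero[OF b]]
      by (auto simp: eps_def)
  qed
qed

lemma eps_cases: "a \<in> S_set q \<Longrightarrow> eps a = 1 \<or> eps a = -1"
  using chi_cases[OF Tr_nonzero[of a]] by (auto simp: eps_def)

text \<open>By \<open>eps_mult\<close> the condition on Tr (a1 * a) separates into signs of a and of
  a1; the factor 2 = -1 is a square. The element a1 itself belongs because Tr (a1^2) = 0 gives
  character value 0, which is also different from -1.\<close>

lemma X1_iff:
  assumes "a1 \<in> S_set q"
  shows "a \<in> X1 q a1 \<longleftrightarrow> a \<in> S_set q \<and> eps a = eps a1"
proof (cases "a \<in> S_set q")
  case True
  have "quadratic_character (2 * Tr q (a1 * a)) = -1 \<longleftrightarrow> complex_of_int (quadratic_character (2 * Tr q (a1 * a))) = -1"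
    by (metis of_int_eq_iff of_int_minus of_int_1)
  also have "\<dots> \<longleftrightarrow> chi (Tr q (a1 * a)) = -1" by (simp add: quadratic_character_eq_chi)
  also have "\<dots> \<longleftrightarrow> eps a \<noteq> eps a1"
  proof (cases "a = a1")
    case eq: True
    have "Tr q (a1 * a) = 0" using True eq by (simp add: S_set_def power2_eq_square)
    thus ?thesis using eq by simp
  next
    case False
    thus ?thesis using eps_mult[of a1 a] eps_cases[of a] eps_cases[of a1] assms True by auto
  qed
  finally show ?thesis using True by (simp add: X1_def)
qed (simp add: X1_def)

lemma X2_iff:
  assumes "a1 \<in> S_set q"
  shows "a \<in> X2 q a1 \<longleftrightarrow> a \<in> S_set q \<and> eps a = - eps a1"
  using X1_iff[OF assms, of a] eps_cases[of a] eps_cases[OF assms] by (auto simp: X2_def)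

section \<open>The cross product on the cubic extension\<close>

text \<open>In the coordinates \<open>(x, x ^ q, x ^ (q\<^sup>2))\<close> this is the usual cross product, and \<open>Tr q (x * y)\<close> the
  usual scalar product.\<close>

definition cr :: "'k \<Rightarrow> 'k \<Rightarrow> 'k" where
  "cr u b = u ^ q * (b ^ q) ^ q - (u ^ q) ^ q * b ^ q"

lemma cr_scale_left: "s \<in> F \<Longrightarrow> cr (s * u) b = s * cr u b"
  and cr_scale_right: "s \<in> F \<Longrightarrow> cr u (s * b) = s * cr u b"
  by (simp_all add: cr_def F_iff power_mult_distrib algebra_simps)

lemma cr_add_left: "cr (u + v) b = cr u b + cr v b"
  and cr_add_right: "cr u (b + c) = cr u b + cr u c"
  and cr_diff_right: "cr u (b - c) = cr u b - cr u c"
  by (simp_all add: cr_def frob_add frob_diff algebra_simps)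

lemma cr_self [simp]: "cr u u = 0" and cr_0_right [simp]: "cr u 0 = 0"
  and cr_0_left [simp]: "cr 0 u = 0"
  using q_ge_9 by (simp_all add: cr_def zero_power)

lemma Tr_mult_cr_left: "Tr q (u * cr u b) = 0"
  by (simp add: Tr_eq cr_def power_mult_distrib frob_diff algebra_simps)

lemma Tr_mult_cr_swap: "Tr q (u * cr v b) = - Tr q (v * cr u b)"
  by (simp add: Tr_eq cr_def power_mult_distrib frob_diff algebra_simps)

lemma cr_cr: "cr u (cr v w) = v * Tr q (u * w) - w * Tr q (u * v)"
  by (simp add: Tr_eq cr_def power_mult_distrib frob_diff algebra_simps)

lemma cr_1: "cr 1 b = (b ^ q) ^ q - b ^ q"
  by (simp add: cr_def)

lemma cr_eq_0_iff: "u \<noteq> 0 \<Longrightarrow> cr u b = 0 \<longleftrightarrow> (\<exists>s\<in>F. b = s * u)"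
proof
  assume u: "u \<noteq> 0" and "cr u b = 0"
  hence "((b / u) ^ q) ^ q - (b / u) ^ q = 0"
    by (simp add: cr_def power_divide field_simps)
  hence "b / u \<in> F" by (simp only: frob_diff_eq_0_iff)
  thus "\<exists>s\<in>F. b = s * u" using u by (intro bexI[of _ "b / u"]) auto
qed (auto simp: cr_scale_right)

lemma cr_solvable:
  assumes "u \<noteq> 0" "Tr q (u * v) = 0" obtains b where "cr u b = v"
proof -
  \<comment> \<open>In the triple product \<open>cr_cr\<close> the term with Tr (u * v) vanishes, so
    \<open>cr v w\<close> solves the equation as soon as Tr (u * w) = 1.\<close>
  obtain w where "Tr q (u * w) = 1" using ex_Tr_eq_1 assms(1) by blast
  hence "cr u (cr v w) = v" using assms by (simp add: cr_cr)
  thus ?thesis using that by blast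
qed

lemma orthogonal_imp_multiple_cr:
  assumes "cr u x \<noteq> 0" "Tr q (u * v) = 0" "Tr q (x * v) = 0"
  obtains s where "s \<in> F" "v = s * cr u x"
proof (cases "v = 0")
  case True
  thus ?thesis using that[of 0] by simp
next
  case False
  have "cr v (cr u x) = 0" using assms by (simp add: cr_cr mult.commute)
  then obtain s where s: "s \<in> F" "cr u x = s * v" using cr_eq_0_iff False by blast
  hence "s \<noteq> 0" using assms(1) by auto
  thus ?thesis using that[of "inverse s"] s F_inverse[of s] by simp
qed

lemma solutions_cr_eq:
  assumes "u \<noteq> 0" "cr u b = v"
  shows "{b'. cr u b' = v} = (\<lambda>t. b + t * u) ` F"
proof safe
  fix b' assume "v = cr u b'"
  hence "cr u (b' - b) = 0" using assms by (simp add: cr_diff_right)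
  then obtain s where "s \<in> F" "b' - b = s * u" using cr_eq_0_iff assms(1) by blast
  thus "b' \<in> (\<lambda>t. b + t * u) ` F" by (intro image_eqI[of _ _ s]) (auto simp: algebra_simps)
qed (use assms in \<open>auto simp: cr_add_right cr_scale_right\<close>)

lemma inj_on_line: "u \<noteq> 0 \<Longrightarrow> inj_on (\<lambda>t. b + t * u) F" for u b :: 'k
  by (auto intro: inj_onI)

section \<open>Line sums as a function on the points of the quadric\<close>

definition Phi :: "'k \<Rightarrow> 'k \<Rightarrow> complex" where
  "Phi u v = (\<Sum>b | cr u b = v. eta b)"

lemma Phi_eq:
  assumes "u \<noteq> 0" "cr u b = v"
  shows "Phi u v = (\<Sum>t\<in>F. eta (b + t * u))"
  unfolding Phi_def solutions_cr_eq[OF assms]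
  by (simp add: sum.reindex[OF inj_on_line[OF assms(1)]])

text \<open>So \<open>Phi\<close> depends only on the projective point.\<close>

lemma Phi_scale: "s \<in> F \<Longrightarrow> s \<noteq> 0 \<Longrightarrow> Phi (s * u) (s * v) = Phi u v"
  by (simp add: Phi_def cr_scale_left)

lemma Phi_scale_right:
  assumes "s \<in> F" "s \<noteq> 0"
  shows "Phi u (s * v) = eta s * Phi u v"
proof -
  have "(\<Sum>b | cr u b = s * v. eta b) = (\<Sum>b | cr u b = v. eta (s * b))"
    by (rule sum.reindex_bij_witness[of _ "\<lambda>b. s * b" "\<lambda>b. inverse s * b"])
       (use assms in \<open>auto simp: cr_scale_right F_inverse mult.assoc[symmetric]\<close>)
  thus ?thesis by (simp add: Phi_def eta_mult sum_distrib_left)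
qed

lemma eta_norm_1: "Nm q m = 1 \<Longrightarrow> eta m = 1"
  using eta_eq_eta_Nm[of m] by simp

lemma cr_twist: "Nm q m = 1 \<Longrightarrow> cr (m * u) (m * b) = cr u b / m"
proof -
  assume m: "Nm q m = 1"
  hence "m \<noteq> 0" by (auto simp: Nm_def)
  have "m * cr (m * u) (m * b) = Nm q m * cr u b"
    by (simp add: cr_def Nm_eq power_mult_distrib algebra_simps)
  thus ?thesis using m \<open>m \<noteq> 0\<close> by (simp add: field_simps)
qed

text \<open>Multiplication by an element of norm 1 preserves \<open>eta\<close> and carries one
  affine line to the other. This is invariance under \<open>map_c\<close>; invariance under
  \<open>map_z\<close> is \<open>Phi_scale_right\<close> with \<open>eta s = 1\<close>. Hence
  \<open>Phi\<close> is constant on the orbits of the group.\<close>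

lemma Phi_twist:
  assumes m: "Nm q m = 1"
  shows "Phi (m * u) (v / m) = Phi u v"
proof -
  have m0: "m \<noteq> 0" using m by (auto simp: Nm_def)
  have tw: "cr u (inverse m * b) = v \<longleftrightarrow> cr (m * u) b = v / m" for b
    using cr_twist[OF m, of u "inverse m * b"] m0 by (auto simp: field_simps)
  have "(\<Sum>b | cr (m * u) b = v / m. eta b) = (\<Sum>b | cr u b = v. eta (m * b))"
    by (rule sum.reindex_bij_witness[of _ "\<lambda>b. m * b" "\<lambda>b. inverse m * b"])
       (use m0 tw cr_twist[OF m] in \<open>auto simp: mult.assoc[symmetric]\<close>)
  thus ?thesis by (simp add: Phi_def eta_mult eta_norm_1[OF m])
qed

lemma Phi_1_value:
  assumes s: "s \<in> F" "s \<noteq> 0" and a: "a \<in> S_set q"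
  shows "Phi 1 (s * a\<^sup>2) = - G * eta s * eps a"
proof -
  have "Tr q (1 * a\<^sup>2) = 0" using a by (simp add: S_set_def)
  then obtain w where w: "cr 1 w = a\<^sup>2" using cr_solvable[of 1 "a\<^sup>2"] by auto
  have "Phi 1 (a\<^sup>2) = (\<Sum>t\<in>F. eta (w + t))" using Phi_eq[OF _ w] by simp
  also have "\<dots> = - G * eps a" using w by (intro line_sum[OF a]) (simp add: cr_1)
  finally show ?thesis using s by (simp add: Phi_scale_right)
qed

definition mu_el :: 'k where "mu_el = mu q \<alpha>"

lemma Nm_mu_el: "Nm q mu_el = 1"
  unfolding mu_el_def mu_def Nm_def power_mult[symmetric] q3_minus_1[symmetric] by (rule \<alpha>_power_card)

lemma norm_1_power_mu: "Nm q m = 1 \<Longrightarrow> \<exists>i. m = mu_el ^ i"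
proof -
  assume m: "Nm q m = 1"
  hence "m \<noteq> 0" by (auto simp: Nm_def)
  then obtain k where k: "m = \<alpha> ^ k" using ex_power_\<alpha> by blast
  have "\<alpha> ^ ((q\<^sup>2 + q + 1) * k) = 1"
    using m by (simp only: Nm_def k power_mult[symmetric] mult.commute)
  hence "(q\<^sup>2 + q + 1) * (q - 1) dvd (q\<^sup>2 + q + 1) * k"
    by (simp only: \<alpha>_power_eq_1_iff q3_minus_1 mult.commute)
  hence "(q - 1) dvd k" by (subst (asm) nat_mult_dvd_cancel_disj) auto
  then obtain i where "k = (q - 1) * i" by blast
  thus ?thesis using k by (auto simp: mu_el_def mu_def power_mult)
qed

section \<open>Points of the quadric\<close>

lemma span_pt_scale:
  assumes "s \<in> F" "s \<noteq> 0"
  shows "span_pt q (s * u, s * v) = span_pt q (u, v)"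
proof -
  have "\<exists>c'. c * u = c' * (s * u) \<and> c * v = c' * (s * v) \<and> c' \<in> F" if "c \<in> F" for c
    using that assms by (intro exI[of _ "c / s"]) auto
  moreover have "\<exists>c'. c * (s * u) = c' * u \<and> c * (s * v) = c' * v \<and> c' \<in> F" if "c \<in> F" for c
    using that assms by (intro exI[of _ "c * s"]) (auto simp: mult_ac)
  ultimately show ?thesis by (fastforce simp: span_pt_def)
qed

lemma span_pt_self: "w \<in> span_pt q w" for w :: "'k \<times> 'k"
  unfolding span_pt_def by (cases w) (auto intro!: exI[of _ 1])

lemma span_pt_eqD:
  assumes "span_pt q (u, v) = span_pt q (u', v')" "(u', v') \<noteq> (0, 0)"
  obtains s where "s \<in> F" "s \<noteq> 0" "u' = s * u" "v' = s * v"
proof -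
  have "(u', v') \<in> span_pt q (u, v)" using assms(1) span_pt_self by metis
  then obtain s where "s \<in> F" "u' = s * u" "v' = s * v" by (auto simp: span_pt_def)
  thus ?thesis using that[of s] assms(2) by auto
qed

lemma span_pt_eq_iff:
  assumes "(u', v') \<noteq> (0, 0)"
  shows "span_pt q (u, v) = span_pt q (u', v') \<longleftrightarrow> (\<exists>s\<in>F - {0}. u' = s * u \<and> v' = s * v)"
  using span_pt_eqD[OF _ assms] span_pt_scale by (metis DiffE DiffI singletonD singletonI)

lemma card_span_pt_image:
  assumes "(0, 0) \<notin> A" and scale: "\<And>s u v. s \<in> F - {0} \<Longrightarrow> (u, v) \<in> A \<Longrightarrow> (s * u, s * v) \<in> A"
  shows "card (span_pt q ` A) * (q - 1) = card (A :: ('k \<times> 'k) set)"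
proof -
  have "card {w \<in> A. span_pt q w = P} = q - 1" if P: "P \<in> span_pt q ` A" for P
  proof -
    obtain u v where uv: "(u, v) \<in> A" "P = span_pt q (u, v)" using P by force
    have "{w \<in> A. span_pt q w = P} = (\<lambda>s. (s * u, s * v)) ` (F - {0})"
    proof (intro Set.set_eqI iffI)
      fix w assume w: "w \<in> {w \<in> A. span_pt q w = P}"
      obtain u' v' where w': "w = (u', v')" by (cases w)
      have "(u', v') \<noteq> (0, 0)" using w w' assms(1) by auto
      thus "w \<in> (\<lambda>s. (s * u, s * v)) ` (F - {0})"
        using w w' uv span_pt_eq_iff[of u' v' u v] by auto
    next
      fix w assume "w \<in> (\<lambda>s. (s * u, s * v)) ` (F - {0})"
      thus "w \<in> {w \<in> A. span_pt q w = P}" using uv scale span_pt_scale by auto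
    qed
    moreover have "inj_on (\<lambda>s. (s * u, s * v)) (F - {0})"
      using uv assms(1) by (intro inj_onI) (cases "u = 0"; auto)
    ultimately show ?thesis by (simp add: card_image card_F card_Diff_singleton)
  qed
  hence "(\<Sum>P\<in>span_pt q ` A. card {w \<in> A. span_pt q w = P}) = card (span_pt q ` A) * (q - 1)"
    by simp
  moreover have "(\<Sum>P\<in>span_pt q ` A. card {w \<in> A. span_pt q w = P}) = card A"
    using sum.image_gen[of A "\<lambda>_. 1::nat" "span_pt q"] by simp
  ultimately show ?thesis by simp
qed

definition admissible :: "'k \<Rightarrow> 'k \<Rightarrow> bool" where
  "admissible u v \<longleftrightarrow> u \<noteq> 0 \<and> v \<noteq> 0 \<and> Tr q (u * v) = 0"

lemma quadric_cases:
  assumes "P \<in> (quadric q :: ('k \<times> 'k) set set)"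
  obtains (gen1) x where "x \<noteq> 0" "P = span_pt q (x, 0)"
    | (gen2) y where "y \<noteq> 0" "P = span_pt q (0, y)"
    | (other) u v where "admissible u v" "P = span_pt q (u, v)"
proof -
  obtain u v where uv: "(u, v) \<noteq> (0, 0)" "Tr q (u * v) = 0" "P = span_pt q (u, v)"
    using assms by (auto simp: quadric_def quad_form_def)
  thus ?thesis using that by (cases "u = 0"; cases "v = 0") (auto simp: admissible_def)
qed

lemma span_pt_in_quadric: "(u, v) \<noteq> (0, 0) \<Longrightarrow> Tr q (u * v) = 0 \<Longrightarrow> span_pt q (u, v) \<in> quadric q"
  for u v :: 'k
  unfolding quadric_def quad_form_def by (intro CollectI exI[of _ "(u, v)"]) auto

lemma gen1_subset_quadric: "gen1 q \<subseteq> (quadric q :: ('k \<times> 'k) set set)"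
  by (auto simp: gen1_def Tr_F intro!: span_pt_in_quadric)

lemma gen2_subset_quadric: "gen2 q \<subseteq> (quadric q :: ('k \<times> 'k) set set)"
  by (auto simp: gen2_def Tr_F intro!: span_pt_in_quadric)

lemma span_pt_in_gen1_iff: "(u, v) \<noteq> (0, 0) \<Longrightarrow> span_pt q (u, v) \<in> gen1 q \<longleftrightarrow> v = 0" for u v :: 'k
proof
  assume "(u, v) \<noteq> (0, 0)" "span_pt q (u, v) \<in> gen1 q"
  then obtain x where "x \<noteq> 0" "span_pt q (x, 0) = span_pt q (u, v)" by (auto simp: gen1_def)
  thus "v = 0" using \<open>(u, v) \<noteq> (0, 0)\<close> by (auto elim!: span_pt_eqD)
qed (auto simp: gen1_def)

lemma span_pt_in_gen2_iff: "(u, v) \<noteq> (0, 0) \<Longrightarrow> span_pt q (u, v) \<in> gen2 q \<longleftrightarrow> u = 0" for u v :: 'k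
proof
  assume "(u, v) \<noteq> (0, 0)" "span_pt q (u, v) \<in> gen2 q"
  then obtain x where "x \<noteq> 0" "span_pt q (0, x) = span_pt q (u, v)" by (auto simp: gen2_def)
  thus "u = 0" using \<open>(u, v) \<noteq> (0, 0)\<close> by (auto elim!: span_pt_eqD)
qed (auto simp: gen2_def)

lemma collinear_span_pt_iff:
  assumes "Tr q (u * v) = 0" "Tr q (u' * v') = (0::'k)"
  shows "collinear_on_quadric q (span_pt q (u, v)) (span_pt q (u', v')) \<longleftrightarrow> Tr q (u * v' + u' * v) = 0"
proof
  assume "collinear_on_quadric q (span_pt q (u, v)) (span_pt q (u', v'))"
  hence "quad_form q ((u, v) + (u', v')) = 0"
    unfolding collinear_on_quadric_def using span_pt_self by blast
  thus "Tr q (u * v' + u' * v) = 0"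
    using assms by (simp add: quad_form_def algebra_simps Tr_add)
next
  assume *: "Tr q (u * v' + u' * v) = 0"
  show "collinear_on_quadric q (span_pt q (u, v)) (span_pt q (u', v'))"
    unfolding collinear_on_quadric_def
  proof (intro ballI)
    fix w w' assume "w \<in> span_pt q (u, v)" "w' \<in> span_pt q (u', v')"
    then obtain c c' where c: "c \<in> F" "c' \<in> F" "w = (c * u, c * v)" "w' = (c' * u', c' * v')"
      by (auto simp: span_pt_def)
    have "fst (w + w') * snd (w + w') = (c * c) * (u * v) + (c' * c') * (u' * v') + (c * c') * (u * v' + u' * v)"
      by (simp add: c algebra_simps)
    hence "quad_form q (w + w') = (c * c) * Tr q (u * v) + (c' * c') * Tr q (u' * v') + (c * c') * Tr q (u * v' + u' * v)"
      using c by (simp only: quad_form_def Tr_add Tr_scale F_mult)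
    thus "quad_form q (w + w') = 0" using assms * by simp
  qed
qed

section \<open>The group orbits\<close>

text \<open>A commutative family containing both generators: \<open>map_c\<close> is the case l = 1
  and \<open>map_z\<close> the case m = 1. Members of the group have m of norm 1 and l in F with
  \<open>eta l = 1\<close>.\<close>

definition lmap :: "'k \<Rightarrow> 'k \<Rightarrow> 'k \<times> 'k \<Rightarrow> 'k \<times> 'k" where
  "lmap m l = (\<lambda>(u, v). (m * u, l * inverse m * v))"

lemma lmap_in_carrier: "m \<noteq> 0 \<Longrightarrow> l \<noteq> 0 \<Longrightarrow> lmap m l \<in> carrier (BijGroup UNIV)"
  unfolding BijGroup_def Bij_def
  by (auto simp: lmap_def field_simps intro!: bij_betw_byWitness[where f' = "\<lambda>(u, v). (inverse m * u, m * inverse l * v)"])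

lemma lmap_mult:
  assumes "m \<noteq> 0" "l \<noteq> 0" "m' \<noteq> 0" "l' \<noteq> 0"
  shows "lmap m l \<otimes>\<^bsub>BijGroup UNIV\<^esub> lmap m' l' = lmap (m * m') (l * l')"
  using assms lmap_in_carrier[of m l] lmap_in_carrier[of m' l']
  by (auto simp: BijGroup_def lmap_def compose_def fun_eq_iff)

lemma lmap_one: "\<one>\<^bsub>BijGroup UNIV\<^esub> = lmap 1 1"
  by (auto simp: BijGroup_def lmap_def)

lemma lmap_inv:
  assumes "m \<noteq> 0" "l \<noteq> 0"
  shows "inv\<^bsub>BijGroup UNIV\<^esub> (lmap m l) = lmap (inverse m) (inverse l)"
  by (rule group.inv_equality[OF group_BijGroup])
     (use assms in \<open>auto simp: lmap_mult lmap_one lmap_in_carrier\<close>)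

lemma map_c_eq: "map_c q \<alpha> = lmap mu_el 1" and map_z_eq: "map_z q \<alpha> = lmap 1 (\<omega> ^ 4)"
  by (auto simp: map_c_def map_z_def lmap_def mu_el_def \<omega>_def)

lemma mu_el_nonzero: "mu_el \<noteq> 0"
  using Nm_mu_el by (auto simp: Nm_def)

lemma grp_subset:
  assumes "h \<in> grp q \<alpha>"
  obtains m l where "Nm q m = 1" "l \<in> F" "l \<noteq> 0" "eta l = 1" "h = lmap m l"
proof -
  let ?P = "\<lambda>h. \<exists>m l. Nm q m = 1 \<and> l \<in> F \<and> l \<noteq> 0 \<and> eta l = 1 \<and> h = lmap m l"
  have eta4: "eta (\<omega> ^ 4) = 1" by (simp add: eta_power eta_\<omega>)
  have nz: "m \<noteq> 0" if "Nm q m = 1" for m :: 'k using that by (auto simp: Nm_def)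
  have gens: "?P h'" if "h' \<in> {map_c q \<alpha>, map_z q \<alpha>}" for h'
  proof (cases "h' = map_c q \<alpha>")
    case True
    thus ?thesis using Nm_mu_el by (intro exI[of _ mu_el] exI[of _ 1]) (auto simp: map_c_eq)
  next
    case False
    hence "h' = lmap 1 (\<omega> ^ 4)" using that by (simp add: map_z_eq)
    moreover have "Nm q (1::'k) = 1" by (simp add: Nm_def)
    ultimately show ?thesis using eta4 \<omega>_power_in_F \<omega>_nonzero power_not_zero by blast
  qed
  have "h \<in> generate (BijGroup UNIV) {map_c q \<alpha>, map_z q \<alpha>}"
    using assms by (simp add: grp_def)
  hence "?P h"
  proof (induction rule: generate.induct)
    case one
    have "Nm q (1::'k) = 1" by (simp add: Nm_def)
    thus ?case by (intro exI[of _ 1]) (auto simp: lmap_one)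
  next
    case (incl h')
    thus ?case using gens by blast
  next
    case (inv h')
    then obtain m l where "Nm q m = 1" "l \<in> F" "l \<noteq> 0" "eta l = 1" "h' = lmap m l"
      using gens by blast
    moreover from this have "Nm q (inverse m) = 1"
      using Nm_mult[of m "inverse m"] nz[of m] by (simp add: Nm_def)
    ultimately show ?case using nz
      by (intro exI[of _ "inverse m"] exI[of _ "inverse l"]) (auto simp: lmap_inv eta_inverse)
  next
    case (eng h1 h2)
    then obtain m l m' l' where "Nm q m = 1" "l \<in> F" "l \<noteq> 0" "eta l = 1" "h1 = lmap m l"
      "Nm q m' = 1" "l' \<in> F" "l' \<noteq> 0" "eta l' = 1" "h2 = lmap m' l'" by blast
    thus ?case using nz
      by (intro exI[of _ "m * m'"] exI[of _ "l * l'"]) (auto simp: lmap_mult Nm_mult eta_mult)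
  qed
  thus ?thesis using that by blast
qed

lemma lmap_in_grp: "lmap (mu_el ^ i) (\<omega> ^ (4 * j)) \<in> grp q \<alpha>"
proof -
  have c: "lmap (mu_el ^ i) 1 \<in> grp q \<alpha>" for i
  proof (induction i)
    case 0
    show ?case unfolding grp_def using generate.one[of "BijGroup UNIV" "{map_c q \<alpha>, map_z q \<alpha>}"]
      by (simp add: lmap_one)
  next
    case (Suc i)
    have "lmap mu_el 1 \<in> grp q \<alpha>"
      unfolding grp_def map_c_eq[symmetric] by (rule generate.incl) simp
    hence "lmap mu_el 1 \<otimes>\<^bsub>BijGroup UNIV\<^esub> lmap (mu_el ^ i) 1 \<in> grp q \<alpha>"
      using Suc unfolding grp_def by (rule generate.eng)
    thus ?case using mu_el_nonzero by (simp add: lmap_mult)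
  qed
  show ?thesis
  proof (induction j)
    case 0
    show ?case using c by simp
  next
    case (Suc j)
    have "lmap 1 (\<omega> ^ 4) \<in> grp q \<alpha>"
      unfolding grp_def map_z_eq[symmetric] by (rule generate.incl) simp
    hence "lmap 1 (\<omega> ^ 4) \<otimes>\<^bsub>BijGroup UNIV\<^esub> lmap (mu_el ^ i) (\<omega> ^ (4 * j)) \<in> grp q \<alpha>"
      using Suc unfolding grp_def by (rule generate.eng)
    moreover have "lmap 1 (\<omega> ^ 4) \<otimes>\<^bsub>BijGroup UNIV\<^esub> lmap (mu_el ^ i) (\<omega> ^ (4 * j))
      = lmap (mu_el ^ i) (\<omega> ^ (4 * Suc j))"
      using mu_el_nonzero \<omega>_nonzero by (subst lmap_mult) (auto simp: power_add)
    ultimately show ?case by simp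
  qed
qed

lemma image_lmap_span_pt: "lmap m l ` span_pt q (u, v) = span_pt q (m * u, l * inverse m * v)"
proof -
  have "lmap m l (c * u, c * v) = (c * (m * u), c * (l * inverse m * v))" for c
    by (simp add: lmap_def mult_ac)
  thus ?thesis unfolding span_pt_def by (force simp: image_iff)
qed

lemma grp_orbit_PhiD:
  assumes "P \<in> grp_orbit q \<alpha> (span_pt q (1, d))" "d \<noteq> 0" "Tr q d = 0"
  obtains u v where "admissible u v" "P = span_pt q (u, v)" "Phi u v = Phi 1 d"
proof -
  obtain m l where ml: "Nm q m = 1" "l \<in> F" "l \<noteq> 0" "eta l = 1" "P = span_pt q (m, l * inverse m * d)"
    using assms(1) by (auto simp: grp_orbit_def image_lmap_span_pt elim!: grp_subset)
  have m0: "m \<noteq> 0" using ml by (auto simp: Nm_def)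
  have "Phi m (l * inverse m * d) = Phi (m * 1) ((l * d) / m)" by (simp add: field_simps)
  also have "\<dots> = Phi 1 d" using ml by (simp only: Phi_twist) (simp add: Phi_scale_right)
  finally have "Phi m (l * inverse m * d) = Phi 1 d" .
  moreover have "m * (l * inverse m * d) = l * d" using m0 by simp
  hence "Tr q (m * (l * inverse m * d)) = 0" using ml assms by (simp only: Tr_scale) simp
  hence "admissible m (l * inverse m * d)"
    using ml m0 assms by (simp add: admissible_def)
  ultimately show ?thesis using that ml by blast
qed

text \<open>The first coordinate is scaled to norm 1 and then twisted to 1. The second becomes an
  element of trace zero, that is, r a^2 with r in F and a in S; writing r as a power of
  \<open>\<omega>\<close>, the part with exponent divisible by 4 is absorbed by
  \<open>map_z\<close>.\<close>

lemma admissible_normal_form: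
  assumes "admissible u v"
  obtains k j a where "k < (4::nat)" "a \<in> S_set q" "Phi u v = - G * (- \<i>) ^ k * eps a"
    "span_pt q (u, v) \<in> grp_orbit q \<alpha> (span_pt q (1, \<omega> ^ k * a\<^sup>2))"
proof -
  have uv: "u \<noteq> 0" "v \<noteq> 0" "Tr q (u * v) = 0" using assms by (auto simp: admissible_def)
  obtain s m where s: "s \<in> F" "s \<noteq> 0" "Nm q m = 1" "u = s * m" using norm_decomposition uv(1) by blast
  have m0: "m \<noteq> 0" using uv s by auto
  define d where "d = m * v / s"
  have "d = inverse s * inverse s * (u * v)" using s by (simp add: d_def field_simps)
  hence "Tr q d = 0" using s uv by (simp add: Tr_scale F_mult F_inverse)
  moreover have "d \<noteq> 0" using s uv m0 by (simp add: d_def)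
  ultimately obtain r a where r: "r \<in> F" "r \<noteq> 0" "a \<in> S_set q" "d = r * a\<^sup>2"
    using trace_zero_decomposition by blast
  obtain l where l: "r = \<omega> ^ l" using r F_cases by blast
  obtain i where i: "m = mu_el ^ i" using norm_1_power_mu s by blast
  define k j where "k = l mod 4" and "j = l div 4"
  have r_eq: "r = \<omega> ^ (4 * j) * \<omega> ^ k" by (simp add: l k_def j_def power_add[symmetric])
  have eta_r: "eta r = (- \<i>) ^ k"
    by (simp add: r_eq eta_mult eta_power eta_\<omega> power_mult)
  have "Phi u v = Phi (s * m) (s * (v / s))" using s by simp
  also have "\<dots> = Phi m (v / s)" using s by (intro Phi_scale)
  also have "\<dots> = Phi (m * 1) (d / m)" using m0 by (simp add: d_def)
  also have "\<dots> = Phi 1 d" using s by (simp only: Phi_twist)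
  also have "\<dots> = - G * (- \<i>) ^ k * eps a" using r eta_r by (simp add: Phi_1_value)
  finally have Phi: "Phi u v = - G * (- \<i>) ^ k * eps a" .
  have "span_pt q (u, v) = span_pt q (s * m, s * (v / s))" using s by simp
  also have "\<dots> = span_pt q (m, v / s)" using s by (intro span_pt_scale)
  also have "v / s = \<omega> ^ (4 * j) * inverse m * (\<omega> ^ k * a\<^sup>2)"
  proof -
    have "v / s = inverse m * d" using m0 by (simp add: d_def)
    thus ?thesis by (simp add: r(4) r_eq mult_ac)
  qed
  also have "span_pt q (m, \<dots>) = lmap m (\<omega> ^ (4 * j)) ` span_pt q (1, \<omega> ^ k * a\<^sup>2)"
    by (simp add: image_lmap_span_pt)
  also have "\<dots> \<in> grp_orbit q \<alpha> (span_pt q (1, \<omega> ^ k * a\<^sup>2))"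
    unfolding grp_orbit_def using lmap_in_grp[of i j] i by blast
  finally show ?thesis using that[of k a] Phi r by (simp add: k_def)
qed

section \<open>Generators of the quadric\<close>

text \<open>For nonzero \<open>b\<close> and \<open>x\<close>, \<open>W b\<close> will be the star of a point off \<open>\<pi>\<close> and different from \<open>p\<close>, and
  \<open>V x\<close> the star of a point of \<open>\<pi>\<close>; all points other than \<open>p\<close> arise in this way.\<close>

definition W :: "'k \<Rightarrow> ('k \<times> 'k) set set" where
  "W b = {span_pt q (u, cr u b) | u. u \<noteq> 0}"

definition V :: "'k \<Rightarrow> ('k \<times> 'k) set set" where
  "V x = {span_pt q (s * x, y) | s y. s \<in> F \<and> Tr q (x * y) = 0 \<and> (s, y) \<noteq> (0, 0)}"

lemma cr_swap: "cr u b = - cr b u"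
  by (simp add: cr_def)

lemma cr_eq_0_swap: "cr u b = 0 \<longleftrightarrow> cr b u = 0"
  using cr_swap[of u b] by simp

lemma span_pt_in_W_iff:
  assumes "(u, v) \<noteq> (0, 0)"
  shows "span_pt q (u, v) \<in> W b \<longleftrightarrow> v = cr u b"
proof
  assume "span_pt q (u, v) \<in> W b"
  then obtain u' where "u' \<noteq> 0" "span_pt q (u', cr u' b) = span_pt q (u, v)" by (auto simp: W_def)
  then obtain s where "s \<in> F" "u = s * u'" "v = s * cr u' b" using assms by (auto elim: span_pt_eqD)
  thus "v = cr u b" by (simp add: cr_scale_left)
qed (use assms in \<open>auto simp: W_def\<close>)

lemma span_pt_in_V_iff:
  assumes "(u, v) \<noteq> (0, 0)" "x \<noteq> 0"
  shows "span_pt q (u, v) \<in> V x \<longleftrightarrow> Tr q (x * v) = 0 \<and> (\<exists>s\<in>F. u = s * x)"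
proof
  assume "span_pt q (u, v) \<in> V x"
  then obtain s y where sy: "s \<in> F" "Tr q (x * y) = 0" "span_pt q (s * x, y) = span_pt q (u, v)"
    by (auto simp: V_def)
  then obtain r where r: "r \<in> F" "u = r * (s * x)" "v = r * y" using assms by (auto elim: span_pt_eqD)
  have "Tr q (x * v) = Tr q (r * (x * y))" by (simp add: r mult_ac)
  also have "\<dots> = 0" using r sy by (simp add: Tr_scale)
  finally have "Tr q (x * v) = 0" .
  moreover have "u = (r * s) * x" "r * s \<in> F" using r sy by (auto simp: mult_ac)
  ultimately show "Tr q (x * v) = 0 \<and> (\<exists>s\<in>F. u = s * x)" by blast
next
  assume "Tr q (x * v) = 0 \<and> (\<exists>s\<in>F. u = s * x)"
  then obtain s where "Tr q (x * v) = 0" "s \<in> F" "u = s * x" by blast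
  thus "span_pt q (u, v) \<in> V x" using assms unfolding V_def by (intro CollectI exI[of _ s] exI[of _ v]) auto
qed

lemma W_subset_quadric: "W b \<subseteq> quadric q"
  by (auto simp: W_def Tr_mult_cr_left intro!: span_pt_in_quadric)

lemma V_subset_quadric: "x \<noteq> 0 \<Longrightarrow> V x \<subseteq> quadric q"
proof
  fix P assume x: "x \<noteq> 0" and "P \<in> V x"
  then obtain s y where sy: "s \<in> F" "Tr q (x * y) = 0" "(s, y) \<noteq> (0, 0)" "P = span_pt q (s * x, y)"
    by (auto simp: V_def)
  hence "(s * x, y) \<noteq> (0, 0)" "Tr q (s * x * y) = 0"
    using x by (auto simp: mult.assoc Tr_scale)
  thus "P \<in> quadric q" unfolding sy(4) by (rule span_pt_in_quadric)
qed

lemma W_inter_gen1: "b \<noteq> 0 \<Longrightarrow> W b \<inter> gen1 q = {span_pt q (b, 0)}"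
proof -
  assume b: "b \<noteq> 0"
  have "P = span_pt q (b, 0)" if P: "P \<in> W b" "P \<in> gen1 q" for P
  proof -
    obtain u where u: "u \<noteq> 0" "P = span_pt q (u, cr u b)" using P by (auto simp: W_def)
    hence "cr u b = 0" using P span_pt_in_gen1_iff[of u "cr u b"] by auto
    then obtain s where s: "s \<in> F" "b = s * u" using cr_eq_0_iff u by blast
    have "s \<noteq> 0" using b s(2) by (metis mult_zero_left)
    hence "span_pt q (s * u, s * 0) = span_pt q (u, 0)" using s(1) by (intro span_pt_scale)
    thus ?thesis unfolding s(2)[symmetric] u(2) \<open>cr u b = 0\<close> by simp
  qed
  moreover have "span_pt q (b, 0) \<in> W b" using b by (subst span_pt_in_W_iff) auto
  moreover have "span_pt q (b, 0) \<in> gen1 q" using b by (auto simp: gen1_def)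
  ultimately show ?thesis by blast
qed

lemma W_inter_gen2: "W b \<inter> gen2 q = {}"
  by (auto simp: W_def span_pt_in_gen2_iff)

lemma V_inter_gen1: "x \<noteq> 0 \<Longrightarrow> V x \<inter> gen1 q = {span_pt q (x, 0)}"
proof -
  assume x: "x \<noteq> 0"
  have "P = span_pt q (x, 0)" if P: "P \<in> V x" "P \<in> gen1 q" for P
  proof -
    obtain u where u: "u \<noteq> 0" "P = span_pt q (u, 0)" using P by (auto simp: gen1_def)
    then obtain s where s: "s \<in> F" "u = s * x" using P x span_pt_in_V_iff[of u 0 x] by auto
    have "s \<noteq> 0" using u(1) s(2) by (metis mult_zero_left)
    hence "span_pt q (s * x, s * 0) = span_pt q (x, 0)" using s(1) by (intro span_pt_scale)
    thus ?thesis unfolding s(2)[symmetric] u(2) by simp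
  qed
  moreover have "span_pt q (x, 0) \<in> V x" using x by (subst span_pt_in_V_iff) (auto simp: Tr_F intro!: bexI[of _ 1])
  moreover have "span_pt q (x, 0) \<in> gen1 q" using x by (auto simp: gen1_def)
  ultimately show ?thesis by blast
qed

text \<open>The fibres of y -> Tr (x * y) over F are translates of the kernel, so q fibres share the
  q^3 elements equally.\<close>

lemma card_orthogonal:
  assumes x: "x \<noteq> (0::'k)" shows "card {y. Tr q (x * y) = 0} = q\<^sup>2"
proof -
  obtain w where w: "Tr q (x * w) = 1" using ex_Tr_eq_1 x by blast
  define K where "K = {y. Tr q (x * y) = 0}"
  have "card {y. Tr q (x * y) = c} = card K" if c: "c \<in> F" for c
  proof -
    have "Tr q (x * (c * w)) = c" using c w by (simp add: Tr_scale mult.left_commute)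
    hence "bij_betw (\<lambda>y. y + c * w) K {y. Tr q (x * y) = c}"
      by (intro bij_betw_byWitness[where f' = "\<lambda>y. y - c * w"])
         (auto simp: K_def Tr_add Tr_diff algebra_simps)
    thus ?thesis by (simp add: bij_betw_same_card)
  qed
  hence "(\<Sum>c\<in>F. card {y \<in> UNIV. Tr q (x * y) = c}) = q * card K" by (simp add: card_F)
  moreover have "(\<Sum>c\<in>F. \<Sum>y\<in>{y \<in> UNIV. Tr q (x * y) = c}. 1::nat) = (\<Sum>y\<in>(UNIV::'k set). 1)"
    by (rule sum.group) (auto simp: Tr_in_F)
  ultimately have "q * card K = q ^ 3" by (simp add: card_field)
  thus ?thesis using q_ge_9 by (simp add: K_def power3_eq_cube power2_eq_square)
qed

lemma card_nonzero_orthogonal: "x \<noteq> 0 \<Longrightarrow> card {y. y \<noteq> 0 \<and> Tr q (x * y) = 0} = q\<^sup>2 - 1" for x :: 'k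
proof -
  assume "x \<noteq> 0"
  moreover have "{y. y \<noteq> 0 \<and> Tr q (x * y) = 0} = {y. Tr q (x * y) = 0} - {0}" by auto
  moreover have "Tr q (x * 0) = 0" using Tr_F[of 0] by simp
  ultimately show ?thesis by (simp add: card_Diff_singleton card_orthogonal)
qed

lemma card_V_inter_gen2: "x \<noteq> 0 \<Longrightarrow> card (V x \<inter> gen2 q) * (q - 1) = q\<^sup>2 - 1"
proof -
  assume x: "x \<noteq> 0"
  define A :: "('k \<times> 'k) set" where "A = {0} \<times> {y. y \<noteq> 0 \<and> Tr q (x * y) = 0}"
  have "V x \<inter> gen2 q = span_pt q ` A"
  proof (intro equalityI subsetI)
    fix P assume P: "P \<in> V x \<inter> gen2 q"
    then obtain y where y: "y \<noteq> 0" "P = span_pt q (0, y)" by (auto simp: gen2_def)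
    thus "P \<in> span_pt q ` A" using P x span_pt_in_V_iff[of 0 y x] by (auto simp: A_def)
  next
    fix P assume "P \<in> span_pt q ` A"
    then obtain y where y: "y \<noteq> 0" "Tr q (x * y) = 0" "P = span_pt q (0, y)" by (auto simp: A_def)
    have "span_pt q (0, y) \<in> V x"
      using y x by (subst span_pt_in_V_iff) (auto intro!: bexI[of _ 0])
    thus "P \<in> V x \<inter> gen2 q" using y by (auto simp: gen2_def)
  qed
  moreover have "card (span_pt q ` A) * (q - 1) = card A"
  proof (rule card_span_pt_image)
    show "(s * u, s * v) \<in> A" if "s \<in> F - {0}" "(u, v) \<in> A" for s u v
    proof -
      have "Tr q (x * (s * v)) = s * Tr q (x * v)" using that Tr_scale[of s "x * v"] by (simp add: mult_ac)
      thus ?thesis using that by (auto simp: A_def)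
    qed
  qed (auto simp: A_def)
  ultimately show ?thesis using x by (simp add: A_def card_cartesian_product card_nonzero_orthogonal)
qed

lemma card_gen1_orthogonal:
  assumes y: "y \<noteq> (0::'k)"
  shows "card {P. \<exists>x. x \<noteq> 0 \<and> P = span_pt q (x, 0) \<and> Tr q (x * y) = 0} * (q - 1) = q\<^sup>2 - 1"
proof -
  define A :: "('k \<times> 'k) set" where "A = {x. x \<noteq> 0 \<and> Tr q (y * x) = 0} \<times> {0}"
  have "{P. \<exists>x. x \<noteq> 0 \<and> P = span_pt q (x, 0) \<and> Tr q (x * y) = 0} = span_pt q ` A"
    by (auto simp: A_def mult.commute)
  moreover have "card (span_pt q ` A) * (q - 1) = card A"
  proof (rule card_span_pt_image)
    show "(s * u, s * v) \<in> A" if "s \<in> F - {0}" "(u, v) \<in> A" for s u v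
    proof -
      have "Tr q (y * (s * u)) = s * Tr q (y * u)" using that Tr_scale[of s "y * u"] by (simp add: mult_ac)
      thus ?thesis using that by (auto simp: A_def)
    qed
  qed (auto simp: A_def)
  ultimately show ?thesis using y by (simp add: A_def card_cartesian_product card_nonzero_orthogonal)
qed

section \<open>Sums of \<open>eta\<close> over all lines of a star\<close>

lemma sum_eta_multiples: "(\<Sum>u\<in>(\<lambda>s. s * b) ` F. eta u) = 0"
proof (cases "b = 0")
  case False
  hence "inj_on (\<lambda>s. s * b) F" by (auto intro: inj_onI)
  thus ?thesis using sum_eta_power[of 1] by (simp add: sum.reindex eta_mult flip: sum_distrib_right)
qed (auto simp: image_constant_conv)

lemma sum_eta_UNIV: "(\<Sum>u\<in>UNIV. eta u) = 0"
proof -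
  define S where "S = (\<Sum>u\<in>UNIV. eta u)"
  have "S = (\<Sum>u\<in>UNIV. eta (\<omega> * u))" unfolding S_def
    by (rule sum.reindex_bij_witness[of _ "\<lambda>u. \<omega> * u" "\<lambda>u. u / \<omega>"]) (auto simp: \<omega>_nonzero)
  also have "\<dots> = - \<i> * S" by (simp add: S_def eta_mult eta_\<omega> sum_distrib_left)
  finally have "S + \<i> * S = 0" by (simp only: add_eq_0_iff2 mult_minus_left)
  hence "(1 + \<i>) * S = 0" by (simp only: distrib_right mult_1)
  moreover have "1 + \<i> \<noteq> 0" by (simp add: complex_eq_iff)
  ultimately show ?thesis unfolding S_def by (metis mult_eq_0_iff)
qed

lemma cr_eq_0_set: "b \<noteq> 0 \<Longrightarrow> {u. cr u b = 0} = (\<lambda>s. s * b) ` F"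
proof -
  assume "b \<noteq> 0"
  hence "cr u b = 0 \<longleftrightarrow> (\<exists>s\<in>F. u = s * b)" for u
    using cr_eq_0_iff[of b u] cr_eq_0_swap[of u b] by simp
  thus ?thesis by auto
qed

lemma card_cr_nonzero: "b \<noteq> 0 \<Longrightarrow> card {u. cr u b \<noteq> 0} = q ^ 3 - q"
proof -
  assume b: "b \<noteq> 0"
  have "inj_on (\<lambda>s. s * b) F" using b by (auto intro: inj_onI)
  hence "card {u. cr u b = 0} = q" by (simp add: cr_eq_0_set[OF b] card_image card_F)
  moreover have "{u. cr u b \<noteq> 0} = UNIV - {u. cr u b = 0}" by auto
  ultimately show ?thesis by (simp add: card_Diff_subset card_field)
qed

text \<open>After exchanging the sums, for every nonzero t the map u -> b + t u permutes the
  elements outside F b, and \<open>eta\<close> sums to 0 there because it does so over the whole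
  field and over F b. Only t = 0 survives. So the line sums through a point recover
  \<open>eta\<close> at that point.\<close>

lemma sum_Phi_W:
  assumes b: "b \<noteq> 0"
  shows "(\<Sum>u | cr u b \<noteq> 0. Phi u (cr u b)) = of_nat (q ^ 3 - q) * eta b"
proof -
  define U where "U = {u. cr u b \<noteq> 0}"
  have U0: "(\<Sum>u\<in>U. eta u) = 0"
  proof -
    have "(\<Sum>u\<in>UNIV. eta u) = (\<Sum>u\<in>U. eta u) + (\<Sum>u\<in>{u. cr u b = 0}. eta u)"
      by (subst sum.union_disjoint[symmetric]) (auto simp: U_def intro: sum.cong)
    thus ?thesis by (simp add: sum_eta_UNIV cr_eq_0_set[OF b] sum_eta_multiples)
  qed
  have "(\<Sum>u\<in>U. Phi u (cr u b)) = (\<Sum>u\<in>U. \<Sum>t\<in>F. eta (b + t * u))"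
    by (intro sum.cong refl Phi_eq) (auto simp: U_def)
  also have "\<dots> = (\<Sum>t\<in>F. \<Sum>u\<in>U. eta (b + t * u))" by (rule sum.swap)
  also have "\<dots> = (\<Sum>t\<in>F. if t = 0 then of_nat (card U) * eta b else 0)"
  proof (intro sum.cong refl)
    fix t assume t: "t \<in> F"
    show "(\<Sum>u\<in>U. eta (b + t * u)) = (if t = 0 then of_nat (card U) * eta b else 0)"
    proof (cases "t = 0")
      case False
      have "(\<Sum>u\<in>U. eta (b + t * u)) = (\<Sum>u\<in>U. eta u)"
      proof (rule sum.reindex_bij_witness[of _ "\<lambda>u. inverse t * (u - b)" "\<lambda>u. b + t * u"])
        fix u assume "u \<in> U"
        thus "b + t * u \<in> U" using t False by (simp add: U_def cr_add_left cr_scale_left)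
      next
        fix u assume u: "u \<in> U"
        have "cr (inverse t * (u + - b)) b = inverse t * (cr u b + cr (- b) b)"
          using t by (simp only: cr_scale_left F_inverse cr_add_left)
        moreover have "cr (- b) b = 0" using cr_scale_left[of "-1" b b] by simp
        ultimately show "inverse t * (u - b) \<in> U" using u False by (simp add: U_def)
      qed (use False in \<open>auto simp: field_simps\<close>)
      thus ?thesis using False U0 by simp
    qed simp
  qed
  also have "\<dots> = of_nat (card U) * eta b" by simp
  finally show ?thesis using card_cr_nonzero[OF b] by (simp only: U_def)
qed

end

section \<open>From line sums to intersection numbers\<close>

locale cameron_liebler = cubic_extension e q \<alpha>
  for e q :: nat and \<alpha> :: "'k::{field,finite}" +
  fixes a1 :: 'k
  assumes a1: "a1 \<in> S_set q"
begin

abbreviation "TT1 \<equiv> T1 q \<alpha> a1"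
abbreviation "TT2 \<equiv> T2 q \<alpha> a1"

text \<open>The number is real, equal to 3^e up to sign; taking the real part makes it available for
  counting. It is the line sum at the base representatives (1, a^2) with a in
  \<open>X1\<close>.\<close>

definition \<gamma> :: real where "\<gamma> = Re (- G * eps a1)"

lemma \<gamma>_complex: "complex_of_real \<gamma> = - G * eps a1"
  and \<gamma>_cases: "\<gamma> = 3 ^ e \<or> \<gamma> = - (3 ^ e)"
proof -
  have "- G * eps a1 = complex_of_real (3 ^ e) \<or> - G * eps a1 = complex_of_real (- (3 ^ e))"
    using G_eq eps_cases[OF a1] by auto
  thus "complex_of_real \<gamma> = - G * eps a1" "\<gamma> = 3 ^ e \<or> \<gamma> = - (3 ^ e)"
    unfolding \<gamma>_def by (metis Re_complex_of_real)+
qed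

lemma \<gamma>_nonzero: "\<gamma> \<noteq> 0"
  using \<gamma>_cases by auto

lemma \<gamma>_squared: "\<gamma> * \<gamma> = real q"
  using \<gamma>_cases by (auto simp: q_eq power_add[symmetric] mult_2)

text \<open>The four values \<open>\<i> ^ k\<close> are split into two pairs of neighbours by the sign of
  \<open>Re ((1 + \<i>) * \<i> ^ k)\<close>.\<close>

definition sg :: "complex \<Rightarrow> real" where "sg x = Re ((1 + \<i>) * x)"

lemma sg_sum: "sg (\<Sum>x\<in>A. f x) = (\<Sum>x\<in>A. sg (f x))"
  by (simp add: sg_def sum_distrib_left)

lemma sg_scale: "sg (of_real r * x) = r * sg x"
  by (simp add: sg_def algebra_simps)

lemma sg_eta_cases: "b \<noteq> 0 \<Longrightarrow> sg (eta b) = 1 \<or> sg (eta b) = - 1"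
  using eta_cases[of b] by (auto simp: sg_def)

lemma Phi_cases:
  assumes "admissible u v"
  obtains k :: nat where "k < 4" "Phi u v = of_real \<gamma> * \<i> ^ k"
proof -
  obtain k a where ka: "k < (4::nat)" "a \<in> S_set q" "Phi u v = - G * (- \<i>) ^ k * eps a"
    using admissible_normal_form[OF assms] by blast
  have "eps a = eps a1 \<or> eps a = - eps a1" using eps_cases[OF ka(2)] eps_cases[OF a1] by auto
  hence "Phi u v = of_real \<gamma> * (- \<i>) ^ k \<or> Phi u v = of_real \<gamma> * - ((- \<i>) ^ k)"
    using ka by (auto simp: \<gamma>_complex)
  moreover have "\<exists>j<4. (- \<i>) ^ k = \<i> ^ j" "\<exists>j<4. - ((- \<i>) ^ k) = \<i> ^ j"
  proof -
    have "k \<in> {0, 1, 2, 3}" using ka by auto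
    thus "\<exists>j<4. (- \<i>) ^ k = \<i> ^ j"
      by (auto simp: power3_eq_cube intro: exI[of _ 0] exI[of _ 3] exI[of _ 2] exI[of _ 1])
    show "\<exists>j<4. - ((- \<i>) ^ k) = \<i> ^ j" using \<open>k \<in> {0, 1, 2, 3}\<close>
      by (auto simp: power3_eq_cube intro: exI[of _ 0] exI[of _ 3] exI[of _ 2] exI[of _ 1])
  qed
  ultimately show ?thesis using that by metis
qed

lemma sg_Phi_cases: "admissible u v \<Longrightarrow> sg (Phi u v) = \<gamma> \<or> sg (Phi u v) = - \<gamma>"
proof -
  assume "admissible u v"
  then obtain k :: nat where k: "k < 4" "Phi u v = of_real \<gamma> * \<i> ^ k" using Phi_cases by blast
  have "k \<in> {0, 1, 2, 3}" using k by auto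
  thus ?thesis by (auto simp: k sg_scale) (auto simp: sg_def power3_eq_cube)
qed

lemma T1_span_ptD:
  assumes "P \<in> TT1"
  obtains u v where "admissible u v" "P = span_pt q (u, v)" "sg (Phi u v) = \<gamma>"
proof -
  note concl = that
  have key: thesis if orb: "P \<in> grp_orbit q \<alpha> (span_pt q (1, s * a\<^sup>2))" and s: "s \<in> F" "s \<noteq> 0"
    and a: "a \<in> S_set q" and sg: "sg (- G * eta s * eps a) = \<gamma>" for s a
  proof -
    have "s * a\<^sup>2 \<noteq> 0" "Tr q (s * a\<^sup>2) = 0"
      using s a by (auto simp: S_set_def Tr_scale)
    then obtain u v where uv: "admissible u v" "P = span_pt q (u, v)" "Phi u v = Phi 1 (s * a\<^sup>2)"
      by (rule grp_orbit_PhiD[OF orb])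
    thus ?thesis using concl[of u v] Phi_1_value[OF s a] sg by simp
  qed
  have val: "sg (- G * z * eps a) = \<gamma> * sg z" if "eps a = eps a1" for z a
    using sg_scale[of \<gamma> z] that by (simp add: \<gamma>_complex mult_ac)
  have val': "sg (- G * z * eps a) = \<gamma> * sg (- z)" if "eps a = - eps a1" for z a
    using sg_scale[of \<gamma> "- z"] that by (simp add: \<gamma>_complex mult_ac)
  have sgs: "sg (eta 1) = 1" "sg (eta \<omega>) = 1" "sg (- eta (\<omega> ^ 2)) = 1" "sg (- eta (\<omega> ^ 3)) = 1"
    by (simp_all add: sg_def eta_power eta_\<omega>) (simp add: power3_eq_cube)
  consider a where "a \<in> X1 q a1" "P \<in> grp_orbit q \<alpha> (span_pt q (1, 1 * a\<^sup>2))"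
    | a where "a \<in> X1 q a1" "P \<in> grp_orbit q \<alpha> (span_pt q (1, \<omega> * a\<^sup>2))"
    | a where "a \<in> X2 q a1" "P \<in> grp_orbit q \<alpha> (span_pt q (1, \<omega> ^ 2 * a\<^sup>2))"
    | a where "a \<in> X2 q a1" "P \<in> grp_orbit q \<alpha> (span_pt q (1, \<omega> ^ 3 * a\<^sup>2))"
    using assms unfolding T1_def \<omega>_def by auto
  thus ?thesis
  proof cases
    case 1
    thus ?thesis using val[of a "eta 1"] sgs by (intro key[of 1 a]) (simp_all add: X1_iff[OF a1])
  next
    case 2
    thus ?thesis using val[of a "eta \<omega>"] sgs \<omega>_in_F \<omega>_nonzero
      by (intro key[of \<omega> a]) (simp_all add: X1_iff[OF a1])
  next
    case 3
    thus ?thesis using val'[of a "eta (\<omega> ^ 2)"] sgs \<omega>_power_in_F \<omega>_nonzero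
      by (intro key[of "\<omega> ^ 2" a]) (simp_all add: X2_iff[OF a1])
  next
    case 4
    thus ?thesis using val'[of a "eta (\<omega> ^ 3)"] sgs \<omega>_power_in_F \<omega>_nonzero
      by (intro key[of "\<omega> ^ 3" a]) (simp_all add: X2_iff[OF a1])
  qed
qed

text \<open>By the normal form, the line sum divided by \<open>\<gamma>\<close> is (-i)^k for a in
  \<open>X1\<close> and its negative for a in \<open>X2\<close>. The exponents 0, 1 in the first
  case and 2, 3 in the second are exactly those giving 1 or -i, the values with \<open>sg\<close>
  equal to 1.\<close>

lemma span_pt_in_T1_iff:
  assumes "admissible u v"
  shows "span_pt q (u, v) \<in> TT1 \<longleftrightarrow> sg (Phi u v) = \<gamma>"
proof
  assume "span_pt q (u, v) \<in> TT1"
  then obtain u' v' where *: "admissible u' v'" "span_pt q (u, v) = span_pt q (u', v')" "sg (Phi u' v') = \<gamma>"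
    using T1_span_ptD by metis
  have "(u', v') \<noteq> (0, 0)" using * by (auto simp: admissible_def)
  then obtain s where "s \<in> F" "s \<noteq> 0" "u' = s * u" "v' = s * v" using span_pt_eqD *(2) by metis
  thus "sg (Phi u v) = \<gamma>" using * by (simp add: Phi_scale)
next
  assume sg: "sg (Phi u v) = \<gamma>"
  obtain k a where ka: "k < (4::nat)" "a \<in> S_set q" "Phi u v = - G * (- \<i>) ^ k * eps a"
    "span_pt q (u, v) \<in> grp_orbit q \<alpha> (span_pt q (1, \<omega> ^ k * a\<^sup>2))"
    using admissible_normal_form[OF assms] by metis
  have val: "sg (Phi u v) = \<gamma> * sg ((- \<i>) ^ k)" if "eps a = eps a1"
    using sg_scale[of \<gamma> "(- \<i>) ^ k"] that ka by (simp add: \<gamma>_complex mult_ac)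
  have val': "sg (Phi u v) = \<gamma> * sg (- ((- \<i>) ^ k))" if "eps a = - eps a1"
    using sg_scale[of \<gamma> "- ((- \<i>) ^ k)"] that ka by (simp add: \<gamma>_complex mult_ac)
  have k: "k = 0 \<or> k = 1 \<or> k = 2 \<or> k = 3" using ka(1) by auto
  have "eps a = eps a1 \<or> eps a = - eps a1" using eps_cases[OF ka(2)] eps_cases[OF a1] by auto
  thus "span_pt q (u, v) \<in> TT1"
  proof
    assume ea: "eps a = eps a1"
    hence "a \<in> X1 q a1" using ka by (simp add: X1_iff[OF a1])
    moreover have "k = 0 \<or> k = 1"
      using k val[OF ea] sg \<gamma>_nonzero by (auto simp: sg_def power3_eq_cube)
    ultimately show ?thesis using ka(4) unfolding T1_def \<omega>_def by auto
  next
    assume ea: "eps a = - eps a1"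
    hence "a \<in> X2 q a1" using ka by (simp add: X2_iff[OF a1])
    moreover have "k = 2 \<or> k = 3"
      using k val'[OF ea] sg \<gamma>_nonzero by (auto simp: sg_def power3_eq_cube)
    ultimately show ?thesis using ka(4) unfolding T1_def \<omega>_def by auto
  qed
qed

lemma span_pt_in_T2_iff:
  assumes "admissible u v"
  shows "span_pt q (u, v) \<in> TT2 \<longleftrightarrow> sg (Phi u v) = - \<gamma>"
proof -
  have "(u, v) \<noteq> (0, 0)" "u \<noteq> 0" "v \<noteq> 0" "Tr q (u * v) = 0"
    using assms by (auto simp: admissible_def)
  thus ?thesis using assms sg_Phi_cases[OF assms] \<gamma>_nonzero
    by (auto simp: T2_def span_pt_in_T1_iff span_pt_in_gen1_iff span_pt_in_gen2_iff span_pt_in_quadric)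
qed

lemma T1_subset_quadric: "TT1 \<subseteq> quadric q"
  by (auto elim!: T1_span_ptD simp: admissible_def intro!: span_pt_in_quadric)

lemma T1_disjoint: "TT1 \<inter> gen1 q = {}" "TT1 \<inter> gen2 q = {}"
  by (auto elim!: T1_span_ptD simp: admissible_def span_pt_in_gen1_iff span_pt_in_gen2_iff)

lemma T2_subset_quadric: "TT2 \<subseteq> quadric q"
  by (auto simp: T2_def)

text \<open>\<open>sum_Phi_W\<close> gives the sum of the signed line sums, each
  \<open>\<gamma>\<close> or its negative, and so the number of each kind. The directions u in F b
  are left out; they give the single point of the star in \<open>gen1\<close>.\<close>

lemma card_W_inter:
  assumes b: "b \<noteq> 0"
  shows "real (card (W b \<inter> TT1)) = (real q + 1) * (real q + \<gamma> * sg (eta b)) / 2"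
    and "real (card (W b \<inter> TT2)) = (real q + 1) * (real q - \<gamma> * sg (eta b)) / 2"
proof -
  define U where "U = {u. cr u b \<noteq> 0}"
  define f where "f u = sg (Phi u (cr u b))" for u
  have adm: "admissible u (cr u b)" if "u \<in> U" for u
    using that by (auto simp: admissible_def U_def Tr_mult_cr_left)
  have f_cases: "f u = \<gamma> \<or> f u = - \<gamma>" if "u \<in> U" for u
    using sg_Phi_cases[OF adm[OF that]] by (simp add: f_def)
  have cardU: "card U = q ^ 3 - q" using card_cr_nonzero[OF b] by (simp add: U_def)
  have qq: "q \<le> q ^ 3" using q_ge_9 self_le_power[of q 3] by simp
  have realU: "real (card U) = (real q - 1) * (real q * (real q + 1))"
    using qq by (simp add: cardU of_nat_diff power3_eq_cube algebra_simps)
  have "(\<Sum>u\<in>U. f u) = sg (of_real (real (card U)) * eta b)"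
    using sum_Phi_W[OF b] by (simp add: f_def sg_sum[symmetric] U_def[symmetric] cardU)
  hence sum: "(\<Sum>u\<in>U. f u) = real (card U) * sg (eta b)" by (simp only: sg_scale)
  note tv = sum_two_values[of U f \<gamma>, OF _ f_cases \<gamma>_nonzero]
  have inter: "card (W b \<inter> T) * (q - 1) = card {u \<in> U. f u = c}"
    if T: "\<And>u v. admissible u v \<Longrightarrow> span_pt q (u, v) \<in> T \<longleftrightarrow> sg (Phi u v) = c"
      and dis: "T \<inter> gen1 q = {}" for T c
  proof -
    define A where "A = (\<lambda>u. (u, cr u b)) ` {u \<in> U. f u = c}"
    have "W b \<inter> T = span_pt q ` A"
    proof (intro equalityI subsetI)
      fix P assume P: "P \<in> W b \<inter> T"
      then obtain u where u: "u \<noteq> 0" "P = span_pt q (u, cr u b)" by (auto simp: W_def)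
      have "cr u b \<noteq> 0"
      proof
        assume "cr u b = 0"
        hence "P \<in> gen1 q" using u by (auto simp: gen1_def)
        thus False using P dis by auto
      qed
      hence "u \<in> U" by (simp add: U_def)
      thus "P \<in> span_pt q ` A" using u P T[OF adm] by (auto simp: A_def f_def)
    next
      fix P assume "P \<in> span_pt q ` A"
      then obtain u where u: "u \<in> U" "f u = c" "P = span_pt q (u, cr u b)" by (auto simp: A_def)
      hence "u \<noteq> 0" by (auto simp: U_def)
      thus "P \<in> W b \<inter> T" using u T[OF adm] by (auto simp: W_def f_def)
    qed
    moreover have "card (span_pt q ` A) * (q - 1) = card A"
    proof (rule card_span_pt_image)
      show "(s * u, s * v) \<in> A" if "s \<in> F - {0}" "(u, v) \<in> A" for s u v
        using that by (auto simp: A_def U_def f_def cr_scale_left Phi_scale)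
    qed (auto simp: A_def U_def)
    moreover have "card A = card {u \<in> U. f u = c}"
      unfolding A_def by (intro card_image inj_onI) auto
    ultimately show ?thesis by simp
  qed
  have q1: "real (q - 1) = real q - 1" "real q - 1 \<noteq> 0" using q_ge_9 by (auto simp: of_nat_diff)
  have "\<gamma> * (2 * real (card {u \<in> U. f u = \<gamma>})) = real (card U) * (\<gamma> + sg (eta b))"
    using tv(1) sum by (simp add: algebra_simps)
  \<comment> \<open>A further factor \<open>\<gamma>\<close> replaces a division by
    \<open>\<gamma>\<close>, since \<open>\<gamma> * \<gamma>\<close> is q.\<close>
  hence "\<gamma> * (\<gamma> * (2 * real (card {u \<in> U. f u = \<gamma>}))) = \<gamma> * (real (card U) * (\<gamma> + sg (eta b)))"
    by (rule arg_cong)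
  hence "\<gamma> * \<gamma> * (2 * real (card {u \<in> U. f u = \<gamma>})) = real (card U) * (\<gamma> * \<gamma> + \<gamma> * sg (eta b))"
    by (simp only: distrib_left mult_ac)
  hence "real q * (2 * real (card {u \<in> U. f u = \<gamma>})) = real q * ((real q - 1) * (real q + 1) * (real q + \<gamma> * sg (eta b)))"
    unfolding \<gamma>_squared realU by (simp only: mult_ac)
  hence pos: "2 * real (card {u \<in> U. f u = \<gamma>}) = (real q - 1) * ((real q + 1) * (real q + \<gamma> * sg (eta b)))"
    using q_ge_9 by simp
  have "2 * real (card {u \<in> U. f u = - \<gamma>}) = 2 * real (card U) - 2 * real (card {u \<in> U. f u = \<gamma>})"
    using tv(2) by simp
  hence neg: "2 * real (card {u \<in> U. f u = - \<gamma>}) = (real q - 1) * ((real q + 1) * (real q - \<gamma> * sg (eta b)))"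
    unfolding pos realU by algebra
  have "real (card (W b \<inter> TT1)) * (real q - 1) = real (card {u \<in> U. f u = \<gamma>})"
    unfolding q1(1)[symmetric] of_nat_mult[symmetric] using span_pt_in_T1_iff T1_disjoint
    by (intro arg_cong[of _ _ real] inter)
  hence "(real q - 1) * (2 * real (card (W b \<inter> TT1))) = (real q - 1) * ((real q + 1) * (real q + \<gamma> * sg (eta b)))"
    using pos by (simp add: mult_ac)
  thus "real (card (W b \<inter> TT1)) = (real q + 1) * (real q + \<gamma> * sg (eta b)) / 2"
    using q1(2) by simp
  have "TT2 \<inter> gen1 q = {}" by (auto simp: T2_def)
  hence "real (card (W b \<inter> TT2)) * (real q - 1) = real (card {u \<in> U. f u = - \<gamma>})"
    unfolding q1(1)[symmetric] of_nat_mult[symmetric] using span_pt_in_T2_iff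
    by (intro arg_cong[of _ _ real] inter)
  hence "(real q - 1) * (2 * real (card (W b \<inter> TT2))) = (real q - 1) * ((real q + 1) * (real q - \<gamma> * sg (eta b)))"
    using neg by (simp add: mult_ac)
  thus "real (card (W b \<inter> TT2)) = (real q + 1) * (real q - \<gamma> * sg (eta b)) / 2"
    using q1(2) by simp
qed

lemma Phi_\<omega>_squared: "Phi u (\<omega>\<^sup>2 * v) = - Phi u v"
  using \<omega>_power_in_F[of 2] \<omega>_nonzero by (simp add: Phi_scale_right eta_power eta_\<omega>)

lemma sg_minus: "sg (- x) = - sg x"
  by (simp add: sg_def)

text \<open>Multiplying y by the square of \<open>\<omega>\<close> stays inside the star and
  reverses the sign of \<open>Phi\<close>, so the two kinds are equally frequent. With the first
  coordinate normalised to x, the element y is a faithful coordinate and no factor q - 1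
  appears.\<close>

lemma card_V_inter:
  assumes x: "x \<noteq> 0"
  shows "2 * card (V x \<inter> TT1) = q\<^sup>2 - 1" and "2 * card (V x \<inter> TT2) = q\<^sup>2 - 1"
proof -
  define Y where "Y = {y. y \<noteq> 0 \<and> Tr q (x * y) = 0}"
  define f where "f y = sg (Phi x y)" for y
  have adm: "admissible x y" if "y \<in> Y" for y
    using that x by (auto simp: admissible_def Y_def)
  have f_cases: "f y = \<gamma> \<or> f y = - \<gamma>" if "y \<in> Y" for y
    using sg_Phi_cases[OF adm[OF that]] by (simp add: f_def)
  have inter: "card (V x \<inter> T) = card {y \<in> Y. f y = c}"
    if T: "\<And>u v. admissible u v \<Longrightarrow> span_pt q (u, v) \<in> T \<longleftrightarrow> sg (Phi u v) = c"
      and dis: "T \<inter> gen1 q = {}" "T \<inter> gen2 q = {}" for T c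
  proof -
    have "V x \<inter> T = (\<lambda>y. span_pt q (x, y)) ` {y \<in> Y. f y = c}"
    proof (intro equalityI subsetI)
      fix P assume P: "P \<in> V x \<inter> T"
      then obtain s y where sy: "s \<in> F" "Tr q (x * y) = 0" "(s, y) \<noteq> (0, 0)" "P = span_pt q (s * x, y)"
        by (auto simp: V_def)
      have "s \<noteq> 0"
      proof
        assume "s = 0"
        hence "P \<in> gen2 q" using sy by (auto simp: gen2_def)
        thus False using P dis by auto
      qed
      have "y \<noteq> 0"
      proof
        assume "y = 0"
        hence "P \<in> gen1 q" using sy x \<open>s \<noteq> 0\<close> by (auto simp: gen1_def)
        thus False using P dis by auto
      qed
      have P': "P = span_pt q (x, y / s)"
        using sy \<open>s \<noteq> 0\<close> span_pt_scale[of s x "y / s"] by simp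
      have "Tr q (x * (y / s)) = inverse s * Tr q (x * y)"
        using Tr_scale[OF F_inverse[OF sy(1)], of "x * y"] by (simp add: divide_inverse mult_ac)
      hence "y / s \<in> Y" using sy \<open>s \<noteq> 0\<close> \<open>y \<noteq> 0\<close> by (simp add: Y_def)
      thus "P \<in> (\<lambda>y. span_pt q (x, y)) ` {y \<in> Y. f y = c}"
        using P P' T[OF adm] by (auto simp: f_def)
    next
      fix P assume "P \<in> (\<lambda>y. span_pt q (x, y)) ` {y \<in> Y. f y = c}"
      then obtain y where y: "y \<in> Y" "f y = c" "P = span_pt q (x, y)" by auto
      have "P \<in> T" using T[OF adm[OF y(1)]] y by (simp add: f_def)
      moreover have "P \<in> V x" unfolding y(3) using x y(1)
        by (subst span_pt_in_V_iff) (auto simp: Y_def intro!: bexI[of _ 1])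
      ultimately show "P \<in> V x \<inter> T" by simp
    qed
    moreover have "inj_on (\<lambda>y. span_pt q (x, y)) {y \<in> Y. f y = c}"
    proof (rule inj_onI)
      fix y y' assume "span_pt q (x, y) = span_pt q (x, y')"
      then obtain s where "s \<in> F" "x = s * x" "y' = s * y" using x by (auto elim: span_pt_eqD)
      thus "y = y'" using x by simp
    qed
    ultimately show ?thesis by (simp add: card_image)
  qed
  have "bij_betw (\<lambda>y. \<omega>\<^sup>2 * y) {y \<in> Y. f y = \<gamma>} {y \<in> Y. f y = - \<gamma>}"
  proof (rule bij_betw_byWitness[where f' = "\<lambda>y. y / \<omega>\<^sup>2"])
    have tr: "Tr q (x * (\<omega>\<^sup>2 * y)) = \<omega>\<^sup>2 * Tr q (x * y)" for y
      using Tr_scale[OF \<omega>_power_in_F[of 2], of "x * y"] by (simp add: mult_ac)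
    show "(\<lambda>y. \<omega>\<^sup>2 * y) ` {y \<in> Y. f y = \<gamma>} \<subseteq> {y \<in> Y. f y = - \<gamma>}"
      using \<omega>_nonzero by (auto simp: Y_def f_def Phi_\<omega>_squared sg_minus tr)
    show "(\<lambda>y. y / \<omega>\<^sup>2) ` {y \<in> Y. f y = - \<gamma>} \<subseteq> {y \<in> Y. f y = \<gamma>}"
    proof (rule image_subsetI)
      fix y assume "y \<in> {y \<in> Y. f y = - \<gamma>}"
      thus "y / \<omega>\<^sup>2 \<in> {y \<in> Y. f y = \<gamma>}"
        using Phi_\<omega>_squared[of x "y / \<omega>\<^sup>2"] tr[of "y / \<omega>\<^sup>2"] \<omega>_nonzero
        by (simp add: f_def Y_def sg_minus)
    qed
  qed (use \<omega>_nonzero in auto)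
  hence "card {y \<in> Y. f y = \<gamma>} = card {y \<in> Y. f y = - \<gamma>}" by (rule bij_betw_same_card)
  moreover have "card {y \<in> Y. f y = - \<gamma>} + card {y \<in> Y. f y = \<gamma>} = card Y"
    by (rule sum_two_values(2)) (use f_cases \<gamma>_nonzero in auto)
  moreover have "card Y = q\<^sup>2 - 1" unfolding Y_def using x by (rule card_nonzero_orthogonal)
  moreover have "card (V x \<inter> TT1) = card {y \<in> Y. f y = \<gamma>}"
    using span_pt_in_T1_iff T1_disjoint by (intro inter) auto
  moreover have "card (V x \<inter> TT2) = card {y \<in> Y. f y = - \<gamma>}"
    using span_pt_in_T2_iff by (intro inter) (auto simp: T2_def)
  ultimately show "2 * card (V x \<inter> TT1) = q\<^sup>2 - 1" "2 * card (V x \<inter> TT2) = q\<^sup>2 - 1" by auto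
qed

text \<open>An affine line has q points b, each contributing 1 or -1 to \<open>sg (Phi u v)\<close>,
  so the sum fixes both frequencies.\<close>

lemma card_solutions_cr:
  assumes uv: "admissible u v" and s: "s = 1 \<or> s = - 1"
  shows "2 * real (card {b. cr u b = v \<and> sg (eta b) = s}) = real q + s * sg (Phi u v)"
proof -
  define B where "B = {b. cr u b = v}"
  have u: "u \<noteq> 0" "v \<noteq> 0" using uv by (auto simp: admissible_def)
  obtain b0 where b0: "cr u b0 = v" using cr_solvable uv by (auto simp: admissible_def)
  have cardB: "card B = q"
    unfolding B_def solutions_cr_eq[OF u(1) b0]
    by (subst card_image) (auto simp: card_F inj_on_line u)
  have s0: "s \<noteq> 0" using s by auto
  have cases: "sg (eta b) = s \<or> sg (eta b) = - s" if "b \<in> B" for b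
  proof -
    have "b \<noteq> 0" using that u by (auto simp: B_def)
    thus ?thesis using sg_eta_cases[of b] s by auto
  qed
  have "sg (Phi u v) = (\<Sum>b\<in>B. sg (eta b))" by (simp add: Phi_def sg_sum B_def)
  also have "\<dots> = s * (2 * real (card {b \<in> B. sg (eta b) = s}) - real (card B))"
    by (rule sum_two_values(1)) (use cases s0 in auto)
  finally have "s * sg (Phi u v) = 2 * real (card {b \<in> B. sg (eta b) = s}) - real q"
    using s by (auto simp: cardB)
  thus ?thesis by (simp add: B_def)
qed

text \<open>On the multiples of u, multiplication by the square of \<open>\<omega>\<close> exchanges
  the two signs.\<close>

lemma card_multiples_sg:
  assumes u: "u \<noteq> 0" and s: "s = 1 \<or> s = - 1"
  shows "2 * card {b. b \<noteq> 0 \<and> cr u b = 0 \<and> sg (eta b) = s} = q - 1"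
proof -
  define B where "B = {b. b \<noteq> 0 \<and> cr u b = 0}"
  have "B = (\<lambda>s. s * u) ` F - {0}" using cr_eq_0_set[OF u] cr_eq_0_swap[of u] by (auto simp: B_def)
  moreover have "card ((\<lambda>s. s * u) ` F) = q" using u by (subst card_image) (auto simp: card_F intro: inj_onI)
  moreover have "0 \<in> (\<lambda>s. s * u) ` F" by (auto intro!: image_eqI[of _ _ 0])
  ultimately have cardB: "card B = q - 1" by (simp add: card_Diff_singleton)
  have s0: "s \<noteq> 0" using s by auto
  have cases: "sg (eta b) = s \<or> sg (eta b) = - s" if "b \<in> B" for b
    using that sg_eta_cases[of b] s by (auto simp: B_def)
  have w: "sg (eta (\<omega>\<^sup>2 * b)) = - sg (eta b)" "cr u (\<omega>\<^sup>2 * b) = \<omega>\<^sup>2 * cr u b" for b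
    using cr_scale_right[OF \<omega>_power_in_F[of 2]] by (simp_all add: eta_mult eta_power eta_\<omega> sg_minus)
  have "bij_betw (\<lambda>y. \<omega>\<^sup>2 * y) {b \<in> B. sg (eta b) = s} {b \<in> B. sg (eta b) = - s}"
  proof (rule bij_betw_byWitness[where f' = "\<lambda>y. y / \<omega>\<^sup>2"])
    show "(\<lambda>y. \<omega>\<^sup>2 * y) ` {b \<in> B. sg (eta b) = s} \<subseteq> {b \<in> B. sg (eta b) = - s}"
      using \<omega>_nonzero w by (auto simp: B_def)
    show "(\<lambda>y. y / \<omega>\<^sup>2) ` {b \<in> B. sg (eta b) = - s} \<subseteq> {b \<in> B. sg (eta b) = s}"
    proof (rule image_subsetI)
      fix b assume "b \<in> {b \<in> B. sg (eta b) = - s}"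
      thus "b / \<omega>\<^sup>2 \<in> {b \<in> B. sg (eta b) = s}"
        using w[of "b / \<omega>\<^sup>2"] \<omega>_nonzero by (simp add: B_def)
    qed
  qed (use \<omega>_nonzero in auto)
  hence "card {b \<in> B. sg (eta b) = s} = card {b \<in> B. sg (eta b) = - s}" by (rule bij_betw_same_card)
  moreover have "card {b \<in> B. sg (eta b) = - s} + card {b \<in> B. sg (eta b) = s} = card B"
    by (rule sum_two_values(2)) (use cases s0 in auto)
  ultimately have "2 * card {b \<in> B. sg (eta b) = s} = q - 1" using cardB by linarith
  thus ?thesis by (simp add: B_def conj_assoc)
qed

lemma ex_sg: "\<exists>b. b \<noteq> 0 \<and> sg (eta b) = 1" "\<exists>b. b \<noteq> 0 \<and> sg (eta b) = - 1"
proof -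
  show "\<exists>b. b \<noteq> 0 \<and> sg (eta b) = 1" by (intro exI[of _ 1]) (simp add: sg_def)
  show "\<exists>b. b \<noteq> 0 \<and> sg (eta b) = - 1"
    by (intro exI[of _ "\<omega>\<^sup>2"]) (simp add: sg_def eta_power eta_\<omega> \<omega>_nonzero)
qed

end

section \<open>Incidence in \<open>PG(3,q)\<close>\<close>

lemma nontrivial_subspace_contains_point:
  fixes U :: "('f::field ^ 4) set"
  assumes "vec.subspace U" "vec.dim U \<ge> 1"
  obtains r where "r \<in> pg_points" "r \<subseteq> U"
proof -
  have "\<not> U \<subseteq> {0}" using assms vec.dim_eq_0[of U] by linarith
  then obtain x where x: "x \<in> U" "x \<noteq> 0" by auto
  have "vec.span {x} \<in> pg_points" using x by (simp add: pg_points_def)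
  moreover have "vec.span {x} \<subseteq> U" using x assms by (simp add: vec.span_minimal)
  ultimately show ?thesis using that by blast
qed

lemma dim_ge_2_if_two_points:
  fixes U :: "('f::field ^ 4) set"
  assumes "r \<in> pg_points" "s \<in> pg_points" "r \<noteq> s" "r \<subseteq> U" "s \<subseteq> U"
  shows "vec.dim U \<ge> 2"
proof (rule ccontr)
  assume "\<not> ?thesis"
  hence U: "vec.dim (vec.span U) \<le> 1" by simp
  have "r \<subseteq> vec.span U" "s \<subseteq> vec.span U" using assms vec.span_superset by blast+
  hence "r = vec.span U" "s = vec.span U"
    using assms U by - (rule vec.subspace_dim_equal; simp add: pg_points_def)+
  thus False using assms by simp
qed

lemma pg_line_subset_if_two_points:
  assumes "l \<in> pg_lines" "vec.subspace U" "r \<in> pg_points" "s \<in> pg_points" "r \<noteq> s"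
    "r \<subseteq> l" "s \<subseteq> l" "r \<subseteq> U" "s \<subseteq> U"
  shows "l \<subseteq> U"
proof -
  have "vec.dim (l \<inter> U) \<ge> 2" using assms by (intro dim_ge_2_if_two_points[of r s]) auto
  hence "l \<inter> U = l"
    using assms by (intro vec.subspace_dim_equal) (auto simp: pg_lines_def vec.subspace_inter)
  thus ?thesis by auto
qed

lemma pg_line_unique:
  assumes "l \<in> pg_lines" "m \<in> pg_lines" "r \<in> pg_points" "s \<in> pg_points" "r \<noteq> s"
    "r \<subseteq> l" "s \<subseteq> l" "r \<subseteq> m" "s \<subseteq> m"
  shows "l = m"
  using pg_line_subset_if_two_points[of l m r s] pg_line_subset_if_two_points[of m l r s] assms
  by (auto simp: pg_lines_def)

lemma pg_line_through:
  assumes "r \<in> pg_points" "s \<in> pg_points" "r \<noteq> s"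
  obtains l where "l \<in> pg_lines" "r \<subseteq> l" "s \<subseteq> l"
    "\<And>U. vec.subspace U \<Longrightarrow> r \<subseteq> U \<Longrightarrow> s \<subseteq> U \<Longrightarrow> l \<subseteq> U"
proof -
  define l where "l = {x + y | x y. x \<in> r \<and> y \<in> s}"
  have sub: "vec.subspace r" "vec.subspace s" "vec.dim r = 1" "vec.dim s = 1"
    using assms by (auto simp: pg_points_def)
  have l: "vec.subspace l" unfolding l_def using sub by (intro vec.subspace_sums)
  have r: "r \<subseteq> l" unfolding l_def using vec.subspace_0[OF sub(2)] by (force intro: exI[of _ 0])
  have s: "s \<subseteq> l" unfolding l_def using vec.subspace_0[OF sub(1)] by (force intro: exI[of _ 0])
  have "vec.dim l + vec.dim (r \<inter> s) = 2" unfolding l_def using sub by (subst vec.dim_sums_Int) auto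
  moreover have "vec.dim l \<ge> 2" using assms r s by (rule dim_ge_2_if_two_points)
  ultimately have "l \<in> pg_lines" using l by (simp add: pg_lines_def)
  moreover have "l \<subseteq> U" if "vec.subspace U" "r \<subseteq> U" "s \<subseteq> U" for U
    using that by (auto simp: l_def intro: vec.subspace_add)
  ultimately show ?thesis using that r s by blast
qed

lemma ex_pg_point_outside:
  fixes U :: "('f::field ^ 4) set"
  assumes "vec.subspace U" "vec.subspace X" "U \<subset> X"
  obtains r where "r \<in> pg_points" "r \<subseteq> X" "\<not> r \<subseteq> U"
proof -
  obtain x where x: "x \<in> X" "x \<notin> U" using assms by auto
  have "x \<noteq> 0" using x vec.subspace_0[OF assms(1)] by auto
  hence "vec.span {x} \<in> pg_points" by (simp add: pg_points_def)
  moreover have "vec.span {x} \<subseteq> X" using x assms by (simp add: vec.span_minimal)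
  moreover have "\<not> vec.span {x} \<subseteq> U" using x vec.span_base[of x "{x}"] by auto
  ultimately show ?thesis using that by blast
qed

lemma ex_pg_line_in_subspace:
  fixes X :: "('f::field ^ 4) set"
  assumes "r \<in> pg_points" "vec.subspace X" "r \<subseteq> X" "vec.dim X \<ge> 2"
  obtains l where "l \<in> pg_lines" "r \<subseteq> l" "l \<subseteq> X"
proof -
  have "r \<noteq> X" using assms by (auto simp: pg_points_def)
  then obtain s where s: "s \<in> pg_points" "s \<subseteq> X" "\<not> s \<subseteq> r"
    using assms ex_pg_point_outside[of r X] by (auto simp: pg_points_def)
  obtain l where "l \<in> pg_lines" "r \<subseteq> l" "l \<subseteq> X"
    using pg_line_through[of r s] assms s by (metis order_refl)
  thus ?thesis using that by blast
qed

lemma ex_other_pg_line: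
  fixes l :: "('f::field ^ 4) set"
  assumes "r \<in> pg_points" "l \<in> pg_lines"
  obtains m where "m \<in> pg_lines" "r \<subseteq> m" "m \<noteq> l"
proof -
  have "vec.dim (UNIV :: ('f ^ 4) set) = 4" by (simp only: vec_dim_card) simp
  hence "l \<noteq> UNIV" using assms by (auto simp: pg_lines_def)
  then obtain s where s: "s \<in> pg_points" "\<not> s \<subseteq> l"
    using assms ex_pg_point_outside[of l UNIV] by (auto simp: pg_lines_def)
  show ?thesis
  proof (cases "r = s")
    case True
    have "vec.dim (UNIV :: ('f ^ 4) set) \<ge> 2" using \<open>vec.dim UNIV = 4\<close> by simp
    then obtain m where "m \<in> pg_lines" "r \<subseteq> m"
      using ex_pg_line_in_subspace[of r UNIV] assms by auto
    thus ?thesis using that s True by auto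
  next
    case False
    then obtain m where "m \<in> pg_lines" "r \<subseteq> m" "s \<subseteq> m"
      using pg_line_through[of r s] assms s by metis
    thus ?thesis using that s by blast
  qed
qed

lemma dim_inter_ge:
  fixes S T X :: "('f::field ^ 4) set"
  assumes "vec.subspace S" "vec.subspace T" "vec.subspace X" "S \<subseteq> X" "T \<subseteq> X"
  shows "vec.dim S + vec.dim T \<le> vec.dim X + vec.dim (S \<inter> T)"
proof -
  have "{x + y | x y. x \<in> S \<and> y \<in> T} \<subseteq> X" using assms by (auto intro: vec.subspace_add)
  hence "vec.dim {x + y | x y. x \<in> S \<and> y \<in> T} \<le> vec.dim X" by (rule vec.dim_subset)
  thus ?thesis using vec.dim_sums_Int[OF assms(1,2)] by linarith
qed

lemma coplanar_pg_lines_meet: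
  assumes "l \<in> pg_lines" "m \<in> pg_lines" "\<tau> \<in> pg_planes" "l \<subseteq> \<tau>" "m \<subseteq> \<tau>"
  shows "lines_meet l m"
proof -
  have "vec.dim (l \<inter> m) \<ge> 1"
    using dim_inter_ge[of l m \<tau>] assms by (auto simp: pg_lines_def pg_planes_def)
  moreover have "vec.subspace (l \<inter> m)" using assms by (simp add: pg_lines_def vec.subspace_inter)
  ultimately obtain r where "r \<in> pg_points" "r \<subseteq> l \<inter> m"
    using nontrivial_subspace_contains_point by blast
  thus ?thesis by (auto simp: lines_meet_def)
qed

lemma ex_common_pg_line:
  fixes \<tau> \<pi> :: "('f::field ^ 4) set"
  assumes "\<tau> \<in> pg_planes" "\<pi> \<in> pg_planes"
  obtains m where "m \<in> pg_lines" "m \<subseteq> \<tau>" "m \<subseteq> \<pi>"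
proof -
  have "vec.dim (UNIV :: ('f ^ 4) set) = 4" by (simp only: vec_dim_card) simp
  hence 2: "vec.dim (\<tau> \<inter> \<pi>) \<ge> 2"
    using dim_inter_ge[of \<tau> \<pi> UNIV] assms by (auto simp: pg_planes_def)
  have sub: "vec.subspace (\<tau> \<inter> \<pi>)" using assms by (auto simp: pg_planes_def vec.subspace_inter)
  then obtain r where "r \<in> pg_points" "r \<subseteq> \<tau> \<inter> \<pi>" using 2 nontrivial_subspace_contains_point[of "\<tau> \<inter> \<pi>"] by auto
  then obtain m where "m \<in> pg_lines" "m \<subseteq> \<tau> \<inter> \<pi>" using ex_pg_line_in_subspace sub 2 by metis
  thus ?thesis using that by auto
qed

lemma pg_plane_unique:
  fixes \<tau> \<pi> :: "('f::field ^ 4) set"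
  assumes "\<tau> \<in> pg_planes" "\<pi> \<in> pg_planes" "l \<in> pg_lines" "m \<in> pg_lines" "l \<noteq> m"
    "l \<subseteq> \<tau>" "m \<subseteq> \<tau>" "l \<subseteq> \<pi>" "m \<subseteq> \<pi>"
  shows "\<tau> = \<pi>"
proof -
  have sub: "vec.subspace (\<tau> \<inter> \<pi>)" using assms by (auto simp: pg_planes_def vec.subspace_inter)
  have "vec.dim (\<tau> \<inter> \<pi>) \<ge> 3"
  proof (rule ccontr)
    assume "\<not> ?thesis"
    hence "l = \<tau> \<inter> \<pi>" "m = \<tau> \<inter> \<pi>"
      using assms sub by - (rule vec.subspace_dim_equal; simp add: pg_lines_def)+
    thus False using assms by simp
  qed
  hence "\<tau> \<inter> \<pi> = \<tau>" "\<tau> \<inter> \<pi> = \<pi>"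
    using assms sub by - (rule vec.subspace_dim_equal; simp add: pg_planes_def)+
  thus ?thesis by simp
qed

lemma ex_pg_plane_through:
  fixes l m :: "('f::field ^ 4) set"
  assumes "l \<in> pg_lines" "m \<in> pg_lines" "l \<noteq> m" "lines_meet l m"
  obtains \<tau> where "\<tau> \<in> pg_planes" "l \<subseteq> \<tau>" "m \<subseteq> \<tau>"
proof -
  define \<tau> where "\<tau> = {x + y | x y. x \<in> l \<and> y \<in> m}"
  have sub: "vec.subspace l" "vec.subspace m" "vec.dim l = 2" "vec.dim m = 2"
    using assms by (auto simp: pg_lines_def)
  have \<tau>: "vec.subspace \<tau>" unfolding \<tau>_def using sub by (intro vec.subspace_sums)
  have l: "l \<subseteq> \<tau>" unfolding \<tau>_def using vec.subspace_0[OF sub(2)] by (force intro: exI[of _ 0])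
  have m: "m \<subseteq> \<tau>" unfolding \<tau>_def using vec.subspace_0[OF sub(1)] by (force intro: exI[of _ 0])
  have sum: "vec.dim \<tau> + vec.dim (l \<inter> m) = 4" unfolding \<tau>_def using sub by (subst vec.dim_sums_Int) auto
  obtain r where r: "r \<in> pg_points" "r \<subseteq> l \<inter> m" using assms by (auto simp: lines_meet_def)
  hence "vec.dim (l \<inter> m) \<ge> 1" using vec.dim_subset[of r "l \<inter> m"] by (simp add: pg_points_def)
  moreover have "vec.dim (l \<inter> m) < 2"
  proof (rule ccontr)
    assume "\<not> ?thesis"
    hence "l \<inter> m = l" "l \<inter> m = m"
      using sub by - (rule vec.subspace_dim_equal; simp add: vec.subspace_inter)+
    thus False using assms by simp
  qed
  ultimately have "\<tau> \<in> pg_planes" using sum \<tau> by (simp add: pg_planes_def)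
  thus ?thesis using that l m by blast
qed

text \<open>Let l and m meet in r and span the plane \<tau>. A line of C not through r meets l and m
  in different points, so it lies in \<tau>. If there is such a line, every line of C through r
  meets it in a second point of \<tau> and lies in \<tau> as well.\<close>

lemma pairwise_meeting_pg_lines:
  fixes C :: "('f::field ^ 4) set set"
  assumes C: "C \<subseteq> pg_lines" and meet: "\<And>l m. l \<in> C \<Longrightarrow> m \<in> C \<Longrightarrow> lines_meet l m"
    and "l \<in> C" "m \<in> C" "l \<noteq> m"
  shows "(\<exists>r\<in>pg_points. \<forall>n\<in>C. r \<subseteq> n) \<or> (\<exists>\<tau>\<in>pg_planes. \<forall>n\<in>C. n \<subseteq> \<tau>)"
proof -
  have lm: "l \<in> pg_lines" "m \<in> pg_lines" "lines_meet l m" using assms by auto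
  obtain r where r: "r \<in> pg_points" "r \<subseteq> l" "r \<subseteq> m" using lm by (auto simp: lines_meet_def)
  obtain \<tau> where \<tau>: "\<tau> \<in> pg_planes" "l \<subseteq> \<tau>" "m \<subseteq> \<tau>" using ex_pg_plane_through lm assms(5) by blast
  have \<tau>s: "vec.subspace \<tau>" using \<tau> by (simp add: pg_planes_def)
  have in_\<tau>: "n \<subseteq> \<tau>" if n: "n \<in> C" "\<not> r \<subseteq> n" for n
  proof -
    obtain a where a: "a \<in> pg_points" "a \<subseteq> n" "a \<subseteq> l" using meet[OF n(1) assms(3)] by (auto simp: lines_meet_def)
    obtain b where b: "b \<in> pg_points" "b \<subseteq> n" "b \<subseteq> m" using meet[OF n(1) assms(4)] by (auto simp: lines_meet_def)
    have "a \<noteq> b"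
    proof
      assume "a = b"
      hence "a \<subseteq> l" "a \<subseteq> m" using a b by auto
      moreover have "a \<noteq> r" using n(2) a by auto
      ultimately show False using pg_line_unique[of l m a r] a r lm assms(5) by auto
    qed
    moreover have "n \<in> pg_lines" using n C by auto
    ultimately show ?thesis using pg_line_subset_if_two_points[of n \<tau> a b] a b \<tau> \<tau>s by auto
  qed
  show ?thesis
  proof (cases "\<forall>n\<in>C. r \<subseteq> n")
    case True
    thus ?thesis using r by auto
  next
    case False
    then obtain n0 where n0: "n0 \<in> C" "\<not> r \<subseteq> n0" by auto
    have "n \<subseteq> \<tau>" if n: "n \<in> C" for n
    proof (cases "r \<subseteq> n")
      case True
      obtain c where c: "c \<in> pg_points" "c \<subseteq> n" "c \<subseteq> n0" using meet[OF n n0(1)] by (auto simp: lines_meet_def)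
      have "c \<noteq> r" using c n0 by auto
      moreover have "c \<subseteq> \<tau>" using c in_\<tau>[OF n0] by auto
      moreover have "n \<in> pg_lines" using n C by auto
      ultimately show ?thesis using pg_line_subset_if_two_points[of n \<tau> c r] c r True \<tau> \<tau>s by auto
    qed (use in_\<tau> n in auto)
    thus ?thesis using \<tau> by blast
  qed
qed

lemma card_four_disjoint:
  assumes "A \<noteq> {}" "B \<noteq> {}" "C \<noteq> {}" "D \<noteq> {}"
    "A \<inter> B = {}" "A \<inter> C = {}" "A \<inter> D = {}" "B \<inter> C = {}" "B \<inter> D = {}" "C \<inter> D = {}"
  shows "card {A, B, C, D} = 4" "disjoint {A, B, C, D}"
proof -
  have "A \<noteq> B" "A \<noteq> C" "A \<noteq> D" "B \<noteq> C" "B \<noteq> D" "C \<noteq> D" using assms by auto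
  thus "card {A, B, C, D} = 4" by simp
  show "disjoint {A, B, C, D}" using assms by (auto simp: disjoint_def)
qed

section \<open>The Klein correspondence\<close>

locale klein_quadric = cameron_liebler e q \<alpha> a1
  for e q :: nat and \<alpha> a1 :: "'k::{field,finite}" +
  fixes \<kappa> :: "('k \<times> 'k) set \<Rightarrow> ('f::{field,finite} ^ 4) set" and p \<pi> :: "('f ^ 4) set"
  assumes klein: "klein_correspondence q \<kappa>"
    and p: "p \<in> pg_points" and star_p: "\<kappa> ` gen1 q = star p"
    and \<pi>: "\<pi> \<in> pg_planes" and lines_in_\<pi>: "\<kappa> ` gen2 q = lines_in \<pi>"
begin

lemma bij_\<kappa>: "bij_betw \<kappa> (quadric q) pg_lines"
  using klein by (simp add: klein_correspondence_def)

lemma inj_\<kappa>: "inj_on \<kappa> (quadric q)"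
  using bij_\<kappa> by (simp add: bij_betw_def)

lemma \<kappa>_in_lines: "P \<in> quadric q \<Longrightarrow> \<kappa> P \<in> pg_lines"
  using bij_\<kappa> by (auto simp: bij_betw_def)

lemma \<kappa>_surj: "l \<in> pg_lines \<Longrightarrow> \<exists>P\<in>quadric q. l = \<kappa> P"
  using bij_\<kappa> by (auto simp: bij_betw_def)

lemma \<kappa>_eq_iff: "P \<in> quadric q \<Longrightarrow> R \<in> quadric q \<Longrightarrow> \<kappa> P = \<kappa> R \<longleftrightarrow> P = R"
  using inj_\<kappa> by (auto simp: inj_on_def)

lemma collinear_iff_meet:
  "P \<in> quadric q \<Longrightarrow> R \<in> quadric q \<Longrightarrow> collinear_on_quadric q P R \<longleftrightarrow> lines_meet (\<kappa> P) (\<kappa> R)"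
  using klein by (simp add: klein_correspondence_def)

lemma gen1_iff: "P \<in> quadric q \<Longrightarrow> P \<in> gen1 q \<longleftrightarrow> p \<subseteq> \<kappa> P"
proof
  assume P: "P \<in> quadric q" and "p \<subseteq> \<kappa> P"
  hence "\<kappa> P \<in> \<kappa> ` gen1 q" using star_p \<kappa>_in_lines by (auto simp: star_def)
  then obtain R where "R \<in> gen1 q" "\<kappa> P = \<kappa> R" by auto
  thus "P \<in> gen1 q" using \<kappa>_eq_iff P gen1_subset_quadric by auto
next
  assume "P \<in> gen1 q"
  hence "\<kappa> P \<in> star p" using star_p by auto
  thus "p \<subseteq> \<kappa> P" by (simp add: star_def)
qed

lemma gen2_iff: "P \<in> quadric q \<Longrightarrow> P \<in> gen2 q \<longleftrightarrow> \<kappa> P \<subseteq> \<pi>"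
proof
  assume P: "P \<in> quadric q" and "\<kappa> P \<subseteq> \<pi>"
  hence "\<kappa> P \<in> \<kappa> ` gen2 q" using lines_in_\<pi> \<kappa>_in_lines by (auto simp: lines_in_def)
  then obtain R where "R \<in> gen2 q" "\<kappa> P = \<kappa> R" by auto
  thus "P \<in> gen2 q" using \<kappa>_eq_iff P gen2_subset_quadric by auto
next
  assume "P \<in> gen2 q"
  hence "\<kappa> P \<in> lines_in \<pi>" using lines_in_\<pi> by auto
  thus "\<kappa> P \<subseteq> \<pi>" by (simp add: lines_in_def)
qed

lemma gen1_gen2_disjoint: "gen1 q \<inter> gen2 q = ({} :: ('k \<times> 'k) set set)"
  by (auto simp: gen1_def span_pt_in_gen2_iff)

lemma \<pi>_subspace: "vec.subspace \<pi>" "vec.dim \<pi> = 3"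
  using \<pi> by (auto simp: pg_planes_def)

lemma line_in_\<pi>_through:
  assumes "r \<in> pg_points" "r \<subseteq> \<pi>" obtains P where "P \<in> gen2 q" "r \<subseteq> \<kappa> P"
proof -
  have "vec.dim \<pi> \<ge> 2" using \<pi>_subspace by simp
  then obtain l where "l \<in> pg_lines" "r \<subseteq> l" "l \<subseteq> \<pi>"
    using ex_pg_line_in_subspace assms \<pi>_subspace(1) by metis
  hence "l \<in> \<kappa> ` gen2 q" unfolding lines_in_\<pi> by (simp add: lines_in_def)
  thus ?thesis using that \<open>r \<subseteq> l\<close> by auto
qed

text \<open>Otherwise a line of \<pi> through p would come from both generators, which are
  disjoint.\<close>

lemma p_not_in_\<pi>: "\<not> p \<subseteq> \<pi>"
proof
  assume "p \<subseteq> \<pi>"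
  then obtain P where P: "P \<in> gen2 q" "p \<subseteq> \<kappa> P" using line_in_\<pi>_through p by metis
  hence "P \<in> gen1 q" using gen1_iff gen2_subset_quadric by auto
  thus False using P gen1_gen2_disjoint by auto
qed

section \<open>Stars of points, pulled back to the quadric\<close>

definition K :: "('f ^ 4) set \<Rightarrow> ('k \<times> 'k) set set" where
  "K r = {P \<in> quadric q. r \<subseteq> \<kappa> P}"

lemma K_p: "K p = gen1 q"
  using gen1_iff gen1_subset_quadric by (auto simp: K_def)

lemma K_collinear: "r \<in> pg_points \<Longrightarrow> P \<in> K r \<Longrightarrow> R \<in> K r \<Longrightarrow> collinear_on_quadric q P R"
  using collinear_iff_meet by (auto simp: K_def lines_meet_def)

text \<open>If every line through r also contained another point s, any two lines through r would
  coincide.\<close>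

lemma K_inj:
  assumes r: "r \<in> pg_points" and s: "s \<in> pg_points" and K: "K r \<subseteq> K s"
  shows "r = s"
proof (rule ccontr)
  assume "r \<noteq> s"
  obtain l where l: "l \<in> pg_lines" "r \<subseteq> l"
    using pg_line_through[OF r s \<open>r \<noteq> s\<close>] by metis
  obtain m where m: "m \<in> pg_lines" "r \<subseteq> m" "m \<noteq> l" using ex_other_pg_line r l by metis
  have "s \<subseteq> n" if n: "n \<in> pg_lines" "r \<subseteq> n" for n
  proof -
    obtain P where "P \<in> quadric q" "n = \<kappa> P" using \<kappa>_surj n by auto
    thus ?thesis using n K by (auto simp: K_def)
  qed
  hence "l = m" using l m r s \<open>r \<noteq> s\<close> by (intro pg_line_unique[of l m r s]) auto
  thus False using m by simp
qed

lemma two_in_K_imp_eq: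
  assumes "r \<in> pg_points" "s \<in> pg_points" "P \<in> K r" "P \<in> K s" "R \<in> K r" "R \<in> K s" "P \<noteq> R"
  shows "r = s"
proof (rule ccontr)
  assume "r \<noteq> s"
  hence "\<kappa> P = \<kappa> R" using assms \<kappa>_in_lines by (intro pg_line_unique[of _ _ r s]) (auto simp: K_def)
  thus False using assms \<kappa>_eq_iff by (auto simp: K_def)
qed

lemma clique_cases:
  assumes sub: "A \<subseteq> quadric q" and col: "\<And>P R. P \<in> A \<Longrightarrow> R \<in> A \<Longrightarrow> collinear_on_quadric q P R"
    and PR: "P \<in> A" "R \<in> A" "P \<noteq> R"
  shows "(\<exists>r\<in>pg_points. A \<subseteq> K r) \<or> (\<exists>\<tau>\<in>pg_planes. \<forall>P\<in>A. \<kappa> P \<subseteq> \<tau>)"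
proof -
  have "(\<exists>r\<in>pg_points. \<forall>n\<in>\<kappa> ` A. r \<subseteq> n) \<or> (\<exists>\<tau>\<in>pg_planes. \<forall>n\<in>\<kappa> ` A. n \<subseteq> \<tau>)"
  proof (rule pairwise_meeting_pg_lines[of _ "\<kappa> P" "\<kappa> R"])
    show "\<kappa> P \<noteq> \<kappa> R" using PR sub \<kappa>_eq_iff[of P R] by blast
    show "lines_meet l m" if lm: "l \<in> \<kappa> ` A" "m \<in> \<kappa> ` A" for l m
    proof -
      obtain P R where PR: "P \<in> A" "R \<in> A" "l = \<kappa> P" "m = \<kappa> R" using lm by blast
      hence "P \<in> quadric q" "R \<in> quadric q" using sub by blast+
      thus ?thesis using collinear_iff_meet col[OF PR(1,2)] PR(3,4) by simp
    qed
  qed (use sub PR \<kappa>_in_lines in auto)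
  thus ?thesis
  proof
    assume "\<exists>r\<in>pg_points. \<forall>n\<in>\<kappa> ` A. r \<subseteq> n"
    then obtain r where "r \<in> pg_points" "\<forall>n\<in>\<kappa> ` A. r \<subseteq> n" ..
    moreover from this have "A \<subseteq> K r" using sub by (auto simp: K_def)
    ultimately show ?thesis by blast
  qed simp
qed

lemma W_collinear: "P \<in> W b \<Longrightarrow> R \<in> W b \<Longrightarrow> collinear_on_quadric q P R"
proof -
  assume "P \<in> W b" "R \<in> W b"
  then obtain u v where "P = span_pt q (u, cr u b)" "R = span_pt q (v, cr v b)" by (auto simp: W_def)
  moreover have "Tr q (u * cr v b + v * cr u b) = 0" by (simp add: Tr_add Tr_mult_cr_swap[of u])
  ultimately show ?thesis by (simp add: collinear_span_pt_iff Tr_mult_cr_left)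
qed

text \<open>Collinearity with all points of \<open>W b\<close> says that v0 - cr u0 b is orthogonal
  to every u, so it is zero by nondegeneracy of the trace form.\<close>

lemma W_maximal:
  assumes P: "P \<in> quadric q" and col: "\<And>R. R \<in> W b \<Longrightarrow> collinear_on_quadric q P R"
  shows "P \<in> W b"
proof -
  obtain u0 v0 where uv: "(u0, v0) \<noteq> (0, 0)" "Tr q (u0 * v0) = 0" "P = span_pt q (u0, v0)"
    using P by (auto simp: quadric_def quad_form_def)
  have "Tr q (u * (v0 - cr u0 b)) = 0" for u
  proof (cases "u = 0")
    case False
    hence "collinear_on_quadric q P (span_pt q (u, cr u b))" by (intro col) (auto simp: W_def)
    hence "Tr q (u0 * cr u b + u * v0) = 0"
      unfolding uv(3) using uv(2) by (simp only: collinear_span_pt_iff Tr_mult_cr_left)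
    thus ?thesis using Tr_mult_cr_swap[of u0 u b] by (simp add: Tr_add Tr_diff right_diff_distrib)
  qed (use Tr_F[of 0] in simp)
  hence "v0 - cr u0 b = 0" by (rule Tr_nondegenerate)
  thus ?thesis using span_pt_in_W_iff[OF uv(1), of b] uv(3) by simp
qed

lemma ex_cr_nonzero: "b \<noteq> 0 \<Longrightarrow> \<exists>u. cr u b \<noteq> 0"
proof -
  assume b: "b \<noteq> 0"
  have "q ^ 1 < q ^ 3" using q_ge_9 by (intro power_strict_increasing) auto
  hence "card {u. cr u b \<noteq> 0} \<noteq> 0" using card_cr_nonzero[OF b] by simp
  thus ?thesis by (auto simp: card_eq_0_iff)
qed

text \<open>The lines of a clique are concurrent or coplanar. If those of \<open>W b\<close> lay in
  a plane, it would share a line with \<pi>, given by some (0, y); being collinear with all of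
  \<open>W b\<close> forces Tr (x * y) = 0 for all x, hence y = 0. So the lines pass through a
  common point r, and maximality gives equality with the whole star.\<close>

lemma W_star:
  assumes b: "b \<noteq> 0"
  obtains r where "r \<in> pg_points" "r \<noteq> p" "\<not> r \<subseteq> \<pi>" "K r = W b"
proof -
  obtain u where u: "cr u b \<noteq> 0" using ex_cr_nonzero b by blast
  hence u0: "u \<noteq> 0" by auto
  have in_W: "span_pt q (b, 0) \<in> W b" "span_pt q (u, cr u b) \<in> W b"
    using b u0 by (auto simp: span_pt_in_W_iff)
  have not_gen1: "span_pt q (u, cr u b) \<notin> gen1 q" "span_pt q (b, 0) \<in> gen1 q"
    using u u0 b by (auto simp: span_pt_in_gen1_iff)
  hence neq: "span_pt q (b, 0) \<noteq> span_pt q (u, cr u b)" by metis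
  have "\<not> (\<exists>\<tau>\<in>pg_planes. \<forall>P\<in>W b. \<kappa> P \<subseteq> \<tau>)"
  proof
    assume "\<exists>\<tau>\<in>pg_planes. \<forall>P\<in>W b. \<kappa> P \<subseteq> \<tau>"
    then obtain \<tau> where \<tau>: "\<tau> \<in> pg_planes" "\<And>P. P \<in> W b \<Longrightarrow> \<kappa> P \<subseteq> \<tau>" by auto
    obtain m where m: "m \<in> pg_lines" "m \<subseteq> \<tau>" "m \<subseteq> \<pi>" using ex_common_pg_line \<tau> \<pi> by metis
    hence "m \<in> \<kappa> ` gen2 q" unfolding lines_in_\<pi> by (simp add: lines_in_def)
    then obtain y where y: "y \<noteq> 0" "m = \<kappa> (span_pt q (0, y))" by (auto simp: gen2_def)
    have yQ: "span_pt q (0, y) \<in> quadric q" using y gen2_subset_quadric by (auto simp: gen2_def)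
    have "Tr q (x * y) = 0" for x
    proof (cases "x = 0")
      case False
      hence xW: "span_pt q (x, cr x b) \<in> W b" by (auto simp: W_def)
      hence xQ: "span_pt q (x, cr x b) \<in> quadric q" using W_subset_quadric by auto
      have "lines_meet (\<kappa> (span_pt q (x, cr x b))) m"
        using \<kappa>_in_lines[OF xQ] m \<tau> xW by (intro coplanar_pg_lines_meet[of _ _ \<tau>]) auto
      hence "collinear_on_quadric q (span_pt q (x, cr x b)) (span_pt q (0, y))"
        using collinear_iff_meet[OF xQ yQ] y by simp
      hence "Tr q (x * y + 0 * cr x b) = 0"
        by (subst (asm) collinear_span_pt_iff) (auto simp: Tr_mult_cr_left Tr_F)
      thus ?thesis by simp
    qed (use Tr_F[of 0] in simp)
    hence "y = 0" by (rule Tr_nondegenerate)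
    thus False using y by simp
  qed
  moreover have "(\<exists>r\<in>pg_points. W b \<subseteq> K r) \<or> (\<exists>\<tau>\<in>pg_planes. \<forall>P\<in>W b. \<kappa> P \<subseteq> \<tau>)"
    by (rule clique_cases[OF W_subset_quadric _ in_W neq]) (rule W_collinear)
  ultimately have "\<exists>r\<in>pg_points. W b \<subseteq> K r" by argo
  then obtain r where r: "r \<in> pg_points" "W b \<subseteq> K r" ..
  have "K r \<subseteq> W b"
  proof
    fix P assume P: "P \<in> K r"
    show "P \<in> W b"
    proof (rule W_maximal)
      show "P \<in> quadric q" using P by (simp add: K_def)
      show "collinear_on_quadric q P R" if "R \<in> W b" for R
        using K_collinear[OF r(1) P] r(2) that by auto
    qed
  qed
  hence K: "K r = W b" using r by auto
  moreover have "r \<noteq> p" using K K_p in_W not_gen1 by auto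
  moreover have "\<not> r \<subseteq> \<pi>"
  proof
    assume "r \<subseteq> \<pi>"
    then obtain P where "P \<in> gen2 q" "r \<subseteq> \<kappa> P" using line_in_\<pi>_through r by metis
    hence "P \<in> W b \<inter> gen2 q" using K gen2_subset_quadric by (auto simp: K_def)
    thus False using W_inter_gen2 by auto
  qed
  ultimately show ?thesis using that r by blast
qed

lemma V_collinear:
  assumes x: "x \<noteq> 0" and P: "P \<in> V x" and R: "R \<in> V x" shows "collinear_on_quadric q P R"
proof -
  obtain s y where sy: "s \<in> F" "Tr q (x * y) = 0" "P = span_pt q (s * x, y)"
    using P by (auto simp: V_def)
  obtain t z where tz: "t \<in> F" "Tr q (x * z) = 0" "R = span_pt q (t * x, z)"
    using R by (auto simp: V_def)
  have "Tr q (s * x * y) = 0" "Tr q (t * x * z) = 0" "Tr q (s * x * z) = 0" "Tr q (t * x * y) = 0"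
    using sy tz by (simp_all add: mult.assoc Tr_scale)
  thus ?thesis unfolding sy tz by (simp add: collinear_span_pt_iff Tr_add)
qed

text \<open>Testing against (x, 0) gives the trace condition on v0; testing against the points (0,
  cr x w) shows that cr u0 x is orthogonal to everything, so u0 is a multiple of x.\<close>

lemma V_maximal:
  assumes x: "x \<noteq> 0" and P: "P \<in> quadric q" and col: "\<And>R. R \<in> V x \<Longrightarrow> collinear_on_quadric q P R"
  shows "P \<in> V x"
proof -
  obtain u0 v0 where uv: "(u0, v0) \<noteq> (0, 0)" "Tr q (u0 * v0) = 0" "P = span_pt q (u0, v0)"
    using P by (auto simp: quadric_def quad_form_def)
  have "span_pt q (x, 0) \<in> V x" using V_inter_gen1[OF x] by auto
  hence "collinear_on_quadric q P (span_pt q (x, 0))" by (rule col)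
  hence 1: "Tr q (x * v0) = 0"
    unfolding uv(3) using uv(2) Tr_F[of 0] by (simp add: collinear_span_pt_iff)
  have "Tr q (w * cr u0 x) = 0" for w
  proof (cases "cr x w = 0")
    case True
    have "Tr q (w * cr u0 x) = Tr q (u0 * cr x w)"
      by (simp add: Tr_eq cr_def power_mult_distrib frob_diff algebra_simps)
    thus ?thesis using True Tr_F[of 0] by simp
  next
    case False
    hence "span_pt q (0, cr x w) \<in> V x"
      using x by (subst span_pt_in_V_iff) (auto simp: Tr_mult_cr_left intro!: bexI[of _ 0])
    hence "collinear_on_quadric q P (span_pt q (0, cr x w))" by (rule col)
    hence "Tr q (u0 * cr x w) = 0"
      unfolding uv(3) using uv(2) Tr_F[of 0] by (simp add: collinear_span_pt_iff)
    moreover have "Tr q (w * cr u0 x) = Tr q (u0 * cr x w)"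
      by (simp add: Tr_eq cr_def power_mult_distrib frob_diff algebra_simps)
    ultimately show ?thesis by simp
  qed
  hence "cr u0 x = 0" by (rule Tr_nondegenerate)
  hence "\<exists>s\<in>F. u0 = s * x" using cr_eq_0_iff[OF x] cr_eq_0_swap by metis
  thus ?thesis using span_pt_in_V_iff[OF uv(1) x] uv(3) 1 by simp
qed

text \<open>\<open>V x\<close> has at least two points in \<open>gen2\<close>, so a plane containing
  all its lines would be \<pi>; but the line of (x, 0) passes through p and is not in \<pi>. The two
  points in \<open>gen2\<close> also give that the common point is in \<pi>.\<close>

lemma V_star:
  assumes x: "x \<noteq> 0"
  obtains r where "r \<in> pg_points" "r \<subseteq> \<pi>" "K r = V x"
proof -
  have sub: "V x \<subseteq> quadric q" using V_subset_quadric x by auto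
  have "card (V x \<inter> gen2 q) \<ge> 2"
  proof (rule ccontr)
    assume "\<not> ?thesis"
    hence "card (V x \<inter> gen2 q) * (q - 1) \<le> 1 * (q - 1)" by (intro mult_right_mono) auto
    hence "q\<^sup>2 - 1 \<le> q - 1" unfolding card_V_inter_gen2[OF x] by (simp only: mult_1)
    moreover have "q < q\<^sup>2" using q_ge_9 by (simp add: power2_eq_square)
    ultimately show False using q_ge_9 by linarith
  qed
  hence "\<not> (\<forall>Y1\<in>V x \<inter> gen2 q. \<forall>Y2\<in>V x \<inter> gen2 q. Y1 = Y2)"
    using card_le_Suc0_iff_eq[of "V x \<inter> gen2 q"] by simp
  then obtain Y1 Y2 where Y: "Y1 \<in> V x" "Y1 \<in> gen2 q" "Y2 \<in> V x" "Y2 \<in> gen2 q" "Y1 \<noteq> Y2"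
    by blast
  have YQ: "Y1 \<in> quadric q" "Y2 \<in> quadric q" using Y sub by blast+
  have \<kappa>Y: "\<kappa> Y1 \<in> pg_lines" "\<kappa> Y2 \<in> pg_lines" "\<kappa> Y1 \<subseteq> \<pi>" "\<kappa> Y2 \<subseteq> \<pi>" "\<kappa> Y1 \<noteq> \<kappa> Y2"
    using \<kappa>_in_lines[OF YQ(1)] \<kappa>_in_lines[OF YQ(2)] gen2_iff[OF YQ(1)] gen2_iff[OF YQ(2)]
      \<kappa>_eq_iff[OF YQ] Y by simp_all
  have xV: "span_pt q (x, 0) \<in> V x" "span_pt q (x, 0) \<in> gen1 q" using V_inter_gen1[OF x] by auto
  have "\<not> (\<exists>\<tau>\<in>pg_planes. \<forall>P\<in>V x. \<kappa> P \<subseteq> \<tau>)"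
  proof
    assume "\<exists>\<tau>\<in>pg_planes. \<forall>P\<in>V x. \<kappa> P \<subseteq> \<tau>"
    then obtain \<tau> where \<tau>: "\<tau> \<in> pg_planes" "\<And>P. P \<in> V x \<Longrightarrow> \<kappa> P \<subseteq> \<tau>" by auto
    hence "\<tau> = \<pi>" using \<kappa>Y Y \<pi> by (intro pg_plane_unique[of \<tau> \<pi> "\<kappa> Y1" "\<kappa> Y2"]) auto
    hence "span_pt q (x, 0) \<in> gen2 q" using \<tau>(2)[OF xV(1)] gen2_iff sub xV by auto
    thus False using xV gen1_gen2_disjoint by auto
  qed
  moreover have "(\<exists>r\<in>pg_points. V x \<subseteq> K r) \<or> (\<exists>\<tau>\<in>pg_planes. \<forall>P\<in>V x. \<kappa> P \<subseteq> \<tau>)"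
    by (rule clique_cases[OF sub _ Y(1,3,5)]) (rule V_collinear[OF x])
  ultimately have "\<exists>r\<in>pg_points. V x \<subseteq> K r" by argo
  then obtain r where r: "r \<in> pg_points" "V x \<subseteq> K r" ..
  have "K r \<subseteq> V x"
  proof
    fix P assume P: "P \<in> K r"
    show "P \<in> V x"
    proof (rule V_maximal[OF x])
      show "P \<in> quadric q" using P by (simp add: K_def)
      show "collinear_on_quadric q P R" if "R \<in> V x" for R
        using K_collinear[OF r(1) P] r(2) that by auto
    qed
  qed
  hence "K r = V x" using r(2) by (rule subset_antisym)
  moreover have "r \<subseteq> \<pi>"
  proof -
    have "Y1 \<in> K r" using Y(1) r(2) by (rule subsetD[rotated])
    hence "r \<subseteq> \<kappa> Y1" by (simp add: K_def)
    thus ?thesis using \<kappa>Y(3) by (rule subset_trans)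
  qed
  ultimately show ?thesis using that[of r] r(1) by simp
qed

lemma line_through_p:
  assumes r: "r \<in> pg_points" "r \<noteq> p"
  obtains x where "x \<noteq> 0" "span_pt q (x, 0) \<in> K r"
proof -
  obtain l where l: "l \<in> pg_lines" "r \<subseteq> l" "p \<subseteq> l" using pg_line_through r p by metis
  hence "l \<in> \<kappa> ` gen1 q" unfolding star_p by (simp add: star_def)
  then obtain x where x: "x \<noteq> 0" "l = \<kappa> (span_pt q (x, 0))" by (auto simp: gen1_def)
  moreover have "span_pt q (x, 0) \<in> quadric q" using x gen1_subset_quadric by (auto simp: gen1_def)
  ultimately show ?thesis using that l by (auto simp: K_def)
qed

lemma unique_point_on_\<pi>:
  assumes "r \<in> pg_points" "r \<subseteq> \<pi>" "s \<in> pg_points" "s \<subseteq> \<pi>" "P \<in> K r" "P \<in> K s" "P \<notin> gen2 q"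
  shows "r = s"
proof (rule ccontr)
  assume "r \<noteq> s"
  have P: "P \<in> quadric q" "r \<subseteq> \<kappa> P" "s \<subseteq> \<kappa> P" using assms(5,6) by (simp_all add: K_def)
  have "\<kappa> P \<subseteq> \<pi>"
    by (rule pg_line_subset_if_two_points[OF \<kappa>_in_lines[OF P(1)] \<pi>_subspace(1) assms(1,3) \<open>r \<noteq> s\<close> P(2,3) assms(2,4)])
  thus False using assms(7) gen2_iff[OF P(1)] by simp
qed

text \<open>The line joining p to r belongs to some (x, 0). It also contains the point with star
  \<open>V x\<close>, and a line not in \<pi> has at most one point in \<pi>.\<close>

lemma ex_V:
  assumes r: "r \<in> pg_points" "r \<subseteq> \<pi>"
  obtains x where "x \<noteq> 0" "K r = V x"
proof -
  have "r \<noteq> p" using r p_not_in_\<pi> by auto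
  then obtain x where x: "x \<noteq> 0" "span_pt q (x, 0) \<in> K r" using line_through_p r by metis
  obtain s where s: "s \<in> pg_points" "s \<subseteq> \<pi>" "K s = V x" using V_star x by metis
  have xV: "span_pt q (x, 0) \<in> V x" "span_pt q (x, 0) \<in> gen1 q" using V_inter_gen1[OF x(1)] by auto
  hence "span_pt q (x, 0) \<notin> gen2 q" using gen1_gen2_disjoint by auto
  hence "r = s" using unique_point_on_\<pi> r s x xV by metis
  thus ?thesis using that x s by blast
qed

text \<open>A point is determined by two lines through it. One is the line to p, given by (x, 0);
  for a second one (u, v), orthogonality of v to u and x makes v a multiple of cr u x, unless that
  product vanishes, in which case r would be the point of \<pi> with star
  \<open>V x\<close>.\<close>

lemma ex_W:
  assumes r: "r \<in> pg_points" "r \<noteq> p" "\<not> r \<subseteq> \<pi>"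
  obtains b where "b \<noteq> 0" "K r = W b"
proof -
  obtain x where x: "x \<noteq> 0" "span_pt q (x, 0) \<in> K r" using line_through_p r by metis
  have xQ: "span_pt q (x, 0) \<in> quadric q" using x by (simp add: K_def)
  have x1: "span_pt q (x, 0) \<in> gen1 q" using x by (auto simp: gen1_def)
  obtain m where m: "m \<in> pg_lines" "r \<subseteq> m" "m \<noteq> \<kappa> (span_pt q (x, 0))"
    using ex_other_pg_line[OF r(1) \<kappa>_in_lines[OF xQ]] by metis
  obtain P where P: "P \<in> quadric q" "m = \<kappa> P" using \<kappa>_surj m by auto
  have PK: "P \<in> K r" using P m by (simp add: K_def)
  have Pneq: "P \<noteq> span_pt q (x, 0)" using P m by auto
  have "P \<notin> gen1 q"
  proof
    assume "P \<in> gen1 q"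
    hence "r = p" using two_in_K_imp_eq[OF r(1) p PK _ x(2) _ Pneq] x1 K_p by auto
    thus False using r by simp
  qed
  moreover have "P \<notin> gen2 q"
    using PK gen2_iff[OF P(1)] r(3) by (auto simp: K_def)
  ultimately have "\<exists>u v. admissible u v \<and> P = span_pt q (u, v)"
    by (cases rule: quadric_cases[OF P(1)]) (auto simp: gen1_def gen2_def)
  then obtain u v where uv: "admissible u v" "P = span_pt q (u, v)" by blast
  have uv': "u \<noteq> 0" "v \<noteq> 0" "Tr q (u * v) = 0" using uv by (auto simp: admissible_def)
  have "collinear_on_quadric q (span_pt q (x, 0)) P" using K_collinear r(1) x(2) PK by auto
  hence xv: "Tr q (x * v) = 0"
    unfolding uv(2) using uv' Tr_F[of 0] by (simp add: collinear_span_pt_iff)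
  have "cr u x \<noteq> 0"
  proof
    assume "cr u x = 0"
    hence "\<exists>s\<in>F. u = s * x" using cr_eq_0_iff[OF x(1)] cr_eq_0_swap by metis
    hence PV: "P \<in> V x" using xv uv uv' x span_pt_in_V_iff[of u v x] by simp
    obtain s where s: "s \<in> pg_points" "s \<subseteq> \<pi>" "K s = V x" using V_star x by metis
    have "span_pt q (x, 0) \<in> V x" using V_inter_gen1[OF x(1)] by auto
    hence "r = s" using two_in_K_imp_eq[OF r(1) s(1) PK _ x(2) _ Pneq] s PV by auto
    thus False using r s by simp
  qed
  then obtain s where s: "s \<in> F" "v = s * cr u x" using orthogonal_imp_multiple_cr uv' xv by metis
  \<comment> \<open>This b satisfies cr u b = v and cr x b = 0, so both chosen lines lie in
    \<open>W b\<close>.\<close>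
  define b where "b = s * x"
  have b: "b \<noteq> 0" "v = cr u b" using s uv' x by (auto simp: b_def cr_scale_right)
  have "cr x b = 0" using s by (simp add: b_def cr_scale_right)
  hence W: "P \<in> W b" "span_pt q (x, 0) \<in> W b"
    using b uv uv' x by (auto simp: span_pt_in_W_iff)
  obtain t where t: "t \<in> pg_points" "K t = W b" using W_star b by metis
  have "r = t" using two_in_K_imp_eq[OF r(1) t(1) PK _ x(2) _ Pneq] t W by auto
  thus ?thesis using that b t by blast
qed

lemma card_lines_through:
  assumes "T \<subseteq> quadric q"
  shows "card {l \<in> \<kappa> ` T. r \<subseteq> l} = card (K r \<inter> T)"
proof -
  have "{l \<in> \<kappa> ` T. r \<subseteq> l} = \<kappa> ` (K r \<inter> T)" using assms by (auto simp: K_def)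
  moreover have "inj_on \<kappa> (K r \<inter> T)" using assms by (intro inj_on_subset[OF inj_\<kappa>]) auto
  ultimately show ?thesis by (simp add: card_image)
qed

lemma card_star_inter:
  assumes "T \<subseteq> quadric q"
  shows "card (star r \<inter> \<kappa> ` T) = card (K r \<inter> T)"
proof -
  have "star r \<inter> \<kappa> ` T = {l \<in> \<kappa> ` T. r \<subseteq> l}"
    using assms \<kappa>_in_lines by (auto simp: star_def)
  thus ?thesis using card_lines_through[OF assms] by simp
qed

section \<open>The point classes\<close>

lemma W_inj:
  assumes "W b = W b'" shows "b = b'"
proof (rule ccontr)
  assume "b \<noteq> b'"
  then obtain u where u: "cr u (b - b') \<noteq> 0" using ex_cr_nonzero[of "b - b'"] by auto
  hence "u \<noteq> 0" by auto
  hence "span_pt q (u, cr u b) \<in> W b'" unfolding assms[symmetric] by (auto simp: W_def)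
  hence "cr u b = cr u b'" using \<open>u \<noteq> 0\<close> span_pt_in_W_iff[of u "cr u b" b'] by simp
  thus False using u by (simp add: cr_diff_right)
qed

text \<open>The classes are first defined through \<open>sg (eta b)\<close>; \<open>PP_eq\<close>
  identifies them by star counts. Which sign belongs to the smaller count depends on the sign of
  \<open>\<gamma>\<close>.\<close>

definition PP :: "real \<Rightarrow> ('f ^ 4) set set" where
  "PP s = {r \<in> pg_points. \<exists>b. b \<noteq> 0 \<and> K r = W b \<and> sg (eta b) = s}"

lemma PP_props:
  assumes "r \<in> PP s" shows "r \<noteq> p" "\<not> r \<subseteq> \<pi>"
proof -
  obtain b where b: "r \<in> pg_points" "b \<noteq> 0" "K r = W b" using assms by (auto simp: PP_def)
  obtain t where t: "t \<in> pg_points" "t \<noteq> p" "\<not> t \<subseteq> \<pi>" "K t = W b" using W_star b by metis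
  have "r = t" using b t by (intro K_inj) auto
  thus "r \<noteq> p" "\<not> r \<subseteq> \<pi>" using t by auto
qed

lemma pg_point_cases:
  assumes "r \<in> pg_points"
  obtains "r = p" | "r \<in> points_in \<pi>" | "r \<in> PP 1" | "r \<in> PP (-1)"
proof -
  consider "r = p" | "r \<subseteq> \<pi>" | "r \<noteq> p" "\<not> r \<subseteq> \<pi>" by blast
  thus ?thesis
  proof cases
    case 2
    thus ?thesis using that assms by (auto simp: points_in_def)
  next
    case 3
    then obtain b where "b \<noteq> 0" "K r = W b" using ex_W assms by metis
    thus ?thesis using that assms sg_eta_cases[of b] by (auto simp: PP_def)
  qed (use that in auto)
qed

lemma PP_nonempty: "s = 1 \<or> s = - 1 \<Longrightarrow> PP s \<noteq> {}"
proof -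
  assume "s = 1 \<or> s = - 1"
  then obtain b where b: "b \<noteq> 0" "sg (eta b) = s" using ex_sg by blast
  obtain r where "r \<in> pg_points" "K r = W b" using W_star b by metis
  thus ?thesis using b by (auto simp: PP_def)
qed

lemma PP_disjoint: "s \<noteq> t \<Longrightarrow> PP s \<inter> PP t = {}"
proof -
  assume "s \<noteq> t"
  have False if r: "r \<in> PP s" "r \<in> PP t" for r
  proof -
    obtain b where b: "K r = W b" "sg (eta b) = s" using r(1) by (auto simp: PP_def)
    obtain c where c: "K r = W c" "sg (eta c) = t" using r(2) by (auto simp: PP_def)
    have "b = c" using b(1) c(1) by (intro W_inj) simp
    thus False using b c \<open>s \<noteq> t\<close> by simp
  qed
  thus ?thesis by blast
qed

lemma points_in_\<pi>_nonempty: "points_in \<pi> \<noteq> {}"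
proof -
  obtain r where "r \<in> pg_points" "r \<subseteq> \<pi>" using V_star[of 1] by (metis zero_neq_one)
  thus ?thesis by (auto simp: points_in_def)
qed

section \<open>Points on a line\<close>

lemma card_PP_on_line:
  assumes P: "P \<in> quadric q"
  shows "card {r \<in> PP s. r \<subseteq> \<kappa> P} = card {b. b \<noteq> 0 \<and> P \<in> W b \<and> sg (eta b) = s}"
proof -
  have "\<forall>b. \<exists>r. b \<noteq> 0 \<longrightarrow> r \<in> pg_points \<and> K r = W b" using W_star by metis
  then obtain f where f: "\<And>b. b \<noteq> 0 \<Longrightarrow> f b \<in> pg_points" "\<And>b. b \<noteq> 0 \<Longrightarrow> K (f b) = W b" by metis
  have "bij_betw f {b. b \<noteq> 0 \<and> P \<in> W b \<and> sg (eta b) = s} {r \<in> PP s. r \<subseteq> \<kappa> P}"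
    unfolding bij_betw_def
  proof (intro conjI equalityI subsetI inj_onI)
    fix b b' assume "b \<in> {b. b \<noteq> 0 \<and> P \<in> W b \<and> sg (eta b) = s}"
      "b' \<in> {b. b \<noteq> 0 \<and> P \<in> W b \<and> sg (eta b) = s}" "f b = f b'"
    thus "b = b'" using f(2)[of b] f(2)[of b'] W_inj by simp
  next
    fix r assume "r \<in> f ` {b. b \<noteq> 0 \<and> P \<in> W b \<and> sg (eta b) = s}"
    then obtain b where b: "b \<noteq> 0" "P \<in> W b" "sg (eta b) = s" "r = f b" by blast
    have "P \<in> K r" using b f(2)[of b] by simp
    thus "r \<in> {r \<in> PP s. r \<subseteq> \<kappa> P}" using b f[of b] by (auto simp: PP_def K_def)
  next
    fix r assume r: "r \<in> {r \<in> PP s. r \<subseteq> \<kappa> P}"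
    then obtain b where b: "r \<in> pg_points" "b \<noteq> 0" "K r = W b" "sg (eta b) = s" by (auto simp: PP_def)
    have "r = f b" using b f[of b] by (intro K_inj) auto
    moreover have "P \<in> W b" using r P b(3) by (auto simp: K_def)
    ultimately show "r \<in> f ` {b. b \<noteq> 0 \<and> P \<in> W b \<and> sg (eta b) = s}" using b by blast
  qed
  thus ?thesis by (simp add: bij_betw_same_card)
qed

lemma card_PP_on_gen1_line:
  assumes "P \<in> gen1 q" "s = 1 \<or> s = - 1"
  shows "2 * card {r \<in> PP s. r \<subseteq> \<kappa> P} = q - 1"
proof -
  obtain x where x: "x \<noteq> 0" "P = span_pt q (x, 0)" using assms by (auto simp: gen1_def)
  have "P \<in> W b \<longleftrightarrow> cr x b = 0" for b using x span_pt_in_W_iff[of x 0 b] by auto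
  thus ?thesis
    using card_PP_on_line[of P s] card_multiples_sg[OF x(1) assms(2)] assms(1) gen1_subset_quadric by auto
qed

lemma card_PP_on_gen2_line:
  assumes "P \<in> gen2 q"
  shows "card {r \<in> PP s. r \<subseteq> \<kappa> P} = 0"
proof -
  have "{b. b \<noteq> 0 \<and> P \<in> W b \<and> sg (eta b) = s} = {}" using assms W_inter_gen2 by auto
  moreover have "P \<in> quadric q" using assms gen2_subset_quadric by blast
  ultimately show ?thesis using card_PP_on_line[of P s] by (simp only: card.empty)
qed

lemma card_PP_on_admissible_line:
  assumes uv: "admissible u v" and s: "s = 1 \<or> s = - 1"
  shows "2 * real (card {r \<in> PP s. r \<subseteq> \<kappa> (span_pt q (u, v))}) = real q + s * sg (Phi u v)"
proof -
  have uv': "u \<noteq> 0" "v \<noteq> 0" "Tr q (u * v) = 0" using uv by (auto simp: admissible_def)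
  have "b \<noteq> 0 \<and> span_pt q (u, v) \<in> W b \<longleftrightarrow> cr u b = v" for b
    using uv' span_pt_in_W_iff[of u v b] by auto
  hence "{b. b \<noteq> 0 \<and> span_pt q (u, v) \<in> W b \<and> sg (eta b) = s} = {b. cr u b = v \<and> sg (eta b) = s}"
    by (simp add: conj_assoc[symmetric])
  moreover have "span_pt q (u, v) \<in> quadric q" using uv' by (intro span_pt_in_quadric) auto
  ultimately show ?thesis using card_PP_on_line card_solutions_cr[OF uv s] by simp
qed

lemma card_\<pi>_on_line:
  assumes P: "P \<in> quadric q" "P \<notin> gen2 q"
  shows "card {r \<in> points_in \<pi>. r \<subseteq> \<kappa> P} = 1"
proof -
  obtain u v where uv: "(u, v) \<noteq> (0, 0)" "Tr q (u * v) = 0" "P = span_pt q (u, v)"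
    using P by (auto simp: quadric_def quad_form_def)
  have u: "u \<noteq> 0" using uv P span_pt_in_gen2_iff[of u v] by auto
  obtain r where r: "r \<in> pg_points" "r \<subseteq> \<pi>" "K r = V u" using V_star u by metis
  have "P \<in> K r"
    unfolding r(3) uv(3) using u uv by (subst span_pt_in_V_iff) (auto intro!: bexI[of _ 1])
  have "s = r" if "s \<in> points_in \<pi>" "s \<subseteq> \<kappa> P" for s
  proof -
    have "s \<in> pg_points" "s \<subseteq> \<pi>" "P \<in> K s" using that P(1) by (simp_all add: points_in_def K_def)
    thus ?thesis using unique_point_on_\<pi> r(1,2) \<open>P \<in> K r\<close> P(2) by blast
  qed
  moreover have "r \<in> points_in \<pi>" using r by (simp add: points_in_def)
  moreover have "r \<subseteq> \<kappa> P" using \<open>P \<in> K r\<close> by (simp add: K_def)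
  ultimately have "{s \<in> points_in \<pi>. s \<subseteq> \<kappa> P} = {r}" by blast
  thus ?thesis by simp
qed

lemma card_\<pi>_on_gen2_line:
  assumes P: "P \<in> gen2 q"
  shows "card {r \<in> points_in \<pi>. r \<subseteq> \<kappa> P} * (q - 1) = q\<^sup>2 - 1"
proof -
  obtain y where y: "y \<noteq> 0" "P = span_pt q (0, y)" using P by (auto simp: gen2_def)
  have PQ: "P \<in> quadric q" using P gen2_subset_quadric by auto
  have PV: "P \<in> V x \<longleftrightarrow> Tr q (x * y) = 0" if "x \<noteq> 0" for x
    using that y span_pt_in_V_iff[of 0 y x] by (auto intro!: bexI[of _ 0])
  \<comment> \<open>The line joining r to p. Points of \<pi> are counted through these lines, whose
    coordinates x are constrained by Tr (x * y) = 0.\<close>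
  define h where "h r = the_elem (K r \<inter> gen1 q)" for r
  have h: "h r = span_pt q (x, 0)" if "x \<noteq> 0" "K r = V x" for r x
    using that by (simp add: h_def V_inter_gen1)
  have inj: "inj_on h {r \<in> points_in \<pi>. r \<subseteq> \<kappa> P}"
  proof (rule inj_onI)
    fix r s assume rs: "r \<in> {r \<in> points_in \<pi>. r \<subseteq> \<kappa> P}" "s \<in> {r \<in> points_in \<pi>. r \<subseteq> \<kappa> P}" "h r = h s"
    hence rs': "r \<in> pg_points" "r \<subseteq> \<pi>" "s \<in> pg_points" "s \<subseteq> \<pi>" by (auto simp: points_in_def)
    obtain x where x: "x \<noteq> 0" "K r = V x" using ex_V rs'(1,2) by metis
    obtain z where z: "z \<noteq> 0" "K s = V z" using ex_V rs'(3,4) by metis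
    have "h r \<in> K r" "h r \<in> gen1 q" using x h V_inter_gen1[OF x(1)] by auto
    moreover have "h r \<in> K s" unfolding rs(3) using z h V_inter_gen1[OF z(1)] by auto
    moreover have "h r \<notin> gen2 q" using calculation gen1_gen2_disjoint by auto
    ultimately show "r = s" using unique_point_on_\<pi>[OF rs'] by blast
  qed
  have im: "h ` {r \<in> points_in \<pi>. r \<subseteq> \<kappa> P} = {X. \<exists>x. x \<noteq> 0 \<and> X = span_pt q (x, 0) \<and> Tr q (x * y) = 0}"
  proof (intro equalityI subsetI)
    fix X assume "X \<in> h ` {r \<in> points_in \<pi>. r \<subseteq> \<kappa> P}"
    then obtain r where r: "r \<in> pg_points" "r \<subseteq> \<pi>" "r \<subseteq> \<kappa> P" "X = h r" by (auto simp: points_in_def)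
    obtain x where x: "x \<noteq> 0" "K r = V x" using ex_V r(1,2) by metis
    have "P \<in> V x" unfolding x(2)[symmetric] using r PQ by (simp add: K_def)
    thus "X \<in> {X. \<exists>x. x \<noteq> 0 \<and> X = span_pt q (x, 0) \<and> Tr q (x * y) = 0}"
      using x r h[OF x] PV[OF x(1)] by blast
  next
    fix X assume "X \<in> {X. \<exists>x. x \<noteq> 0 \<and> X = span_pt q (x, 0) \<and> Tr q (x * y) = 0}"
    then obtain x where x: "x \<noteq> 0" "X = span_pt q (x, 0)" "Tr q (x * y) = 0" by blast
    obtain r where r: "r \<in> pg_points" "r \<subseteq> \<pi>" "K r = V x" using V_star x by metis
    have "P \<in> K r" using r x PV by simp
    thus "X \<in> h ` {r \<in> points_in \<pi>. r \<subseteq> \<kappa> P}"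
      using r x h[OF x(1) r(3)] by (intro image_eqI[of _ _ r]) (auto simp: points_in_def K_def)
  qed
  show ?thesis
    unfolding card_image[OF inj, symmetric] im by (rule card_gen1_orthogonal[OF y(1)])
qed

lemma card_p_on_line:
  assumes "P \<in> quadric q"
  shows "card {r \<in> {p}. r \<subseteq> \<kappa> P} = (if P \<in> gen1 q then 1 else 0)"
proof -
  have "{r \<in> {p}. r \<subseteq> \<kappa> P} = (if P \<in> gen1 q then {p} else {})" using gen1_iff[OF assms] by auto
  thus ?thesis by simp
qed

section \<open>The tactical decomposition\<close>

lemma points_on_lines:
  assumes C: "C \<in> {{p}, points_in \<pi>, PP s, PP (- s)}" and s: "s = 1 \<or> s = - 1"
    and T: "T \<in> {gen1 q, gen2 q, TT1, TT2}" and PR: "P \<in> T" "R \<in> T"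
  shows "card {r \<in> C. r \<subseteq> \<kappa> P} = card {r \<in> C. r \<subseteq> \<kappa> R}"
proof -
  have TQ: "T \<subseteq> quadric q"
    using T gen1_subset_quadric gen2_subset_quadric T1_subset_quadric T2_subset_quadric by auto
  have ms: "- s = 1 \<or> - s = - 1" using s by auto
  have dis: "T = gen1 q \<or> T \<inter> gen1 q = {}" "T = gen2 q \<or> T \<inter> gen2 q = {}"
    using T T1_disjoint gen1_gen2_disjoint by (auto simp: T2_def)
  consider "C = {p}" | "C = points_in \<pi>" | t where "C = PP t" "t = 1 \<or> t = - 1" using C s ms by blast
  thus ?thesis
  proof cases
    case 1
    have "P \<in> gen1 q \<longleftrightarrow> R \<in> gen1 q" using PR dis(1) by blast
    moreover have "P \<in> quadric q" "R \<in> quadric q" using PR TQ by blast+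
    ultimately show ?thesis unfolding 1 using card_p_on_line[of P] card_p_on_line[of R] by simp
  next
    case 2
    show ?thesis
    proof (cases "T = gen2 q")
      case True
      hence "card {r \<in> C. r \<subseteq> \<kappa> P} * (q - 1) = card {r \<in> C. r \<subseteq> \<kappa> R} * (q - 1)"
        unfolding 2 using PR card_\<pi>_on_gen2_line[of P] card_\<pi>_on_gen2_line[of R] by simp
      thus ?thesis using q_ge_9 by simp
    next
      case False
      hence "P \<notin> gen2 q" "R \<notin> gen2 q" using PR dis(2) by blast+
      moreover have "P \<in> quadric q" "R \<in> quadric q" using PR TQ by blast+
      ultimately show ?thesis unfolding 2 using card_\<pi>_on_line[of P] card_\<pi>_on_line[of R] by simp
    qed
  next
    case 3
    have adm: "2 * real (card {r \<in> PP t. r \<subseteq> \<kappa> X}) = real q + t * c"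
      if "X \<in> quadric q" "X \<notin> gen1 q" "X \<notin> gen2 q"
        "\<And>u v. admissible u v \<Longrightarrow> X = span_pt q (u, v) \<Longrightarrow> sg (Phi u v) = c" for X c
      using that(1)
    proof (cases rule: quadric_cases)
      case (other u v)
      thus ?thesis using card_PP_on_admissible_line[OF other(1) 3(2)] that(4)[of u v] by simp
    qed (use that in \<open>auto simp: gen1_def gen2_def\<close>)
    from T consider "T = gen1 q" | "T = gen2 q" | "T = TT1" | "T = TT2" by blast
    thus ?thesis
    proof cases
      case 1
      hence "2 * card {r \<in> C. r \<subseteq> \<kappa> P} = 2 * card {r \<in> C. r \<subseteq> \<kappa> R}"
        unfolding 3(1) using PR 3(2) card_PP_on_gen1_line[of P t] card_PP_on_gen1_line[of R t] by simp
      thus ?thesis by simp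
    next
      case 2
      hence PR': "P \<in> gen2 q" "R \<in> gen2 q" using PR by auto
      show ?thesis unfolding 3(1) card_PP_on_gen2_line[OF PR'(1)] card_PP_on_gen2_line[OF PR'(2)] ..
    next
      case T1: 3
      have "2 * real (card {r \<in> PP t. r \<subseteq> \<kappa> X}) = real q + t * \<gamma>" if "X \<in> T" for X
        using that T1 T1_disjoint TQ span_pt_in_T1_iff by (intro adm) auto
      from this[OF PR(1)] this[OF PR(2)] show ?thesis unfolding 3(1) by simp
    next
      case T2: 4
      have "2 * real (card {r \<in> PP t. r \<subseteq> \<kappa> X}) = real q + t * (- \<gamma>)" if X: "X \<in> T" for X
      proof (rule adm)
        show "X \<in> quadric q" "X \<notin> gen1 q" "X \<notin> gen2 q" using X T2 by (auto simp: T2_def)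
        show "sg (Phi u v) = - \<gamma>" if "admissible u v" "X = span_pt q (u, v)" for u v
          using that X T2 span_pt_in_T2_iff by simp
      qed
      from this[OF PR(1)] this[OF PR(2)] show ?thesis unfolding 3(1) by simp
    qed
  qed
qed

lemma lines_through_points:
  assumes C: "C \<in> {{p}, points_in \<pi>, PP s, PP (- s)}"
    and T: "T \<in> {gen1 q, gen2 q, TT1, TT2}" and rs: "r \<in> C" "r' \<in> C"
  shows "card {l \<in> \<kappa> ` T. r \<subseteq> l} = card {l \<in> \<kappa> ` T. r' \<subseteq> l}"
proof -
  have TQ: "T \<subseteq> quadric q"
    using T gen1_subset_quadric gen2_subset_quadric T1_subset_quadric T2_subset_quadric by auto
  have q1: "q - 1 > 0" using q_ge_9 by simp
  have V: "card (V x \<inter> T) = card (V x' \<inter> T)" if "x \<noteq> 0" "x' \<noteq> 0" for x x'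
  proof -
    consider "T = gen1 q" | "T = gen2 q" | "T = TT1" | "T = TT2" using T by blast
    thus ?thesis
    proof cases
      case 1
      thus ?thesis using that by (simp add: V_inter_gen1)
    next
      case 2
      have "card (V x \<inter> gen2 q) * (q - 1) = card (V x' \<inter> gen2 q) * (q - 1)"
        unfolding card_V_inter_gen2[OF that(1)] card_V_inter_gen2[OF that(2)] ..
      thus ?thesis using 2 q1 by simp
    next
      case 3
      thus ?thesis using card_V_inter(1)[OF that(1)] card_V_inter(1)[OF that(2)] by simp
    next
      case 4
      thus ?thesis using card_V_inter(2)[OF that(1)] card_V_inter(2)[OF that(2)] by simp
    qed
  qed
  have W: "card (W b \<inter> T) = card (W b' \<inter> T)" if b: "b \<noteq> 0" "b' \<noteq> 0" "sg (eta b) = sg (eta b')" for b b'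
  proof -
    consider "T = gen1 q" | "T = gen2 q" | "T = TT1" | "T = TT2" using T by blast
    thus ?thesis
    proof cases
      case 1
      thus ?thesis using b by (simp add: W_inter_gen1)
    next
      case 2
      thus ?thesis by (simp add: W_inter_gen2)
    next
      case 3
      thus ?thesis using card_W_inter(1)[OF b(1)] card_W_inter(1)[OF b(2)] b(3) by simp
    next
      case 4
      thus ?thesis using card_W_inter(2)[OF b(1)] card_W_inter(2)[OF b(2)] b(3) by simp
    qed
  qed
  consider "C = {p}" | "C = points_in \<pi>" | t where "C = PP t" using C by blast
  hence "card (K r \<inter> T) = card (K r' \<inter> T)"
  proof cases
    case 1
    thus ?thesis using rs by simp
  next
    case 2
    hence r: "r \<in> pg_points" "r \<subseteq> \<pi>" "r' \<in> pg_points" "r' \<subseteq> \<pi>" using rs by (auto simp: points_in_def)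
    obtain x where x: "x \<noteq> 0" "K r = V x" using ex_V r(1,2) by metis
    obtain x' where x': "x' \<noteq> 0" "K r' = V x'" using ex_V r(3,4) by metis
    show ?thesis unfolding x(2) x'(2) using x(1) x'(1) by (rule V)
  next
    case 3
    then obtain b b' where b: "b \<noteq> 0" "K r = W b" "sg (eta b) = t" "b' \<noteq> 0" "K r' = W b'" "sg (eta b') = t"
      using rs by (auto simp: PP_def)
    show ?thesis unfolding b(2,5) using b by (intro W) auto
  qed
  thus ?thesis by (simp only: card_lines_through[OF TQ])
qed

lemma T1_nonempty: "TT1 \<noteq> {}" and T2_nonempty: "TT2 \<noteq> {}"
proof -
  have "1 < q\<^sup>2" using q_ge_9 by (intro one_less_power) auto
  hence "q\<^sup>2 - 1 \<noteq> 0" by simp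
  hence "card (V 1 \<inter> TT1) \<noteq> 0" "card (V 1 \<inter> TT2) \<noteq> 0"
    using card_V_inter[of 1] by auto
  thus "TT1 \<noteq> {}" "TT2 \<noteq> {}" by auto
qed

lemma tactical:
  assumes s: "s = 1 \<or> s = - 1"
  shows "tactical_decomposition {{p}, points_in \<pi>, PP s, PP (- s)}
      {star p, lines_in \<pi>, \<kappa> ` TT1, \<kappa> ` TT2}"
    and "card {{p}, points_in \<pi>, PP s, PP (- s)} = 4"
    and "card {star p, lines_in \<pi>, \<kappa> ` TT1, \<kappa> ` TT2} = 4"
proof -
  have s': "- s = 1 \<or> - s = - 1" "s \<noteq> - s" using s by auto
  have pts: "{p} \<noteq> {}" "points_in \<pi> \<noteq> {}" "PP s \<noteq> {}" "PP (- s) \<noteq> {}"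
    "{p} \<inter> points_in \<pi> = {}" "{p} \<inter> PP s = {}" "{p} \<inter> PP (- s) = {}"
    "points_in \<pi> \<inter> PP s = {}" "points_in \<pi> \<inter> PP (- s) = {}" "PP s \<inter> PP (- s) = {}"
    using points_in_\<pi>_nonempty PP_nonempty[OF s] PP_nonempty[OF s'(1)] p_not_in_\<pi>
      PP_props PP_disjoint[OF s'(2)] by (auto simp: points_in_def)
  have TQ: "gen1 q \<subseteq> (quadric q :: ('k \<times> 'k) set set)" "gen2 q \<subseteq> (quadric q :: ('k \<times> 'k) set set)" "TT1 \<subseteq> quadric q" "TT2 \<subseteq> quadric q"
    using gen1_subset_quadric gen2_subset_quadric T1_subset_quadric T2_subset_quadric by auto
  have disj: "\<kappa> ` A \<inter> \<kappa> ` B = {}" if "A \<subseteq> quadric q" "B \<subseteq> quadric q" "A \<inter> B = {}" for A B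
    unfolding inj_on_image_Int[OF inj_\<kappa> that(1,2), symmetric] that(3) by (rule image_empty)
  have "gen1 q \<noteq> ({} :: ('k \<times> 'k) set set)" "gen2 q \<noteq> ({} :: ('k \<times> 'k) set set)"
    by (auto simp: gen1_def gen2_def intro: exI[of _ 1])
  hence ne: "\<kappa> ` gen1 q \<noteq> {}" "\<kappa> ` gen2 q \<noteq> {}" "\<kappa> ` TT1 \<noteq> {}" "\<kappa> ` TT2 \<noteq> {}"
    using T1_nonempty T2_nonempty by (simp_all only: image_is_empty not_False_eq_True)
  have dis: "gen1 q \<inter> TT1 = {}" "gen1 q \<inter> TT2 = {}" "gen2 q \<inter> TT1 = {}"
    "gen2 q \<inter> TT2 = {}" "TT1 \<inter> TT2 = {}"
    using T1_disjoint unfolding T2_def by blast+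
  note lns = ne disj[OF TQ(1,2) gen1_gen2_disjoint] disj[OF TQ(1,3) dis(1)] disj[OF TQ(1,4) dis(2)]
    disj[OF TQ(2,3) dis(3)] disj[OF TQ(2,4) dis(4)] disj[OF TQ(3,4) dis(5)]
  show "card {{p}, points_in \<pi>, PP s, PP (- s)} = 4" by (rule card_four_disjoint(1)[OF pts])
  show "card {star p, lines_in \<pi>, \<kappa> ` TT1, \<kappa> ` TT2} = 4"
    unfolding star_p[symmetric] lines_in_\<pi>[symmetric] by (rule card_four_disjoint(1)[OF lns])
  have "\<Union> {{p}, points_in \<pi>, PP s, PP (- s)} = pg_points"
  proof (intro equalityI subsetI)
    fix r :: "('f ^ 4) set" assume "r \<in> pg_points"
    thus "r \<in> \<Union> {{p}, points_in \<pi>, PP s, PP (- s)}" using s by (cases rule: pg_point_cases) auto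
  qed (use p in \<open>auto simp: points_in_def PP_def\<close>)
  hence 1: "partition_on pg_points {{p}, points_in \<pi>, PP s, PP (- s)}"
    using card_four_disjoint(2)[OF pts] pts by (auto simp: partition_on_def)
  have "gen1 q \<union> gen2 q \<union> TT1 \<union> TT2 = quadric q"
    using TQ unfolding T2_def by blast
  hence "\<kappa> ` gen1 q \<union> \<kappa> ` gen2 q \<union> \<kappa> ` TT1 \<union> \<kappa> ` TT2 = pg_lines"
    using bij_\<kappa> unfolding bij_betw_def image_Un[symmetric] by simp
  hence "\<Union> {\<kappa> ` gen1 q, \<kappa> ` gen2 q, \<kappa> ` TT1, \<kappa> ` TT2} = pg_lines" by auto
  hence 2: "partition_on pg_lines {\<kappa> ` gen1 q, \<kappa> ` gen2 q, \<kappa> ` TT1, \<kappa> ` TT2}"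
    using card_four_disjoint(2)[OF lns] lns unfolding partition_on_def by blast
  have LC: "\<exists>T\<in>{gen1 q, gen2 q, TT1, TT2}. D = \<kappa> ` T"
    if "D \<in> {\<kappa> ` gen1 q, \<kappa> ` gen2 q, \<kappa> ` TT1, \<kappa> ` TT2}" for D using that by blast
  show "tactical_decomposition {{p}, points_in \<pi>, PP s, PP (- s)}
      {star p, lines_in \<pi>, \<kappa> ` TT1, \<kappa> ` TT2}"
    unfolding star_p[symmetric] lines_in_\<pi>[symmetric] tactical_decomposition_def
  proof (intro conjI 1 2 ballI)
    fix C D l m assume C: "C \<in> {{p}, points_in \<pi>, PP s, PP (- s)}"
      and D: "D \<in> {\<kappa> ` gen1 q, \<kappa> ` gen2 q, \<kappa> ` TT1, \<kappa> ` TT2}" and lm: "l \<in> D" "m \<in> D"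
    obtain T where T: "T \<in> {gen1 q, gen2 q, TT1, TT2}" "D = \<kappa> ` T" using LC[OF D] by blast
    obtain P where P: "P \<in> T" "l = \<kappa> P" using lm(1) unfolding T(2) by (rule imageE)
    obtain R where R: "R \<in> T" "m = \<kappa> R" using lm(2) unfolding T(2) by (rule imageE)
    show "card {r \<in> C. r \<subseteq> l} = card {r \<in> C. r \<subseteq> m}"
      unfolding P(2) R(2) by (rule points_on_lines[OF C s T(1) P(1) R(1)])
  next
    fix C D r r' assume C: "C \<in> {{p}, points_in \<pi>, PP s, PP (- s)}"
      and D: "D \<in> {\<kappa> ` gen1 q, \<kappa> ` gen2 q, \<kappa> ` TT1, \<kappa> ` TT2}" and rs: "r \<in> C" "r' \<in> C"
    obtain T where T: "T \<in> {gen1 q, gen2 q, TT1, TT2}" "D = \<kappa> ` T" using LC[OF D] by blast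
    show "card {l \<in> D. r \<subseteq> l} = card {l \<in> D. r' \<subseteq> l}"
      unfolding T(2) by (rule lines_through_points[OF C T(1) rs])
  qed
qed

text \<open>The star count must separate this class from all other points: it is 0 at p, (q^2 - 1) /
  2 on \<pi>, and (q + 1)(q + \<gamma>) / 2 or (q + 1)(q - \<gamma>) / 2 elsewhere. These are
  distinct because the absolute value of \<gamma> is 3^e, at least 3 and less than q.\<close>

lemma PP_eq:
  assumes s: "s = 1 \<or> s = - 1"
  shows "PP s = {r \<in> pg_points. real (card (star r \<inter> \<kappa> ` TT1))
    = 1 / 2 * (3 ^ (2 * e) + 1) * (3 ^ (2 * e) + \<gamma> * s)}"
proof -
  define N where "N r = real (card (star r \<inter> \<kappa> ` TT1))" for r
  have N: "N r = real (card (K r \<inter> TT1))" for r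
    unfolding N_def by (simp only: card_star_inter[OF T1_subset_quadric])
  have q: "real q = 3 ^ (2 * e)" by (simp add: q_eq)
  define R where "R = (3::real) ^ e"
  have R: "R \<ge> 3" unfolding R_def using e_pos self_le_power[of "3::real" e] by simp
  have Q: "real q = R * R" by (simp add: q R_def mult_2 power_add)
  have \<gamma>s: "\<gamma> * s = R \<or> \<gamma> * s = - R" using \<gamma>_cases s by (auto simp: R_def)
  have lt: "R < R * R" using R by simp
  define c where "c = (real q + 1) * (real q + \<gamma> * s) / 2"
  have c1: "c \<noteq> 0"
  proof -
    have "real q + \<gamma> * s \<noteq> 0" using \<gamma>s lt Q R by auto
    thus ?thesis by (simp add: c_def add_eq_0_iff)
  qed
  have c2: "c \<noteq> (real q + 1) * (real q - 1) / 2"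
  proof
    assume "c = (real q + 1) * (real q - 1) / 2"
    hence "(real q + 1) * (real q + \<gamma> * s) = (real q + 1) * (real q - 1)" by (simp add: c_def)
    moreover have "real q + 1 \<noteq> 0" using Q R by (simp add: add_eq_0_iff)
    ultimately have "\<gamma> * s = - 1" by simp
    thus False using \<gamma>s R by auto
  qed
  have "N r = c \<longleftrightarrow> r \<in> PP s" if r: "r \<in> pg_points" for r
    using r
  proof (cases rule: pg_point_cases)
    case 1
    hence "N r = 0" unfolding N using K_p T1_disjoint by (simp add: Int_commute)
    thus ?thesis using c1 1 PP_props by auto
  next
    case 2
    hence r': "r \<in> pg_points" "r \<subseteq> \<pi>" by (auto simp: points_in_def)
    obtain x where x: "x \<noteq> 0" "K r = V x" using ex_V r' by metis
    have "2 * N r = real (q\<^sup>2 - 1)" unfolding N x(2) using card_V_inter(1)[OF x(1)] by (metis of_nat_mult of_nat_numeral)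
    also have "real (q\<^sup>2 - 1) = (real q + 1) * (real q - 1)"
      using q_ge_9 by (subst of_nat_diff) (auto simp: power2_eq_square algebra_simps)
    finally have "N r \<noteq> c" using c2 by simp
    thus ?thesis using r' PP_props by auto
  next
    case 3
    then obtain b where b: "b \<noteq> 0" "K r = W b" "sg (eta b) = 1" by (auto simp: PP_def)
    have Nr: "N r = (real q + 1) * (real q + \<gamma>) / 2"
      unfolding N b(2) using card_W_inter(1)[OF b(1)] b(3) by simp
    have "N r = c \<longleftrightarrow> s = 1"
      using s \<gamma>_nonzero unfolding Nr c_def by (auto simp: add_eq_0_iff)
    moreover have "r \<in> PP s \<longleftrightarrow> s = 1" using 3 PP_disjoint[of s 1] by auto
    ultimately show ?thesis by simp
  next
    case 4
    then obtain b where b: "b \<noteq> 0" "K r = W b" "sg (eta b) = - 1" by (auto simp: PP_def)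
    have Nr: "N r = (real q + 1) * (real q - \<gamma>) / 2"
      unfolding N b(2) using card_W_inter(1)[OF b(1)] b(3) by simp
    have "N r = c \<longleftrightarrow> s = - 1"
      using s \<gamma>_nonzero unfolding Nr c_def by (auto simp: add_eq_0_iff)
    moreover have "r \<in> PP s \<longleftrightarrow> s = - 1" using 4 PP_disjoint[of s "-1"] by auto
    ultimately show ?thesis by simp
  qed
  moreover have "c = 1 / 2 * (3 ^ (2 * e) + 1) * (3 ^ (2 * e) + \<gamma> * s)" by (simp add: c_def q)
  ultimately show ?thesis by (auto simp: N_def PP_def)
qed

end

theorem mainTheorem2:
  fixes e q :: nat
    and \<alpha> a1 :: "'k::{field,finite}"
    and \<kappa> :: "('k \<times> 'k) set \<Rightarrow> ('f::{field,finite} ^ 4) set"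
    and p \<pi> :: "('f ^ 4) set"
    and L1 L2 P1 P2 :: "('f ^ 4) set set"
  assumes "e > 0" and "q = 3 ^ (2 * e)"
    and "CARD('k) = q ^ 3" and "CARD('f) = q"
    and "primitive_element \<alpha>"
    and "a1 \<in> S_set q"
    and "klein_correspondence q \<kappa>"
    and "p \<in> pg_points" and "\<kappa> ` gen1 q = star p"
    and "\<pi> \<in> pg_planes" and "\<kappa> ` gen2 q = lines_in \<pi>"
    and "L1 = \<kappa> ` T1 q \<alpha> a1" and "L2 = \<kappa> ` T2 q \<alpha> a1"
    and "P1 = {r \<in> pg_points.
           real (card (star r \<inter> L1)) = 1 / 2 * (3 ^ (2 * e) + 1) * (3 ^ (2 * e) - 3 ^ e)}"
    and "P2 = {r \<in> pg_points.
           real (card (star r \<inter> L1)) = 1 / 2 * (3 ^ (2 * e) + 1) * (3 ^ (2 * e) + 3 ^ e)}"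
  shows "symmetric_tactical_decomposition
           {{p}, points_in \<pi>, P1, P2} {star p, lines_in \<pi>, L1, L2}
         \<and> card {{p}, points_in \<pi>, P1, P2} = 4
         \<and> card {star p, lines_in \<pi>, L1, L2} = 4"
proof -
  interpret klein_quadric e q \<alpha> a1 \<kappa> p \<pi>
    by unfold_locales (use assms in auto)
  \<comment> \<open>The sign for which \<open>\<gamma> * s\<close> is -(3^e), whichever sign
    \<open>\<gamma>\<close> has; \<open>P1\<close>, with the smaller count, is then
    \<open>PP s\<close>.\<close>
  define s :: real where "s = - \<gamma> / 3 ^ e"
  have s: "s = 1 \<or> s = - 1" "- s = 1 \<or> - s = - 1" "\<gamma> * s = - (3 ^ e)" "\<gamma> * - s = 3 ^ e"
    using \<gamma>_cases by (auto simp: s_def)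
  have "P1 = PP s" "P2 = PP (- s)"
    unfolding PP_eq[OF s(1)] PP_eq[OF s(2)] s(3,4) assms(12,14,15) by simp_all
  thus ?thesis
    using tactical[OF s(1)] by (simp add: assms(12,13) symmetric_tactical_decomposition_def)
qed

end
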